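(* Let $\phi_0$ be an even, $T_0=1/k_0$-periodic, strictly positive traveling wave solution, with wave speed $c_0>0$, of the conduit equation $$u_t+(u^2)_x-(u^2(u^{-1}u_t)_x)_x=0 .$$ Suppose that the set of nearby periodic traveling wave profiles $\phi$ with speed close to $c_0$ is a $3$-dimensional manifold parameterized by $(k,M(\phi),Q(\phi))$, where $1/k$ denotes the fundamental period of $\phi$. Then a necessary condition for $\phi_0$ to be spectrally stable is that the Whitham modulation system $$k_S+\partial_X(kc)=0,\qquad M_S=\partial_X\int_0^1\left(2k^2c\,\phi_\theta^2-\phi^2\right)d\theta,\qquad Q_S=\partial_X\int_0^1 2\ln|\phi|\,d\theta$$ be weakly hyperbolic at $(k_0,M(\phi_0),Q(\phi_0))$, in the sense that all of its characteristic speeds there are real.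
   Context: A traveling wave is a solution $u(x,t)=\phi(z)$, $z=x-ct$; its profile satisfies $-2cE=-c\phi+\phi^2+c\phi^2(\phi^{-1}\phi')'$ for some constant $E\in\mathbb R$. Profiles are normalized by translation to be even. Rescaling: a profile of fundamental period $T=1/k$ is also written as a $1$-periodic function of $\theta=kz$ (still denoted $\phi$), and then $$M(\phi)=\int_0^1\phi\,d\theta,\qquad Q(\phi)=\int_0^1\frac{\phi+k^2\phi_\theta^2}{\phi^2}\,d\theta .$$ The parameterization hypothesis means that the (even, rescaled) periodic profiles near $\phi_0$ with speeds near $c_0$ form a $C^1$ family $\phi(\theta;k,M,Q)$, with wave speed $c=c(k,M,Q)$, locally parameterized in a $C^1$ manner by $(k,M,Q)$ near $(k_0,M(\phi_0),Q(\phi_0))$. Characteristic speeds: in the Whitham system, $\phi=\phi(\theta;k,M,Q)$ and $c=c(k,M,Q)$ with $(k,M,Q)$ functions of slow variables $(X,S)$. By the chain rule the system is $(k,M,Q)^T_S=\mathbf D(\phi)\,(k,M,Q)^T_X$ with $$\mathbf D(\phi)=\begin{pmatrix}-(c+kc_k)&-kc_M&-kc_Q\\ \langle 1,2k^2c\phi_\theta^2-\phi^2\rangle_k&\langle 1,2k^2c\phi_\theta^2-\phi^2\rangle_M&\langle 1,2k^2c\phi_\theta^2-\phi^2\rangle_Q\\ \langle 1,2\ln|\phi|\rangle_k&\langle 1,2\ln|\phi|\rangle_M&\langle 1,2\ln|\phi|\rangle_Q\end{pmatrix},$$ where $\langle\cdot,\cdot\rangle$ is the $L^2_{\rm per}(0,1)$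 inner product in $\theta$ and the subscripts $k,M,Q$ denote partial derivatives. The characteristic speeds at a point are the eigenvalues of $\mathbf D$ at that point. Spectral stability: for a $T$-periodic profile $\phi=\phi(z)$ with speed $c$, let $$G[\phi]f=f+\phi''f-\phi f'',\qquad \mathcal L[\phi]f=cf-2\phi f-c\phi''f+2c\phi'f'-c\phi f'',$$ and $A[\phi]=G[\phi]^{-1}\partial_z\mathcal L[\phi]$, a closed, densely defined operator on $L^2(\mathbb R)$ (the linearization about $\phi$ of the conduit equation in the moving frame). The wave $\phi$ is spectrally unstable if the $L^2(\mathbb R)$-spectrum of $A[\phi]$ intersects $\{\lambda\in\mathbb C:\operatorname{Re}\lambda>0\}$, and spectrally stable otherwise. *)

theory Defs
  imports "HOL-Analysis.Analysis"
begin

section \<open>The conduit equation and its periodic traveling waves\<close>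

definition smooth :: "(real \<Rightarrow> real) \<Rightarrow> bool" where
  "smooth f \<longleftrightarrow> (\<forall>n x. (deriv ^^ n) f differentiable at x)"

text \<open>The first argument of \<open>u\<close> is \<open>x\<close>, the second is \<open>t\<close>. The term \<open>u\<^sup>-\<^sup>1\<close> in the equation
  requires \<open>u\<close> to have no zero.\<close>

definition conduit_equation :: "(real \<Rightarrow> real \<Rightarrow> real) \<Rightarrow> bool" where
  "conduit_equation u \<longleftrightarrow>
     (\<forall>x t. u x t \<noteq> 0) \<and>
     (\<forall>x t. deriv (\<lambda>s. u x s) t + deriv (\<lambda>y. (u y t)\<^sup>2) x
        - deriv (\<lambda>y. (u y t)\<^sup>2 * deriv (\<lambda>w. inverse (u w t) * deriv (\<lambda>s. u w s) t) y) x = 0)"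

text \<open>Smoothness makes every derivative in the equation a genuine one. It is no restriction on
  classical solutions: for \<open>c \<noteq> 0\<close> the profile equation is a second order ODE that can be solved for
  the highest derivative, with right-hand side smooth wherever the profile has no zero.\<close>

definition traveling_wave :: "real \<Rightarrow> (real \<Rightarrow> real) \<Rightarrow> bool" where
  "traveling_wave c \<phi> \<longleftrightarrow> smooth \<phi> \<and> conduit_equation (\<lambda>x t. \<phi> (x - c * t))"

definition even_fn :: "(real \<Rightarrow> real) \<Rightarrow> bool" where
  "even_fn f \<longleftrightarrow> (\<forall>x. f (- x) = f x)"

definition fundamental_period :: "(real \<Rightarrow> real) \<Rightarrow> real \<Rightarrow> bool" where
  "fundamental_period f T \<longleftrightarrow>
     0 < T \<and> (\<forall>x. f (x + T) = f x) \<and> (\<forall>S. 0 < S \<and> S < T \<longrightarrow> \<not> (\<forall>x. f (x + S) = f x))"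

text \<open>Below, \<open>\<psi>\<close> is a profile in the rescaled variable \<open>\<theta> = k z\<close>.\<close>

definition rescaled_profile :: "real \<Rightarrow> real \<Rightarrow> (real \<Rightarrow> real) \<Rightarrow> bool" where
  "rescaled_profile k c \<psi> \<longleftrightarrow>
     0 < k \<and> even_fn \<psi> \<and> fundamental_period \<psi> 1 \<and> traveling_wave c (\<lambda>z. \<psi> (k * z))"

definition M_of :: "(real \<Rightarrow> real) \<Rightarrow> real" where
  "M_of \<psi> = integral {0..1} \<psi>"

definition Q_of :: "real \<Rightarrow> (real \<Rightarrow> real) \<Rightarrow> real" where
  "Q_of k \<psi> = integral {0..1} (\<lambda>\<theta>. (\<psi> \<theta> + k\<^sup>2 * (deriv \<psi> \<theta>)\<^sup>2) / (\<psi> \<theta>)\<^sup>2)"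

definition kMQ :: "real \<Rightarrow> (real \<Rightarrow> real) \<Rightarrow> real ^ 3" where
  "kMQ k \<psi> = vector [k, M_of \<psi>, Q_of k \<psi>]"

section \<open>Local parameterization by \<open>(k, M, Q)\<close>\<close>

definition C1_on :: "('a::euclidean_space \<Rightarrow> real) \<Rightarrow> 'a set \<Rightarrow> bool" where
  "C1_on f U \<longleftrightarrow>
     (\<exists>f'. (\<forall>x\<in>U. (f has_derivative blinfun_apply (f' x)) (at x)) \<and> continuous_on U f')"

text \<open>A parameter \<open>p\<close> has components \<open>p $ 1 = k\<close>, \<open>p $ 2 = M\<close>, \<open>p $ 3 = Q\<close>. The second half of the
  definition says that the family contains every even periodic traveling wave close to the given
  one; applied to \<open>\<phi>\<^sub>0\<close> itself it makes \<open>\<phi>\<^sub>0\<close>, rescaled, the member at its own \<open>(k, M, Q)\<close>, with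
  speed \<open>c\<^sub>0\<close>.\<close>

definition parameterized_by_kMQ ::
    "(real \<Rightarrow> real) \<Rightarrow> real \<Rightarrow> real \<Rightarrow> (real ^ 3 \<Rightarrow> real \<Rightarrow> real) \<Rightarrow> (real ^ 3 \<Rightarrow> real) \<Rightarrow> bool" where
  "parameterized_by_kMQ \<phi>\<^sub>0 k\<^sub>0 c\<^sub>0 \<Phi> c \<longleftrightarrow>
     (\<exists>U. open U \<and> kMQ k\<^sub>0 (\<lambda>\<theta>. \<phi>\<^sub>0 (\<theta> / k\<^sub>0)) \<in> U \<and>
        C1_on (\<lambda>(\<theta>, p). \<Phi> p \<theta>) (UNIV \<times> U) \<and> C1_on c U \<and>
        (\<forall>p\<in>U. rescaled_profile (p $ 1) (c p) (\<Phi> p) \<and> kMQ (p $ 1) (\<Phi> p) = p) \<and>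
        (\<exists>\<delta>>0. \<forall>k s \<psi>.
           rescaled_profile k s \<psi> \<and> \<bar>k - k\<^sub>0\<bar> < \<delta> \<and> \<bar>s - c\<^sub>0\<bar> < \<delta> \<and>
           (\<forall>\<theta>. \<bar>\<psi> \<theta> - \<phi>\<^sub>0 (\<theta> / k\<^sub>0)\<bar> < \<delta>) \<longrightarrow>
           kMQ k \<psi> \<in> U \<and> \<Phi> (kMQ k \<psi>) = \<psi> \<and> c (kMQ k \<psi>) = s))"

section \<open>The Whitham modulation system\<close>

definition partial :: "3 \<Rightarrow> (real ^ 3 \<Rightarrow> real) \<Rightarrow> real ^ 3 \<Rightarrow> real" where
  "partial j F p = deriv (\<lambda>s. F (p + s *\<^sub>R axis j 1)) 0"

definition M_flux :: "(real ^ 3 \<Rightarrow> real \<Rightarrow> real) \<Rightarrow> (real ^ 3 \<Rightarrow> real) \<Rightarrow> real ^ 3 \<Rightarrow> real" where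
  "M_flux \<Phi> c p =
     integral {0..1} (\<lambda>\<theta>. 2 * (p $ 1)\<^sup>2 * c p * (deriv (\<Phi> p) \<theta>)\<^sup>2 - (\<Phi> p \<theta>)\<^sup>2)"

definition Q_flux :: "(real ^ 3 \<Rightarrow> real \<Rightarrow> real) \<Rightarrow> real ^ 3 \<Rightarrow> real" where
  "Q_flux \<Phi> p = integral {0..1} (\<lambda>\<theta>. 2 * ln \<bar>\<Phi> p \<theta>\<bar>)"

definition whitham_matrix ::
    "(real ^ 3 \<Rightarrow> real \<Rightarrow> real) \<Rightarrow> (real ^ 3 \<Rightarrow> real) \<Rightarrow> real ^ 3 \<Rightarrow> real ^ 3 ^ 3" where
  "whitham_matrix \<Phi> c p = vector
     [vector [- (c p + p $ 1 * partial 1 c p), - (p $ 1 * partial 2 c p), - (p $ 1 * partial 3 c p)],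
      vector [partial 1 (M_flux \<Phi> c) p, partial 2 (M_flux \<Phi> c) p, partial 3 (M_flux \<Phi> c) p],
      vector [partial 1 (Q_flux \<Phi>) p, partial 2 (Q_flux \<Phi>) p, partial 3 (Q_flux \<Phi>) p]]"

text \<open>The eigenvalues of the real matrix are taken in the complex numbers.\<close>

definition characteristic_speed ::
    "(real ^ 3 \<Rightarrow> real \<Rightarrow> real) \<Rightarrow> (real ^ 3 \<Rightarrow> real) \<Rightarrow> real ^ 3 \<Rightarrow> complex \<Rightarrow> bool" where
  "characteristic_speed \<Phi> c p \<mu> \<longleftrightarrow>
     (\<exists>v :: complex ^ 3. v \<noteq> 0 \<and>
        (\<chi> i j. complex_of_real (whitham_matrix \<Phi> c p $ i $ j)) *v v = \<mu> *s v)"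

definition weakly_hyperbolic ::
    "(real ^ 3 \<Rightarrow> real \<Rightarrow> real) \<Rightarrow> (real ^ 3 \<Rightarrow> real) \<Rightarrow> real ^ 3 \<Rightarrow> bool" where
  "weakly_hyperbolic \<Phi> c p \<longleftrightarrow> (\<forall>\<mu>. characteristic_speed \<Phi> c p \<mu> \<longrightarrow> \<mu> \<in> \<real>)"

section \<open>The linearized operator on \<open>L\<^sup>2(\<real>)\<close> and its spectrum\<close>

definition L2 :: "(real \<Rightarrow> complex) set" where
  "L2 = {f \<in> borel_measurable lborel. integrable lborel (\<lambda>x. (cmod (f x))\<^sup>2)}"

definition L2_norm :: "(real \<Rightarrow> complex) \<Rightarrow> real" where
  "L2_norm f = sqrt (LINT x|lborel. (cmod (f x))\<^sup>2)"

text \<open>Distributions are represented by their action on real test functions; derivatives and products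
  with smooth functions are the usual ones. In this way the differential expressions \<open>G[\<phi>]\<close> and
  \<open>\<L>[\<phi>]\<close> apply to every element of \<open>L\<^sup>2(\<real>)\<close>.\<close>

definition test_function :: "(real \<Rightarrow> real) \<Rightarrow> bool" where
  "test_function \<eta> \<longleftrightarrow> smooth \<eta> \<and> (\<exists>R. \<forall>x. R < \<bar>x\<bar> \<longrightarrow> \<eta> x = 0)"

type_synonym distribution = "(real \<Rightarrow> real) \<Rightarrow> complex"

definition dist_of :: "(real \<Rightarrow> complex) \<Rightarrow> distribution" where
  "dist_of f = (\<lambda>\<eta>. LINT x|lborel. f x * complex_of_real (\<eta> x))"

definition D_dist :: "distribution \<Rightarrow> distribution" where
  "D_dist F = (\<lambda>\<eta>. - F (deriv \<eta>))"

definition mult_dist :: "(real \<Rightarrow> real) \<Rightarrow> distribution \<Rightarrow> distribution" where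
  "mult_dist a F = (\<lambda>\<eta>. F (\<lambda>x. a x * \<eta> x))"

definition G_op :: "(real \<Rightarrow> real) \<Rightarrow> distribution \<Rightarrow> distribution" where
  "G_op \<phi> F = (\<lambda>\<eta>. F \<eta> + mult_dist (deriv (deriv \<phi>)) F \<eta> - mult_dist \<phi> (D_dist (D_dist F)) \<eta>)"

definition L_op :: "real \<Rightarrow> (real \<Rightarrow> real) \<Rightarrow> distribution \<Rightarrow> distribution" where
  "L_op c \<phi> F = (\<lambda>\<eta>.
     complex_of_real c * F \<eta>
     - 2 * mult_dist \<phi> F \<eta>
     - complex_of_real c * mult_dist (deriv (deriv \<phi>)) F \<eta>
     + 2 * complex_of_real c * mult_dist (deriv \<phi>) (D_dist F) \<eta>
     - complex_of_real c * mult_dist \<phi> (D_dist (D_dist F)) \<eta>)"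

text \<open>The graph of \<open>A[\<phi>] = G[\<phi>]\<^sup>-\<^sup>1 \<partial>\<^sub>z \<L>[\<phi>]\<close>: \<open>g = A[\<phi>] f\<close> means \<open>G[\<phi>] g = \<partial>\<^sub>z \<L>[\<phi>] f\<close> as
  distributions. For a positive periodic profile \<open>\<phi>\<close>, \<open>G[\<phi>]\<close> is injective on \<open>L\<^sup>2(\<real>)\<close>, so this is
  the graph of an operator (modulo null sets); its domain is \<open>H\<^sup>1(\<real>)\<close>, and it is closed and is the
  closure of its restriction to \<open>H\<^sup>3(\<real>)\<close>, where \<open>\<partial>\<^sub>z \<L>[\<phi>] f\<close> lies in \<open>L\<^sup>2(\<real>)\<close>.\<close>

definition A_graph :: "real \<Rightarrow> (real \<Rightarrow> real) \<Rightarrow> ((real \<Rightarrow> complex) \<times> (real \<Rightarrow> complex)) set" where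
  "A_graph c \<phi> = {(f, g). f \<in> L2 \<and> g \<in> L2 \<and>
     (\<forall>\<eta>. test_function \<eta> \<longrightarrow> G_op \<phi> (dist_of g) \<eta> = D_dist (L_op c \<phi> (dist_of f)) \<eta>)}"

text \<open>For an operator given by its graph: \<open>\<mu>\<close> is in the resolvent set if \<open>A - \<mu>\<close> is onto and
  has a bounded inverse; the bound includes injectivity.\<close>

definition L2_resolvent_set :: "((real \<Rightarrow> complex) \<times> (real \<Rightarrow> complex)) set \<Rightarrow> complex set" where
  "L2_resolvent_set A = {\<mu>.
     (\<forall>h\<in>L2. \<exists>(f, g)\<in>A. AE x in lborel. g x - \<mu> * f x = h x) \<and>
     (\<exists>C. \<forall>(f, g)\<in>A. L2_norm f \<le> C * L2_norm (\<lambda>x. g x - \<mu> * f x))}"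

definition L2_spectrum :: "((real \<Rightarrow> complex) \<times> (real \<Rightarrow> complex)) set \<Rightarrow> complex set" where
  "L2_spectrum A = - L2_resolvent_set A"

definition spectrally_unstable :: "real \<Rightarrow> (real \<Rightarrow> real) \<Rightarrow> bool" where
  "spectrally_unstable c \<phi> \<longleftrightarrow> L2_spectrum (A_graph c \<phi>) \<inter> {\<mu>. 0 < Re \<mu>} \<noteq> {}"

definition spectrally_stable :: "real \<Rightarrow> (real \<Rightarrow> real) \<Rightarrow> bool" where
  "spectrally_stable c \<phi> \<longleftrightarrow> \<not> spectrally_unstable c \<phi>"

end

theory Submission
  imports Defs "HOL-Complex_Analysis.Complex_Analysis"
begin

text \<open>In terms of \<open>u = f / \<phi>\<close> the spectral problem \<open>\<partial>\<^sub>z \<L>[\<phi>] f = \<mu> G[\<phi>] f\<close> is a periodic linear system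
  of three first order equations. If it has a Floquet multiplier on the unit circle, then so has the
  adjoint system, and cutting off the corresponding bounded adjoint solution contradicts a resolvent
  bound; so \<open>\<mu>\<close> lies in the \<open>L\<^sup>2\<close> spectrum.

  For \<open>\<mu> = \<xi> \<Lambda>\<close>, multiplier \<open>exp (\<i> \<xi> T)\<close> and \<open>\<xi> \<rightarrow> 0\<close>, the solutions of the system are
  \<open>- (c\<^sub>b / \<mu>) (ln \<phi>)' + \<omega>\<^sub>b + O(\<mu>)\<close> with \<open>b\<close> a complex direction in parameter space, \<open>c\<^sub>b\<close> the derivative
  of the wave speed, and \<open>\<omega>\<^sub>b\<close> that of \<open>ln \<phi>\<close>. Expressing the Floquet condition through the derivative of
  \<open>u\<close> and the fluxes of the two conservation laws turns it, in the limit, into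
  \<open>(\<^bold>D + c) b = - \<i> \<Lambda> b\<close>. By Hurwitz' theorem, an eigenvalue of \<open>\<^bold>D\<close> with negative imaginary part thus
  produces spectrum with positive real part, and non-real eigenvalues come in conjugate pairs.\<close>

text \<open>Two obstacles shape the development. The family is only jointly C1 in \<theta> and the
  parameter, while \<open>Q_of\<close> and \<open>M_flux\<close> contain the \<theta>-derivative of
  the profile, whose dependence on the parameter is not known to be differentiable. The constants
  \<open>E\<close> and \<open>H\<close> of the profile equation are therefore expressed by integrals
  of 1/\<psi> and 1/\<psi>^2, by \<psi>(0) and by c, and both fluxes are algebraic in c,
  \<open>E\<close>, \<open>H\<close>, M and Q. The profile equation is used in twice integrated
  form: differentiated in the parameter, it yields the \<theta>-regularity of the variation
  afterwards. Secondly, the graph of A is given through test functions. Cutting off the adjoint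
  solution produces a test function directly, so no inverse of G has to be constructed. No
  asymptotic series is estimated either: the correction \<open>corr\<close> solves an inhomogeneous
  system exactly, so the waves are true solutions for every \<mu> \<noteq> 0, and the rescaled
  boundary determinant is holomorphic in \<Lambda> and continuous down to \<xi> = 0.\<close>

no_notation fps_nth (infixl "$" 75)

section \<open>Smooth functions and test functions\<close>

lemma smooth_has_deriv: "smooth f \<Longrightarrow> (f has_real_derivative deriv f x) (at x)"
  unfolding smooth_def using DERIV_deriv_iff_real_differentiable by (metis funpow_0)

lemma smooth_deriv: "smooth f \<Longrightarrow> smooth (deriv f)"
  unfolding smooth_def by (metis funpow_simps_right(2) comp_apply)

text \<open>A set closed under differentiation contains all iterated derivatives of its members.
  Naming such a set replaces an induction over the order of the derivative.\<close>

lemma smooth_coinduct: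
  assumes "f \<in> S" and "\<And>f. f \<in> S \<Longrightarrow> \<exists>f'\<in>S. \<forall>x. (f has_real_derivative f' x) (at x)"
  shows "smooth f"
proof -
  have deriv_in: "deriv g \<in> S" and diff: "g differentiable at x" if "g \<in> S" for g x
  proof -
    from assms(2)[OF that] obtain g' where g': "g' \<in> S" "\<And>x. (g has_real_derivative g' x) (at x)"
      by blast
    then have "deriv g = g'"
      by (simp add: DERIV_imp_deriv ext)
    with g' show "deriv g \<in> S" "g differentiable at x"
      by (auto simp: real_differentiable_def)
  qed
  have "(deriv ^^ n) f \<in> S" for n
    by (induction n) (use assms(1) deriv_in in auto)
  then show ?thesis
    unfolding smooth_def using diff by blast
qed

text \<open>Invariant for functions known only through a differential equation: \<open>B\<close>
  holds functions not yet known to be smooth, and their derivatives only have to be polynomials in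
  \<open>B\<close> with smooth coefficients. This covers 1/f and the solutions of linear
  systems.\<close>

inductive_set smooth_alg :: "(real \<Rightarrow> real) set \<Rightarrow> (real \<Rightarrow> real) set" for B where
  base: "f \<in> B \<Longrightarrow> f \<in> smooth_alg B"
| smth: "smooth f \<Longrightarrow> f \<in> smooth_alg B"
| add: "f \<in> smooth_alg B \<Longrightarrow> g \<in> smooth_alg B \<Longrightarrow> (\<lambda>x. f x + g x) \<in> smooth_alg B"
| mult: "f \<in> smooth_alg B \<Longrightarrow> g \<in> smooth_alg B \<Longrightarrow> (\<lambda>x. f x * g x) \<in> smooth_alg B"

text \<open>By the sum and product rules the algebra is closed under differentiation as soon as the
  derivatives of its generators stay inside.\<close>

lemma smooth_smooth_alg:
  assumes B: "\<And>f. f \<in> B \<Longrightarrow> \<exists>f'\<in>smooth_alg B. \<forall>x. (f has_real_derivative f' x) (at x)"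
    and "f \<in> smooth_alg B"
  shows "smooth f"
  using assms(2)
proof (rule smooth_coinduct)
  fix f assume "f \<in> smooth_alg B"
  then show "\<exists>f'\<in>smooth_alg B. \<forall>x. (f has_real_derivative f' x) (at x)"
  proof induction
    case (base f)
    then show ?case using B by blast
  next
    case (smth f)
    then show ?case using smooth_has_deriv smooth_deriv smooth_alg.smth by blast
  next
    case (add f g)
    then obtain f' g' where "f' \<in> smooth_alg B" "g' \<in> smooth_alg B"
      "\<And>x. (f has_real_derivative f' x) (at x)" "\<And>x. (g has_real_derivative g' x) (at x)"
      by blast
    then show ?case
      by (intro bexI[of _ "\<lambda>x. f' x + g' x"]) (auto intro: smooth_alg.add derivative_intros)
  next
    case (mult f g)
    then obtain f' g' where "f' \<in> smooth_alg B" "g' \<in> smooth_alg B"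
      "\<And>x. (f has_real_derivative f' x) (at x)" "\<And>x. (g has_real_derivative g' x) (at x)"
      by blast
    with mult.hyps show ?case
      by (intro bexI[of _ "\<lambda>x. f' x * g x + g' x * f x"])
        (auto intro!: smooth_alg.add smooth_alg.mult intro: DERIV_mult)
  qed
qed

lemma smooth_add: "smooth f \<Longrightarrow> smooth g \<Longrightarrow> smooth (\<lambda>x. f x + g x)"
  and smooth_mult: "smooth f \<Longrightarrow> smooth g \<Longrightarrow> smooth (\<lambda>x. f x * g x)"
  by (rule smooth_smooth_alg[of "{}"]; auto intro: smooth_alg.intros)+

lemma smooth_const: "smooth (\<lambda>x. a)"
  by (rule smooth_coinduct[of _ "range (\<lambda>a x. a)"]) (auto intro!: exI[of _ 0] derivative_eq_intros)

lemma smooth_ident: "smooth (\<lambda>x. x)"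
  by (rule smooth_coinduct[of _ "insert (\<lambda>x. x) (range (\<lambda>a x. a))"])
    (auto intro!: derivative_eq_intros)

lemma smooth_minus: "smooth f \<Longrightarrow> smooth (\<lambda>x. - f x)"
  using smooth_mult[OF smooth_const[of "-1"]] by simp

lemma smooth_diff: "smooth f \<Longrightarrow> smooth g \<Longrightarrow> smooth (\<lambda>x. f x - g x)"
  using smooth_add[OF _ smooth_minus] by simp

lemma smooth_power: "smooth f \<Longrightarrow> smooth (\<lambda>x. f x ^ n)"
  by (induction n) (auto intro: smooth_const smooth_mult)

lemma smooth_inverse:
  assumes "smooth f" "\<And>x. f x \<noteq> 0"
  shows "smooth (\<lambda>x. inverse (f x))"
proof (rule smooth_smooth_alg[of "{\<lambda>x. inverse (f x)}"])
  let ?B = "{\<lambda>x. inverse (f x)}"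
  have "(\<lambda>x. - deriv f x * (inverse (f x) * inverse (f x))) \<in> smooth_alg ?B"
    by (intro smooth_alg.mult[of "\<lambda>x. - deriv f x"] smooth_alg.mult)
      (auto intro: smooth_alg.base smooth_alg.smth smooth_minus smooth_deriv assms)
  then show "\<exists>f'\<in>smooth_alg ?B. \<forall>x. (g has_real_derivative f' x) (at x)" if "g \<in> ?B" for g
    using that assms smooth_has_deriv[OF assms(1)]
    by (auto intro!: bexI[of _ "\<lambda>x. - deriv f x * (inverse (f x) * inverse (f x))"]
        derivative_eq_intros)
qed (auto intro: smooth_alg.base)

lemma smooth_divide:
  "smooth f \<Longrightarrow> smooth g \<Longrightarrow> (\<And>x. g x \<noteq> 0) \<Longrightarrow> smooth (\<lambda>x. f x / g x)"
  by (simp add: divide_inverse smooth_mult smooth_inverse)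

lemma smooth_affine:
  assumes "smooth f"
  shows "smooth (\<lambda>x. f (a * x + b))"
proof (rule smooth_coinduct)
  let ?S = "{\<lambda>x. r * g (a * x + b) | g r. smooth g}"
  show "(\<lambda>x. f (a * x + b)) \<in> ?S"
    using assms by (auto intro!: exI[of _ f] exI[of _ 1])
  fix h assume "h \<in> ?S"
  then obtain g r where g: "smooth g" and h: "h = (\<lambda>x. r * g (a * x + b))" by auto
  show "\<exists>f'\<in>?S. \<forall>x. (h has_real_derivative f' x) (at x)"
    unfolding h
    apply (rule bexI[of _ "\<lambda>x. (r * a) * deriv g (a * x + b)"])
    using smooth_deriv[OF g]
    by (auto intro!: derivative_eq_intros DERIV_chain2[OF smooth_has_deriv[OF g]])
qed

lemmas smooth_intros = smooth_add smooth_mult smooth_const smooth_ident smooth_minus smooth_diff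
  smooth_power smooth_inverse smooth_divide smooth_deriv

lemma smooth_continuous: "smooth f \<Longrightarrow> continuous_on A f"
  by (meson DERIV_isCont continuous_at_imp_continuous_on smooth_has_deriv)

section \<open>A smooth cut-off function\<close>

lemma poly_times_exp_minus_tendsto_0: "((\<lambda>y. poly p y * exp (- y)) \<longlongrightarrow> (0::real)) at_top"
proof (induction p)
  case 0
  then show ?case by simp
next
  case (pCons a p)
  define q where "q = pCons a p"
  have eq: "poly q y * exp (- y) = (\<Sum>i\<le>degree q. coeff q i * (y ^ i * exp (- y)))" for y
    by (simp add: poly_altdef sum_distrib_right mult.assoc)
  have "((\<lambda>y::real. y ^ i * exp (- y)) \<longlongrightarrow> 0) at_top" for i
    using tendsto_power_div_exp_0[of i] by (simp add: exp_minus divide_inverse)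
  then have "((\<lambda>y. \<Sum>i\<le>degree q. coeff q i * (y ^ i * exp (- y))) \<longlongrightarrow> (\<Sum>i\<le>degree q. coeff q i * 0)) at_top"
    by (intro tendsto_intros)
  then show ?case
    by (simp add: eq flip: q_def)
qed

definition flat :: "real \<Rightarrow> real" where
  "flat x = (if 0 < x then exp (- inverse x) else 0)"

lemma smooth_flat: "smooth flat"
proof (rule smooth_coinduct)
  define F where "F p = (\<lambda>x::real. if 0 < x then poly p (inverse x) * exp (- inverse x) else 0)" for p
  show "flat \<in> range F"
    by (rule range_eqI[of _ _ 1]) (simp add: F_def flat_def fun_eq_iff)
  fix f assume "f \<in> range F"
  then obtain p where f: "f = F p" by auto
  \<comment> \<open>With y = 1/x one has dy/dx = - y^2, so p(y) exp(-y) has the x-derivative y^2 (p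
    - p')(y) exp(-y).\<close>
  define q where "q = monom 1 2 * (p - pderiv p)"
  have "(F p has_real_derivative F q x) (at x)" for x
  proof (cases x "0::real" rule: linorder_cases)
    case less
    have "((\<lambda>x. 0) has_real_derivative F q x) (at x)"
      using less by (simp add: F_def)
    then show ?thesis
      by (rule has_field_derivative_transform_within_open[of _ _ _ "{..<0}"])
        (use less in \<open>auto simp: F_def\<close>)
  next
    case greater
    have "((\<lambda>x. poly p (inverse x) * exp (- inverse x)) has_real_derivative F q x) (at x)"
      using greater unfolding F_def q_def
      by (auto intro!: derivative_eq_intros DERIV_chain2[OF poly_DERIV]
          simp: poly_monom field_simps power2_eq_square)
    then show ?thesis
      by (rule has_field_derivative_transform_within_open[of _ _ _ "{0<..}"])
        (use greater in \<open>auto simp: F_def\<close>)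
  next
    case equal
    \<comment> \<open>The difference quotient at 0 is y p(y) exp(-y) with y = 1/h;
      \<open>pCons 0 p\<close> supplies the extra factor y.\<close>
    have "((\<lambda>h. poly (pCons 0 p) (inverse h) * exp (- inverse h)) \<longlongrightarrow> 0) (at_right 0)"
      using filterlim_compose[OF poly_times_exp_minus_tendsto_0 filterlim_inverse_at_top_right] .
    then have "((\<lambda>h. F p h / h) \<longlongrightarrow> 0) (at_right 0)"
      by (rule Lim_transform_eventually)
        (auto simp: eventually_at_right_less F_def divide_inverse mult_ac
          intro!: eventually_mono[OF eventually_at_right_less])
    moreover have "((\<lambda>h. F p h / h) \<longlongrightarrow> 0) (at_left 0)"
      by (rule Lim_transform_eventually[of "\<lambda>_. 0"])
        (auto simp: F_def eventually_at intro!: exI[of _ 1])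
    ultimately have "((\<lambda>h. F p h / h) \<longlongrightarrow> 0) (at 0)"
      by (simp add: filterlim_at_split)
    then show ?thesis
      using equal by (simp add: has_field_derivative_iff F_def)
  qed
  then show "\<exists>f'\<in>range F. \<forall>x. (f has_real_derivative f' x) (at x)"
    using f by blast
qed

text \<open>The factors 1 and -1 are kept so that both arguments have literally the form treated by
  \<open>smooth_affine\<close>.\<close>

definition bump :: "real \<Rightarrow> real" where
  "bump x = flat (1 * x + 1) * flat ((-1) * x + 1)"

lemma smooth_bump: "smooth bump"
  unfolding bump_def[abs_def] by (intro smooth_mult smooth_affine smooth_flat)

lemma bump_eq_0: "1 \<le> \<bar>x\<bar> \<Longrightarrow> bump x = 0"
  by (auto simp: bump_def flat_def)

lemma bump_ge_0: "0 \<le> bump x"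
  by (simp add: bump_def flat_def)

lemma bump_pos: "\<bar>x\<bar> < 1 \<Longrightarrow> 0 < bump x"
  by (auto simp: bump_def flat_def)

section \<open>Linear ordinary differential equations\<close>

lemma bounded_bilinear_matrix_vector_mult:
  "bounded_bilinear ((*v) :: complex^'n^'m \<Rightarrow> complex^'n \<Rightarrow> complex^'m)"
proof -
  have "bilinear ((*v) :: complex^'n^'m \<Rightarrow> complex^'n \<Rightarrow> complex^'m)"
    unfolding bilinear_def
    by (auto intro!: linearI simp: matrix_vector_mult_def vec_eq_iff algebra_simps sum.distrib
        scaleR_sum_right)
  then show ?thesis
    by (simp add: bilinear_conv_bounded_bilinear)
qed

lemma has_vector_derivative_vecI:
  fixes Y :: "real \<Rightarrow> complex^'n"
  assumes "\<And>i. ((\<lambda>t. Y t $ i) has_vector_derivative Y' $ i) (at t)"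
  shows "(Y has_vector_derivative Y') (at t)"
  using assms unfolding has_vector_derivative_def has_derivative_at_within
  by (auto intro!: bounded_linear_scaleR_left vec_tendstoI)

lemmas has_vector_derivative_vec_nth =
  bounded_linear.has_vector_derivative[OF bounded_linear_vec_nth]

text \<open>The squared norm is differentiable where the norm need not be, so |Y|^2 + e^2 is
  compared with an exponential. Absorbing 2 |Y| e \<le> |Y|^2 + e^2 costs the extra 1 in the rate
  \<open>K + 1\<close>.\<close>

lemma gronwall:
  fixes Y Y' :: "real \<Rightarrow> 'a::real_inner"
  assumes Y: "\<And>t. 0 \<le> t \<Longrightarrow> t \<le> T \<Longrightarrow> (Y has_vector_derivative Y' t) (at t)"
    and Y0: "Y 0 = 0"
    and bnd: "\<And>t. 0 \<le> t \<Longrightarrow> t \<le> T \<Longrightarrow> norm (Y' t) \<le> K * norm (Y t) + e"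
    and "0 \<le> K" "0 \<le> e" "0 \<le> t" "t \<le> T"
  shows "norm (Y t) \<le> e * exp ((K + 1) * t)"
proof -
  define g where "g = (\<lambda>t. exp (- (2 * (K + 1) * t)) * (Y t \<bullet> Y t + e\<^sup>2))"
  define g' where "g' = (\<lambda>t. exp (- (2 * (K + 1) * t)) *
    (2 * (Y t \<bullet> Y' t) - 2 * (K + 1) * (Y t \<bullet> Y t + e\<^sup>2)))"
  have "(g has_real_derivative g' s) (at s)" if "0 \<le> s" "s \<le> T" for s
  proof -
    have "((\<lambda>t. Y t \<bullet> Y t) has_vector_derivative (Y s \<bullet> Y' s + Y' s \<bullet> Y s)) (at s)"
      using bounded_bilinear.has_vector_derivative[OF bounded_bilinear_inner Y[OF that] Y[OF that]] .
    then have "((\<lambda>t. Y t \<bullet> Y t) has_real_derivative 2 * (Y s \<bullet> Y' s)) (at s)"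
      by (simp add: has_real_derivative_iff_has_vector_derivative inner_commute)
    then show ?thesis
      unfolding g_def g'_def by (auto intro!: derivative_eq_intros simp: algebra_simps)
  qed
  moreover have "g' s \<le> 0" if "0 \<le> s" "s \<le> T" for s
  proof -
    have "Y s \<bullet> Y' s \<le> norm (Y s) * (K * norm (Y s) + e)"
      using bnd[OF that] norm_cauchy_schwarz[of "Y s" "Y' s"]
      by (meson mult_left_mono norm_ge_zero order_trans)
    moreover have "2 * (norm (Y s) * e) \<le> (norm (Y s))\<^sup>2 + e\<^sup>2"
      using sum_squares_bound[of "norm (Y s)" e] by (simp add: mult_ac)
    moreover have "0 \<le> (norm (Y s))\<^sup>2 + e\<^sup>2 + 2 * K * e\<^sup>2"
      using \<open>0 \<le> K\<close> by simp
    ultimately have "2 * (Y s \<bullet> Y' s) \<le> 2 * (K + 1) * (Y s \<bullet> Y s + e\<^sup>2)"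
      unfolding dot_square_norm by (simp add: algebra_simps power2_eq_square)
    then show ?thesis
      unfolding g'_def by (simp add: mult_nonneg_nonpos)
  qed
  ultimately have "g t \<le> g 0"
    using DERIV_nonpos_imp_nonincreasing[of 0 t g] \<open>0 \<le> t\<close> \<open>t \<le> T\<close>
    by (meson order_trans)
  then have "exp (- (2 * (K + 1) * t)) * ((norm (Y t))\<^sup>2 + e\<^sup>2) \<le> e\<^sup>2"
    by (simp add: g_def Y0 dot_square_norm)
  then have "inverse (exp (2 * (K + 1) * t)) * ((norm (Y t))\<^sup>2 + e\<^sup>2) \<le> e\<^sup>2"
    by (simp only: exp_minus)
  then have "(norm (Y t))\<^sup>2 + e\<^sup>2 \<le> exp (2 * (K + 1) * t) * e\<^sup>2"
    by (simp only: inverse_eq_divide mult_1_left times_divide_eq_left divide_le_eq exp_gt_zero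
        if_True mult.commute)
  also have "\<dots> = (e * exp ((K + 1) * t))\<^sup>2"
    by (simp add: power_mult_distrib mult_ac flip: exp_double)
  finally have "(norm (Y t))\<^sup>2 \<le> (e * exp ((K + 1) * t))\<^sup>2"
    by (smt (verit) zero_le_power2)
  then show ?thesis
    using \<open>0 \<le> e\<close> by (simp add: power2_le_iff_abs_le)
qed

text \<open>Each integration gains a power of |t| and a factor 1/(n + 1); iterated, this gives the
  factorial in the Picard bound. Negative t is reduced to positive t by reflection.\<close>

lemma norm_antiderivative_le:
  fixes F :: "real \<Rightarrow> 'a::real_normed_vector"
  assumes F: "\<And>s. (F has_vector_derivative f s) (at s)" and F0: "F 0 = 0"
    and bnd: "\<And>s. \<bar>s\<bar> \<le> R \<Longrightarrow> norm (f s) \<le> a * \<bar>s\<bar> ^ n" and t: "\<bar>t\<bar> \<le> R"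
  shows "norm (F t) \<le> a * \<bar>t\<bar> ^ Suc n / Suc n"
proof -
  have *: "norm (G t) \<le> a * t ^ Suc n / Suc n"
    if G: "\<And>s. (G has_vector_derivative g s) (at s)" and "G 0 = 0"
      and g: "\<And>s. \<bar>s\<bar> \<le> R \<Longrightarrow> norm (g s) \<le> a * \<bar>s\<bar> ^ n" and "0 < t" "t \<le> R"
    for G g t
  proof -
    have "norm (G t - G 0) \<le> a * t ^ Suc n / Suc n - a * 0 ^ Suc n / Suc n"
    proof (rule differentiable_bound_general[where f' = g and \<phi>' = "\<lambda>s. a * s ^ n"])
      show "continuous_on {0..t} G"
        using G has_vector_derivative_continuous continuous_at_imp_continuous_on by blast
      show "((\<lambda>s. a * s ^ Suc n / real (Suc n)) has_vector_derivative a * x ^ n) (at x)" for x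
        unfolding has_real_derivative_iff_has_vector_derivative[symmetric]
        by (auto intro!: derivative_eq_intros simp del: of_nat_Suc power_Suc)
    qed (use that in \<open>auto intro!: continuous_intros G g[THEN order_trans]\<close>)
    then show ?thesis using \<open>G 0 = 0\<close> by simp
  qed
  consider "t = 0" | "t > 0" | "t < 0" by linarith
  then show ?thesis
  proof cases
    case 1
    then show ?thesis using F0 by simp
  next
    case 2
    then show ?thesis using *[OF F F0 bnd, of t] t by simp
  next
    case 3
    have "((\<lambda>s. F (- s)) has_vector_derivative - f (- s)) (at s)" for s
    proof -
      have "((\<lambda>s. - s) has_vector_derivative - 1) (at s)"
        by (auto intro!: derivative_eq_intros)
      from vector_diff_chain_at[OF this F] show ?thesis
        by (simp add: o_def)
    qed
    from *[OF this, of "- t"] show ?thesis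
      using 3 F0 bnd[of "- s" for s] t by simp
  qed
qed

lemma continuous_bounded_interval:
  fixes f :: "real \<Rightarrow> 'a::real_normed_vector"
  assumes "continuous_on UNIV f"
  shows "\<exists>C>0. \<forall>t. \<bar>t\<bar> \<le> R \<longrightarrow> norm (f t) \<le> C"
proof -
  have "bounded (f ` {-R..R})"
    by (intro compact_imp_bounded compact_continuous_image continuous_on_subset[OF assms]) auto
  then obtain C where "0 < C" "\<forall>x\<in>{-R..R}. norm (f x) \<le> C"
    unfolding bounded_pos by auto
  then show ?thesis by (auto simp: abs_le_iff)
qed

lemma has_vector_derivative_imp_continuous_on:
  "(\<And>x. (f has_vector_derivative f' x) (at x)) \<Longrightarrow> continuous_on A f"
  by (meson continuous_at_imp_continuous_on has_vector_derivative_continuous)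

lemma continuous_antiderivative:
  fixes g :: "real \<Rightarrow> 'a::euclidean_space"
  assumes "continuous_on UNIV g"
  shows "\<exists>F. F 0 = 0 \<and> (\<forall>t. (F has_vector_derivative g t) (at t))"
proof -
  have "\<exists>F. \<forall>x::real. -\<infinity> < ereal x \<longrightarrow> ereal x < \<infinity> \<longrightarrow> (F has_vector_derivative g x) (at x)"
    using assms by (intro einterval_antiderivative) (auto simp: continuous_on_eq_continuous_at)
  then obtain F where F: "\<And>x. (F has_vector_derivative g x) (at x)" by auto
  then have "((\<lambda>x. F x - F 0) has_vector_derivative g x) (at x)" for x
    by (auto intro!: derivative_eq_intros)
  then show ?thesis
    by (intro exI[of _ "\<lambda>x. F x - F 0"]) auto
qed

lemma matrix_vector_mult_bound:
  fixes A :: "real \<Rightarrow> complex^'n^'n"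
  assumes "continuous_on UNIV A"
  shows "\<exists>K>0. \<forall>t x. \<bar>t\<bar> \<le> R \<longrightarrow> norm (A t *v x) \<le> K * norm x"
proof -
  interpret mv: bounded_bilinear "(*v) :: complex^'n^'n \<Rightarrow> complex^'n \<Rightarrow> complex^'n"
    by (rule bounded_bilinear_matrix_vector_mult)
  obtain L where L: "0 < L" "\<forall>t. \<bar>t\<bar> \<le> R \<longrightarrow> norm (A t) \<le> L"
    using continuous_bounded_interval[OF assms, of R] by blast
  obtain K where K: "0 < K"
    "\<forall>M v. norm ((M :: complex^'n^'n) *v (v :: complex^'n)) \<le> norm M * norm v * K"
    using mv.pos_bounded by blast
  have "norm (A t *v x) \<le> (L * K) * norm x" if "\<bar>t\<bar> \<le> R" for t x
  proof -
    have "norm (A t *v x) \<le> norm (A t) * norm x * K" using K by blast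
    also have "\<dots> \<le> L * norm x * K"
      using L(2) that K(1) by (intro mult_right_mono) auto
    finally show ?thesis by (simp add: mult_ac)
  qed
  then show ?thesis
    using L(1) K(1) by (intro exI[of _ "L * K"]) auto
qed

text \<open>Picard iteration written as a series: \<open>y n\<close> is the n-th increment. The
  bound C (K |t|)^n / n! makes the series and its termwise derivative converge uniformly on every
  bounded interval, so the solution exists on the whole line.\<close>

lemma linear_ode_exists:
  fixes A :: "real \<Rightarrow> complex^'n^'n" and r :: "real \<Rightarrow> complex^'n"
  assumes A: "continuous_on UNIV A" and r: "continuous_on UNIV r"
  obtains Y where "Y 0 = y0" "\<And>t. (Y has_vector_derivative A t *v Y t + r t) (at t)"
proof -
  interpret mv: bounded_bilinear "(*v) :: complex^'n^'n \<Rightarrow> complex^'n \<Rightarrow> complex^'n"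
    by (rule bounded_bilinear_matrix_vector_mult)
  from continuous_antiderivative[where ?'a = "complex^'n"]
  obtain P where P0: "\<And>g. continuous_on UNIV g \<Longrightarrow> P g 0 = (0 :: complex^'n)"
    and P: "\<And>g t. continuous_on UNIV g \<Longrightarrow> (P g has_vector_derivative g t) (at t)"
    by metis
  define y where "y = rec_nat (\<lambda>t. y0 + P r t) (\<lambda>_ f. P (\<lambda>t. A t *v f t))"
  have y_0: "y 0 = (\<lambda>t. y0 + P r t)" and y_Suc: "y (Suc n) = P (\<lambda>t. A t *v y n t)" for n
    by (simp_all add: y_def)
  have P_cont: "continuous_on UNIV (P g)" if "continuous_on UNIV g" for g
    using P[OF that] has_vector_derivative_continuous continuous_at_imp_continuous_on by blast
  have y_cont: "continuous_on UNIV (y n)" for n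
    by (induction n) (auto simp: y_0 y_Suc intro!: continuous_intros P_cont r A mv.continuous_on)
  note Ay_cont = mv.continuous_on[OF A y_cont]
  \<comment> \<open>The increment n has derivative A times the increment n - 1; the inhomogeneity
    enters only through the increment 0.\<close>
  define f' where "f' = (\<lambda>n t. case n of 0 \<Rightarrow> r t | Suc n \<Rightarrow> A t *v y n t)"
  have y': "(y n has_vector_derivative f' n t) (at t)" for n t
    using P[OF r] P[OF Ay_cont]
    by (cases n) (auto simp: y_0 y_Suc f'_def intro!: derivative_eq_intros)
  define Y where "Y = (\<lambda>t. \<Sum>n. y n t)"
  have main: "summable (\<lambda>n. y n t) \<and> (Y has_vector_derivative A t *v Y t + r t) (at t)" for t
  proof -
    \<comment> \<open>The extra 1 makes t an interior point, where a derivative within the interval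
      is a full derivative.\<close>
    define R where "R = \<bar>t\<bar> + 1"
    have "0 < R" by (simp add: R_def)
    obtain C where C: "0 < C" "\<forall>t. \<bar>t\<bar> \<le> R \<longrightarrow> norm (y 0 t) \<le> C"
      using continuous_bounded_interval[OF y_cont[of 0], of R] by blast
    obtain K where "0 < K" and K: "\<And>t v. \<bar>t\<bar> \<le> R \<Longrightarrow> norm (A t *v v) \<le> K * norm v"
      using matrix_vector_mult_bound[OF A, of R] by blast
    have bnd: "norm (y n s) \<le> C * K ^ n / fact n * \<bar>s\<bar> ^ n" if "\<bar>s\<bar> \<le> R" for n s
      using that
    proof (induction n arbitrary: s)
      case 0
      then show ?case using C by simp
    next
      case (Suc n)
      have "norm (P (\<lambda>t. A t *v y n t) s) \<le> (C * K ^ Suc n / fact n) * \<bar>s\<bar> ^ Suc n / Suc n"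
      proof (rule norm_antiderivative_le[where R = R, OF P[OF Ay_cont] P0[OF Ay_cont]])
        fix s assume "\<bar>s\<bar> \<le> R"
        then have "norm (A s *v y n s) \<le> K * (C * K ^ n / fact n * \<bar>s\<bar> ^ n)"
          using K Suc.IH \<open>0 < K\<close> by (meson mult_left_mono order.strict_implies_order order_trans)
        then show "norm (A s *v y n s) \<le> C * K ^ Suc n / fact n * \<bar>s\<bar> ^ n"
          by (simp add: mult_ac)
      qed (use Suc in auto)
      then show ?case by (simp add: y_Suc mult_ac)
    qed
    define M where "M = (\<lambda>n. C * K ^ n / fact n * R ^ n)"
    have bndM: "norm (y n s) \<le> M n" if "\<bar>s\<bar> \<le> R" for n s
    proof -
      have "C * K ^ n / fact n * \<bar>s\<bar> ^ n \<le> M n"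
        unfolding M_def using that C(1) \<open>0 < K\<close> by (intro mult_left_mono power_mono) auto
      with bnd[OF that, of n] show ?thesis by linarith
    qed
    have sM: "summable M"
      using summable_mult[OF summable_exp[of "K * R"], of C]
      by (simp add: M_def power_mult_distrib divide_inverse mult_ac)
    have summ: "summable (\<lambda>n. y n s)" if "\<bar>s\<bar> \<le> R" for s
      by (rule summable_comparison_test'[OF sM]) (use bndM that in auto)
    have sums': "(\<lambda>n. f' n s) sums (A s *v Y s + r s)" if "\<bar>s\<bar> \<le> R" for s
    proof -
      have "(\<lambda>n. A s *v y n s) sums (A s *v Y s)"
        unfolding Y_def by (intro bounded_linear.sums[OF mv.bounded_linear_right] summable_sums summ that)
      then have "(\<lambda>n. f' (Suc n) s) sums (A s *v Y s)" by (simp add: f'_def)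
      then show ?thesis
        using sums_Suc[of "\<lambda>n. f' n s"] by (simp add: f'_def)
    qed
    \<comment> \<open>The term \<open>f' n\<close> is bounded through \<open>y (n - 1)\<close>,
      hence the shifted majorant and the restriction to n \<ge> 1.\<close>
    have ul: "uniform_limit {-R..R} (\<lambda>n s. \<Sum>i<n. f' i s) (\<lambda>s. \<Sum>i. f' i s) sequentially"
    proof (rule Weierstrass_m_test_ev)
      show "\<forall>\<^sub>F n in sequentially. \<forall>x\<in>{-R..R}. norm (f' n x) \<le> K * M (n - 1)"
      proof (rule eventually_sequentiallyI[of 1], rule ballI)
        fix n :: nat and x assume "1 \<le> n" "x \<in> {-R..R}"
        then obtain m where m: "n = Suc m" and x: "\<bar>x\<bar> \<le> R" by (cases n) auto
        show "norm (f' n x) \<le> K * M (n - 1)"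
          using K[OF x, of "y m x"] bndM[OF x, of m] \<open>0 < K\<close>
          by (simp add: m f'_def) (meson mult_left_mono order.strict_implies_order order_trans)
      qed
      have "summable (\<lambda>n. K * M n)" using sM by (rule summable_mult)
      then show "summable (\<lambda>n. K * M (n - 1))"
        using summable_Suc_iff[of "\<lambda>n. K * M (n - 1)"] by simp
    qed
    have lim: "(\<Sum>i. f' i s) = A s *v Y s + r s" if "\<bar>s\<bar> \<le> R" for s
      using sums'[OF that] by (simp add: sums_iff)
    have "\<exists>g. \<forall>x\<in>{-R..R}. (\<lambda>n. y n x) sums g x \<and>
       (g has_derivative (\<lambda>h. h *\<^sub>R (A x *v Y x + r x))) (at x within {-R..R})"
    proof (rule has_derivative_series[where f' = "\<lambda>n x h. h *\<^sub>R f' n x"])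
      show "((y n) has_derivative (\<lambda>h. h *\<^sub>R f' n x)) (at x within {-R..R})" for n x
        using y'[of n x] by (simp add: has_vector_derivative_def has_derivative_at_withinI)
      show "(\<lambda>n. y n 0) sums Y 0"
        unfolding Y_def using summ[of 0] \<open>0 < R\<close> by (simp add: summable_sums)
      show "0 \<in> {-R..R}" using \<open>0 < R\<close> by simp
      fix e :: real assume "0 < e"
      with ul have "\<forall>\<^sub>F n in sequentially. \<forall>x\<in>{-R..R}. dist (\<Sum>i<n. f' i x) (\<Sum>i. f' i x) < e"
        by (simp add: uniform_limit_iff)
      then show "\<forall>\<^sub>F n in sequentially. \<forall>x\<in>{-R..R}. \<forall>h.
          norm ((\<Sum>i<n. h *\<^sub>R f' i x) - h *\<^sub>R (A x *v Y x + r x)) \<le> e * norm h"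
      proof (rule eventually_mono, intro ballI allI)
        fix n x and h :: real
        assume 1: "\<forall>x\<in>{-R..R}. dist (\<Sum>i<n. f' i x) (\<Sum>i. f' i x) < e" and x: "x \<in> {-R..R}"
        have "norm ((\<Sum>i<n. f' i x) - (A x *v Y x + r x)) \<le> e"
          using 1[rule_format, OF x] lim[of x] x by (auto simp: dist_norm abs_le_iff)
        moreover have "norm ((\<Sum>i<n. h *\<^sub>R f' i x) - h *\<^sub>R (A x *v Y x + r x))
          = \<bar>h\<bar> * norm ((\<Sum>i<n. f' i x) - (A x *v Y x + r x))"
          by (simp only: scaleR_sum_right[symmetric] scaleR_diff_right[symmetric] norm_scaleR)
        ultimately show "norm ((\<Sum>i<n. h *\<^sub>R f' i x) - h *\<^sub>R (A x *v Y x + r x)) \<le> e * norm h"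
          by (simp only: real_norm_def mult.commute[of e]) (rule mult_left_mono, simp_all)
      qed
    qed auto
    then obtain g where g: "\<And>x. x \<in> {-R..R} \<Longrightarrow> (\<lambda>n. y n x) sums g x"
      "\<And>x. x \<in> {-R..R} \<Longrightarrow> (g has_derivative (\<lambda>h. h *\<^sub>R (A x *v Y x + r x))) (at x within {-R..R})"
      by blast
    have t: "t \<in> {-R<..<R}" by (auto simp: R_def)
    have "(g has_vector_derivative A t *v Y t + r t) (at t within {-R..R})"
      using g(2)[of t] t by (auto simp: has_vector_derivative_def)
    then have "(g has_vector_derivative A t *v Y t + r t) (at t)"
      using t at_within_Icc_at[of "-R" t R] by simp
    then have "(Y has_vector_derivative A t *v Y t + r t) (at t)"
      by (rule has_vector_derivative_transform_within_open[of _ _ _ "{-R<..<R}"])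
        (use t g(1) in \<open>auto simp: Y_def sums_iff\<close>)
    moreover have "summable (\<lambda>n. y n t)" by (rule summ) (simp add: R_def)
    ultimately show ?thesis by blast
  qed
  have "y (Suc n) 0 = 0" for n by (simp add: y_Suc P0 Ay_cont)
  then have "y n 0 = (if n = 0 then y0 else 0)" for n
    by (cases n) (simp_all add: y_0 P0 r)
  then have "Y 0 = y0"
    unfolding Y_def by (simp add: sums_If_finite_set sums_iff flip: sums_unique[OF sums_single])
  with main that show thesis by blast
qed

lemma norm_vector_smult: "norm (a *s (x :: complex^'n)) = norm a * norm x"
  by (simp add: norm_vec_def norm_mult L2_set_right_distrib)

lemma bounded_linear_vector_smult: "bounded_linear (\<lambda>x :: complex^'n. a *s x)"
  by (rule bounded_linear_intro[of _ "norm a"])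
    (auto simp: norm_vector_smult vec_eq_iff algebra_simps)

lemma matrix_vector_mult_smult: "(A :: complex^'n^'m) *v (a *s x) = a *s (A *v x)"
  by (simp add: matrix_vector_mult_def vec_eq_iff sum_distrib_left mult_ac)

text \<open>The difference solves the homogeneous system with zero initial value, so
  \<open>gronwall\<close> with e = 0 applies forwards, and backwards after reversing time.\<close>

lemma linear_ode_unique:
  fixes A :: "real \<Rightarrow> complex^'n^'n"
  assumes A: "continuous_on UNIV A"
    and Y: "\<And>t. (Y has_vector_derivative A t *v Y t + r t) (at t)"
    and Z: "\<And>t. (Z has_vector_derivative A t *v Z t + r t) (at t)"
    and "Y 0 = Z 0"
  shows "Y t = Z t"
proof -
  define D where "D = (\<lambda>t. Y t - Z t)"
  have D: "(D has_vector_derivative A t *v D t) (at t)" for t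
    unfolding D_def using has_vector_derivative_diff[OF Y[of t] Z[of t]]
    by (simp add: matrix_vector_mult_diff_distrib)
  have D0: "D 0 = 0" using assms by (simp add: D_def)
  obtain K where K: "0 < K" "\<forall>s x. \<bar>s\<bar> \<le> \<bar>t\<bar> \<longrightarrow> norm (A s *v x) \<le> K * norm x"
    using matrix_vector_mult_bound[OF A, of "\<bar>t\<bar>"] by blast
  have "norm (D \<bar>t\<bar>) \<le> 0 * exp ((K + 1) * \<bar>t\<bar>)"
    by (rule gronwall[where Y' = "\<lambda>t. A t *v D t" and T = "\<bar>t\<bar>"])
      (use K D D0 in \<open>auto\<close>)
  moreover have "norm (D (- \<bar>t\<bar>)) \<le> 0 * exp ((K + 1) * \<bar>t\<bar>)"
  proof (rule gronwall[where Y = "\<lambda>s. D (- s)" and Y' = "\<lambda>s. - (A (- s) *v D (- s))" and T = "\<bar>t\<bar>"])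
    show "((\<lambda>s. D (- s)) has_vector_derivative - (A (- s) *v D (- s))) (at s)" for s
    proof -
      have "((\<lambda>s. - s) has_vector_derivative - 1) (at s)"
        by (auto intro!: derivative_eq_intros)
      from vector_diff_chain_at[OF this D] show ?thesis
        by (simp add: o_def)
    qed
  qed (use K D0 in auto)
  ultimately have "D t = 0"
    by (cases "0 \<le> t") auto
  then show ?thesis by (simp add: D_def)
qed

text \<open>Complex multiple of a matrix; \<open>*s\<close> applied to a matrix would expect a whole
  row as its scalar.\<close>

definition mscale :: "complex \<Rightarrow> complex^'n^'m \<Rightarrow> complex^'n^'m" where
  "mscale a M = (\<chi> i j. a * M $ i $ j)"

lemma mscale_mult: "mscale a M *v x = a *s (M *v x)"
  by (simp add: mscale_def matrix_vector_mult_def vec_eq_iff sum_distrib_left mult.assoc)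

lemma continuous_on_mscale:
  fixes A :: "real \<Rightarrow> complex^'n^'m"
  shows "continuous_on S A \<Longrightarrow> continuous_on S (\<lambda>t. mscale a (A t))"
  unfolding mscale_def by (intro continuous_intros)

text \<open>The candidate \<open>W\<close> for the complex derivative solves the variational
  equation. A first use of \<open>gronwall\<close> gives H a - H a0 = O(|a - a0|); a second one,
  with this as source, bounds the remainder by O(|a - a0|^2). The common initial value makes both
  differences start at 0.\<close>

lemma linear_ode_holomorphic:
  fixes A0 A1 :: "real \<Rightarrow> complex^'n^'n" and H :: "complex \<Rightarrow> real \<Rightarrow> complex^'n"
  assumes A0: "continuous_on UNIV A0" and A1: "continuous_on UNIV A1"
    and H: "\<And>a t. (H a has_vector_derivative A0 t *v H a t + a *s (A1 t *v H a t) + r t) (at t)"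
    and H0: "\<And>a. H a 0 = y0" and t: "0 \<le> t"
  shows "(\<lambda>a. H a t $ i) holomorphic_on UNIV"
proof -
  interpret mv: bounded_bilinear "(*v) :: complex^'n^'n \<Rightarrow> complex^'n \<Rightarrow> complex^'n"
    by (rule bounded_bilinear_matrix_vector_mult)
  have "\<exists>D. ((\<lambda>a. H a t $ i) has_field_derivative D) (at a0)" for a0
  proof -
    have H_cont: "continuous_on UNIV (H a)" for a
      using H has_vector_derivative_continuous continuous_at_imp_continuous_on by blast
    obtain W where W0: "W 0 = 0"
      and W: "\<And>t. (W has_vector_derivative (A0 t + mscale a0 (A1 t)) *v W t + A1 t *v H a0 t) (at t)"
      using linear_ode_exists[of "\<lambda>t. A0 t + mscale a0 (A1 t)" "\<lambda>t. A1 t *v H a0 t" 0]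
        mv.continuous_on[OF A1 H_cont] continuous_on_add[OF A0 continuous_on_mscale[OF A1]]
      by blast
    have W': "(W has_vector_derivative A0 t *v W t + a0 *s (A1 t *v W t) + A1 t *v H a0 t) (at t)" for t
      using W[of t] by (simp add: matrix_vector_mult_add_rdistrib mscale_mult)
    obtain K0 where K0: "0 < K0" "\<forall>s x. \<bar>s\<bar> \<le> t \<longrightarrow> norm (A0 s *v x) \<le> K0 * norm x"
      using matrix_vector_mult_bound[OF A0, of t] by blast
    obtain K1 where K1: "0 < K1" "\<forall>s x. \<bar>s\<bar> \<le> t \<longrightarrow> norm (A1 s *v x) \<le> K1 * norm x"
      using matrix_vector_mult_bound[OF A1, of t] by blast
    obtain C where C: "0 < C" "\<forall>s. \<bar>s\<bar> \<le> t \<longrightarrow> norm (H a0 s) \<le> C"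
      using continuous_bounded_interval[OF H_cont, of t] by blast
    \<comment> \<open>A growth rate valid for every coefficient b with |b| \<le> |a0| + 1, hence for
      all a within distance 1 of a0.\<close>
    define K where "K = K0 + (norm a0 + 1) * K1"
    have K: "0 \<le> K" using K0(1) K1(1) by (simp add: K_def)
    define C1 where "C1 = K1 * C * exp ((K + 1) * t)"
    define C2 where "C2 = K1 * C1 * exp ((K + 1) * t)"
    have ineq: "norm (A0 s *v x + b *s (A1 s *v x)) \<le> K * norm x"
      if "0 \<le> s" "s \<le> t" "norm b \<le> norm a0 + 1" for s x b
    proof -
      have "norm (A0 s *v x + b *s (A1 s *v x)) \<le> norm (A0 s *v x) + norm b * norm (A1 s *v x)"
        by (metis norm_triangle_ineq norm_vector_smult)
      also have "\<dots> \<le> K0 * norm x + (norm a0 + 1) * (K1 * norm x)"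
        using K0(2) K1(2) that by (intro add_mono mult_mono) auto
      finally show ?thesis by (simp add: K_def algebra_simps)
    qed
    have est: "norm (H a t - H a0 t - (a - a0) *s W t) \<le> C2 * (norm (a - a0))\<^sup>2"
      if a: "norm (a - a0) \<le> 1" for a
    proof -
      define d where "d = a - a0"
      have na: "norm a \<le> norm a0 + 1"
        using a norm_triangle_ineq2[of a a0] by simp
      define \<Delta> where "\<Delta> = (\<lambda>s. H a s - H a0 s)"
      have \<Delta>': "(\<Delta> has_vector_derivative
          A0 s *v \<Delta> s + a *s (A1 s *v \<Delta> s) + d *s (A1 s *v H a0 s)) (at s)" for s
        unfolding \<Delta>_def d_def
        using has_vector_derivative_diff[OF H[of a s] H[of a0 s]]
        by (rule has_vector_derivative_eq_rhs)
          (simp add: matrix_vector_mult_diff_distrib vec_eq_iff algebra_simps)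
      have \<Delta>0: "\<Delta> 0 = 0" by (simp add: \<Delta>_def H0)
      have \<Delta>: "norm (\<Delta> s) \<le> norm d * C1" if s: "0 \<le> s" "s \<le> t" for s
      proof -
        have "norm (\<Delta> s) \<le> (norm d * (K1 * C)) * exp ((K + 1) * s)"
        proof (rule gronwall[OF \<Delta>' \<Delta>0 _ K _ s])
          fix u assume u: "0 \<le> u" "u \<le> t"
          have "norm (d *s (A1 u *v H a0 u)) \<le> norm d * (K1 * C)"
          proof -
            have "norm (A1 u *v H a0 u) \<le> K1 * norm (H a0 u)" using K1(2) u by simp
            also have "\<dots> \<le> K1 * C" using K1(1) C(2) u by (intro mult_left_mono) auto
            finally show ?thesis unfolding norm_vector_smult by (intro mult_left_mono) auto
          qed
          with ineq[OF u na, of "\<Delta> u"]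
          show "norm (A0 u *v \<Delta> u + a *s (A1 u *v \<Delta> u) + d *s (A1 u *v H a0 u))
             \<le> K * norm (\<Delta> u) + norm d * (K1 * C)"
            by (meson add_mono norm_triangle_ineq order_trans)
        qed (use K1 C in auto)
        also have "\<dots> \<le> (norm d * (K1 * C)) * exp ((K + 1) * t)"
          using s K K1 C by (intro mult_left_mono) auto
        finally show ?thesis by (simp add: C1_def mult_ac)
      qed
      define D where "D = (\<lambda>s. \<Delta> s - d *s W s)"
      have D': "(D has_vector_derivative
          A0 s *v D s + a0 *s (A1 s *v D s) + d *s (A1 s *v \<Delta> s)) (at s)" for s
        unfolding D_def
        using has_vector_derivative_diff[OF \<Delta>'[of s]
            bounded_linear.has_vector_derivative[OF bounded_linear_vector_smult W'[of s], of d]]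
        by (rule has_vector_derivative_eq_rhs)
          (simp add: matrix_vector_mult_diff_distrib matrix_vector_mult_smult vec_eq_iff d_def algebra_simps)
      have "norm (D t) \<le> (norm d * (K1 * (norm d * C1))) * exp ((K + 1) * t)"
      proof (rule gronwall[OF D' _ _ K _ t order_refl])
        fix u assume u: "0 \<le> u" "u \<le> t"
        have "norm (d *s (A1 u *v \<Delta> u)) \<le> norm d * (K1 * (norm d * C1))"
        proof -
          have "norm (A1 u *v \<Delta> u) \<le> K1 * norm (\<Delta> u)" using K1(2) u by simp
          also have "\<dots> \<le> K1 * (norm d * C1)" using K1(1) \<Delta>[OF u] by (intro mult_left_mono) auto
          finally show ?thesis unfolding norm_vector_smult by (intro mult_left_mono) auto
        qed
        with ineq[OF u, of a0 "D u"]
        show "norm (A0 u *v D u + a0 *s (A1 u *v D u) + d *s (A1 u *v \<Delta> u))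
           \<le> K * norm (D u) + norm d * (K1 * (norm d * C1))"
          by (smt (verit) norm_triangle_ineq)
      next
        show "D 0 = 0" by (simp add: D_def \<Delta>0 W0)
        show "0 \<le> norm d * (K1 * (norm d * C1))" using K1 C by (simp add: C1_def)
      qed
      then show ?thesis
        by (simp add: D_def \<Delta>_def d_def C2_def power2_eq_square mult_ac)
    qed
    have "((\<lambda>a. (H a t $ i - H a0 t $ i) / (a - a0) - W t $ i) \<longlongrightarrow> 0) (at a0)"
    proof (rule Lim_null_comparison)
      show "\<forall>\<^sub>F a in at a0. norm ((H a t $ i - H a0 t $ i) / (a - a0) - W t $ i) \<le> C2 * norm (a - a0)"
        unfolding eventually_at
      proof (intro exI[of _ 1] conjI allI impI ballI)
        fix a assume "a \<noteq> a0 \<and> dist a a0 < 1"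
        then have a: "a \<noteq> a0" "dist a a0 \<le> 1" by auto
        have "norm ((H a t - H a0 t - (a - a0) *s W t) $ i) \<le> C2 * (norm (a - a0))\<^sup>2"
          by (rule order_trans[OF Finite_Cartesian_Product.norm_nth_le est]) (use a in \<open>simp add: dist_norm\<close>)
        moreover have "(H a t $ i - H a0 t $ i) / (a - a0) - W t $ i
            = ((H a t - H a0 t - (a - a0) *s W t) $ i) / (a - a0)"
          using a by (simp add: field_simps)
        ultimately show "norm ((H a t $ i - H a0 t $ i) / (a - a0) - W t $ i) \<le> C2 * norm (a - a0)"
          using a by (simp only: norm_divide) (simp add: divide_le_eq power2_eq_square)
      qed simp
      have "((\<lambda>a. C2 * norm (a - a0)) \<longlongrightarrow> C2 * norm (a0 - a0)) (at a0)"
        by (intro tendsto_intros)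
      then show "((\<lambda>a. C2 * norm (a - a0)) \<longlongrightarrow> 0) (at a0)" by simp
    qed
    then have "((\<lambda>a. H a t $ i) has_field_derivative W t $ i) (at a0)"
      by (simp add: has_field_derivative_iff LIM_zero_iff)
    then show ?thesis by blast
  qed
  then show ?thesis
    by (simp add: holomorphic_on_def field_differentiable_def)
qed

lemma dot_transpose:
  fixes A :: "complex^'n^'n"
  shows "(\<Sum>i\<in>UNIV. (transpose A *v z) $ i * y $ i) = (\<Sum>i\<in>UNIV. z $ i * (A *v y) $ i)"
  unfolding matrix_vector_mult_def transpose_def
  by (simp add: sum_distrib_left sum_distrib_right mult_ac) (rule sum.swap)

text \<open>The pairing of a solution with a solution of the adjoint system is constant, so a
  Floquet multiplier \<open>\<rho>\<close> of a periodic system yields the multiplier \<open>1 / \<rho>\<close> of the adjoint.\<close>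

lemma adjoint_floquet_solution:
  fixes A :: "real \<Rightarrow> complex^'n^'n"
  assumes A: "continuous_on UNIV A" and per: "\<And>t. A (t + T) = A t"
    and Y: "\<And>t. (Y has_vector_derivative A t *v Y t) (at t)"
    and Y0: "Y 0 \<noteq> 0" and YT: "Y T = \<rho> *s Y 0" and \<rho>: "\<rho> \<noteq> 0"
  obtains Z where "\<And>t. (Z has_vector_derivative - (transpose (A t) *v Z t)) (at t)" "Z 0 \<noteq> 0"
    "\<And>t. Z (t + T) = (1 / \<rho>) *s Z t"
proof -
  define sol where "sol = (\<lambda>Y. \<forall>t. (Y has_vector_derivative A t *v Y t) (at t))"
  have solI: "sol Y" if "\<And>t. (Y has_vector_derivative A t *v Y t) (at t)" for Y
    using that by (simp add: sol_def)
  have sol_ex: "\<exists>Y. sol Y \<and> Y 0 = y" for y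
    using linear_ode_exists[OF A, of "\<lambda>t. 0" y] unfolding sol_def by (metis add_0_right continuous_on_const)
  have sol_uniq: "Y t = Y' t" if "sol Y" "sol Y'" "Y 0 = Y' 0" for Y Y' t
    using linear_ode_unique[OF A, of Y "\<lambda>t. 0" Y' t] that by (simp add: sol_def)
  have "\<forall>i. \<exists>Y. sol Y \<and> Y 0 = axis i 1" using sol_ex by blast
  from choice[OF this] obtain X where X: "\<And>i. sol (X i)" "\<And>i. X i 0 = axis i 1"
    by blast
  \<comment> \<open>The monodromy matrix: its columns are the values at T of the solutions starting
    at the unit vectors.\<close>
  define M where "M = (\<chi> i j. X j T $ i)"
  have M: "Y T = M *v Y 0" if "sol Y" for Y
  proof -
    define Y' where "Y' = (\<lambda>t. \<Sum>j\<in>UNIV. (Y 0 $ j) *s X j t)"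
    have "sol Y'"
    proof (rule solI)
      fix t
      have "(Y' has_vector_derivative (\<Sum>j\<in>UNIV. (Y 0 $ j) *s (A t *v X j t))) (at t)"
        unfolding Y'_def using X(1)
        by (intro has_vector_derivative_sum bounded_linear.has_vector_derivative[OF bounded_linear_vector_smult])
          (simp add: sol_def)
      also have "(\<Sum>j\<in>UNIV. (Y 0 $ j) *s (A t *v X j t)) = A t *v Y' t"
        unfolding Y'_def by (simp add: vec.sum matrix_vector_mult_smult flip: matrix_vector_mult_smult)
      finally show "(Y' has_vector_derivative A t *v Y' t) (at t)" .
    qed
    moreover have "Y' 0 = Y 0"
      unfolding Y'_def by (simp add: X(2) vec_eq_iff axis_def if_distrib cong: if_cong)
    ultimately have "Y T = Y' T" using sol_uniq[OF that] by metis
    also have "\<dots> = M *v Y 0"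
      by (simp add: Y'_def M_def matrix_vector_mult_def vec_eq_iff mult.commute)
    finally show ?thesis .
  qed
  \<comment> \<open>An eigenvalue of M is one of its transpose; the eigenvector \<open>z\<close> of
    the transpose becomes the initial value of the adjoint solution.\<close>
  have "(M - mscale \<rho> (mat 1)) *v Y 0 = 0"
    using M[OF solI[OF Y]] YT by (simp add: matrix_vector_mult_diff_rdistrib mscale_mult)
  then have "\<not> (\<exists>B. B ** (M - mscale \<rho> (mat 1)) = mat 1)"
    using Y0 unfolding matrix_left_invertible_ker by blast
  then have "\<not> (\<exists>B. B ** transpose (M - mscale \<rho> (mat 1)) = mat 1)"
    unfolding right_invertible_transpose[symmetric] left_invertible_transpose
    by (metis left_invertible_transpose matrix_left_right_inverse right_invertible_transpose)
  then obtain z where z: "z \<noteq> 0" "transpose (M - mscale \<rho> (mat 1)) *v z = 0"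
    unfolding matrix_left_invertible_ker by blast
  have "transpose (M - mscale \<rho> (mat 1)) = transpose M - mscale \<rho> (mat 1)"
    by (simp add: transpose_def vec_eq_iff mscale_def mat_def)
  with z have zM: "transpose M *v z = \<rho> *s z"
    by (simp add: matrix_vector_mult_diff_rdistrib mscale_mult)
  define A' where "A' = (\<lambda>t. - transpose (A t))"
  have A': "continuous_on UNIV A'"
    unfolding A'_def transpose_def using A by (intro continuous_intros)
  have A'_mult: "A' t *v x = - (transpose (A t) *v x)" for t x
    by (simp add: A'_def matrix_vector_mult_def vec_eq_iff sum_negf)
  obtain Z where Z: "Z 0 = z" "\<And>t. (Z has_vector_derivative A' t *v Z t) (at t)"
    using linear_ode_exists[OF A', of "\<lambda>t. 0" z] by (metis add_0_right continuous_on_const)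
  have pairing: "(\<Sum>i\<in>UNIV. Z T $ i * Y T $ i) = (\<Sum>i\<in>UNIV. z $ i * Y 0 $ i)" if "sol Y" for Y
  proof -
    have "((\<lambda>t. \<Sum>i\<in>UNIV. Z t $ i * Y t $ i) has_vector_derivative 0) (at t)" for t
    proof -
      have "((\<lambda>t. \<Sum>i\<in>UNIV. Z t $ i * Y t $ i) has_vector_derivative
         (\<Sum>i\<in>UNIV. Z t $ i * (A t *v Y t) $ i + (A' t *v Z t) $ i * Y t $ i)) (at t)"
        by (intro has_vector_derivative_sum has_vector_derivative_mult has_vector_derivative_vec_nth Z)
          (use that in \<open>simp add: sol_def\<close>)
      also have "(\<Sum>i\<in>UNIV. Z t $ i * (A t *v Y t) $ i + (A' t *v Z t) $ i * Y t $ i) = 0"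
        by (simp only: sum.distrib A'_mult vector_uminus_component mult_minus_left sum_negf dot_transpose) simp
      finally show ?thesis .
    qed
    then obtain k where "\<And>t. (\<Sum>i\<in>UNIV. Z t $ i * Y t $ i) = k"
      using has_vector_derivative_zero_constant[of UNIV "\<lambda>t. \<Sum>i\<in>UNIV. Z t $ i * Y t $ i"] by auto
    then show ?thesis by (metis Z(1))
  qed
  have "\<rho> *s Z T = z"
  proof -
    have "(\<Sum>i\<in>UNIV. (\<rho> *s Z T - z) $ i * w $ i) = 0" for w
    proof -
      obtain Y where Y: "sol Y" "Y 0 = w" using sol_ex by blast
      \<comment> \<open>Pairing with the solution shifted by one period, whose value at T is the
        prescribed w, avoids inverting the monodromy matrix.\<close>
      have "sol (\<lambda>t. Y (t - T))"
      proof (rule solI)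
        fix t
        have "((\<lambda>t. t - T) has_vector_derivative 1) (at t)"
          by (auto intro!: derivative_eq_intros)
        from vector_diff_chain_at[OF this, of Y "A (t - T) *v Y (t - T)"] Y(1)
        show "((\<lambda>t. Y (t - T)) has_vector_derivative A t *v Y (t - T)) (at t)"
          using per[of "t - T"] by (simp add: sol_def o_def)
      qed
      from pairing[OF this] M[OF this] Y(2)
      have 1: "(\<Sum>i\<in>UNIV. Z T $ i * w $ i) = (\<Sum>i\<in>UNIV. z $ i * Y (- T) $ i)"
        and w: "w = M *v Y (- T)" by simp_all
      have "(\<Sum>i\<in>UNIV. z $ i * w $ i) = (\<Sum>i\<in>UNIV. (\<rho> *s z) $ i * Y (- T) $ i)"
        unfolding w dot_transpose[symmetric] zM ..
      then have 2: "(\<Sum>i\<in>UNIV. z $ i * w $ i) = \<rho> * (\<Sum>i\<in>UNIV. z $ i * Y (- T) $ i)"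
        by (simp add: sum_distrib_left mult.assoc)
      have "(\<Sum>i\<in>UNIV. (\<rho> *s Z T - z) $ i * w $ i)
          = \<rho> * (\<Sum>i\<in>UNIV. Z T $ i * w $ i) - (\<Sum>i\<in>UNIV. z $ i * w $ i)"
        by (simp add: left_diff_distrib sum_subtractf sum_distrib_left mult.assoc)
      with 1 2 show ?thesis by simp
    qed
    from this[of "axis i 1" for i] have "(\<rho> *s Z T - z) $ i = 0" for i
      by (simp add: axis_def if_distrib cong: if_cong)
    then show ?thesis by (simp add: vec_eq_iff)
  qed
  then have ZT: "Z T = (1 / \<rho>) *s z" using \<rho> by (auto simp: vec_eq_iff field_simps)
  have "Z (t + T) = (1 / \<rho>) *s Z t" for t
  proof (rule linear_ode_unique[OF A', where r = "\<lambda>t. 0" and Y = "\<lambda>t. Z (t + T)"])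
    fix t
    have "((\<lambda>t. t + T) has_vector_derivative 1) (at t)"
      by (auto intro!: derivative_eq_intros)
    from vector_diff_chain_at[OF this Z(2)]
    show "((\<lambda>t. Z (t + T)) has_vector_derivative A' t *v Z (t + T) + 0) (at t)"
      using per by (simp add: o_def A'_def)
    show "((\<lambda>t. (1 / \<rho>) *s Z t) has_vector_derivative A' t *v ((1 / \<rho>) *s Z t) + 0) (at t)"
      using bounded_linear.has_vector_derivative[OF bounded_linear_vector_smult Z(2)]
      by (simp add: matrix_vector_mult_smult)
  qed (simp add: ZT Z)
  then show thesis
    using that[of Z] Z z(1) by (simp add: A'_mult)
qed

section \<open>A criterion for the spectrum\<close>

lemma L2_mult_integrable:
  assumes "f \<in> L2" "h \<in> L2"
  shows "integrable lborel (\<lambda>x. f x * h x)"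
proof (rule Bochner_Integration.integrable_bound)
  show "integrable lborel (\<lambda>x. (cmod (f x))\<^sup>2 + (cmod (h x))\<^sup>2)"
    using assms by (auto simp: L2_def)
  show "(\<lambda>x. f x * h x) \<in> borel_measurable lborel"
    using assms by (auto simp: L2_def)
  have "cmod (f x * h x) \<le> (cmod (f x))\<^sup>2 + (cmod (h x))\<^sup>2" for x
  proof -
    have "2 * (cmod (f x) * cmod (h x)) \<le> (cmod (f x))\<^sup>2 + (cmod (h x))\<^sup>2"
      using sum_squares_bound[of "cmod (f x)" "cmod (h x)"] by (simp add: mult_ac)
    moreover have "0 \<le> cmod (f x) * cmod (h x)" by simp
    ultimately have "cmod (f x) * cmod (h x) \<le> (cmod (f x))\<^sup>2 + (cmod (h x))\<^sup>2" by linarith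
    then show ?thesis by (simp add: norm_mult)
  qed
  then show "AE x in lborel. norm (f x * h x) \<le> norm ((cmod (f x))\<^sup>2 + (cmod (h x))\<^sup>2)"
    by (intro AE_I2) (simp add: order_trans[OF _ abs_ge_self])
qed

lemma integrable_compact_support:
  fixes h :: "real \<Rightarrow> 'a::{banach, second_countable_topology}"
  assumes "continuous_on UNIV h" "\<And>x. R < \<bar>x\<bar> \<Longrightarrow> h x = 0"
  shows "integrable lborel h"
proof -
  have "integrable lborel (\<lambda>x. indicator {-R..R} x *\<^sub>R h x)"
    by (intro borel_integrable_compact continuous_on_subset[OF assms(1)]) auto
  also have "(\<lambda>x. indicator {-R..R} x *\<^sub>R h x) = h"
    using assms(2) by (auto simp: fun_eq_iff indicator_def)
  finally show ?thesis .
qed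

lemma L2_compact_support:
  assumes "continuous_on UNIV h" "\<And>x. R < \<bar>x\<bar> \<Longrightarrow> h x = 0"
  shows "h \<in> L2"
proof -
  have "h \<in> borel_measurable lborel"
    using assms(1) by (simp add: borel_measurable_continuous_onI)
  moreover have "integrable lborel (\<lambda>x. (cmod (h x))\<^sup>2)"
    by (rule integrable_compact_support[of _ R]) (use assms in \<open>auto intro!: continuous_intros\<close>)
  ultimately show ?thesis by (simp add: L2_def)
qed

lemma deriv_smooth_mult:
  assumes "smooth p" "smooth q"
  shows "deriv (\<lambda>x. p x * q x) = (\<lambda>x. deriv p x * q x + p x * deriv q x)"
  using DERIV_mult'[OF smooth_has_deriv[OF assms(1)] smooth_has_deriv[OF assms(2)]]
  by (auto intro!: ext DERIV_imp_deriv simp: add.commute)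

lemma deriv_smooth_add:
  assumes "smooth p" "smooth q"
  shows "deriv (\<lambda>x. p x + q x) = (\<lambda>x. deriv p x + deriv q x)"
  using DERIV_add[OF smooth_has_deriv[OF assms(1)] smooth_has_deriv[OF assms(2)]]
  by (auto intro!: ext DERIV_imp_deriv)

lemma deriv_eq_0_outside:
  assumes "\<And>x. R < \<bar>x\<bar> \<Longrightarrow> f x = (0::real)" "R < \<bar>x\<bar>"
  shows "deriv f x = 0"
proof (rule DERIV_imp_deriv)
  have "open {x. R < \<bar>x\<bar>}"
    by (intro open_Collect_less continuous_intros)
  then show "(f has_field_derivative 0) (at x)"
    using has_field_derivative_transform_within_open[of "\<lambda>_. 0" 0 x "{x. R < \<bar>x\<bar>}" f] assms by auto
qed

text \<open>All derivatives are moved onto the test function: \<open>G'\<close> is the formal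
  adjoint of G[\<phi>] applied to \<eta>, and \<open>L'\<close> is minus the formal adjoint of
  \<L>[\<phi>] applied to \<eta>', the sign coming from \<open>D_dist\<close>.\<close>

lemma A_graph_pairing:
  assumes fg: "(f, g) \<in> A_graph c \<phi>" and \<phi>: "smooth \<phi>" and \<eta>: "test_function \<eta>"
  defines "G' \<equiv> \<lambda>x. \<eta> x - 2 * deriv \<phi> x * deriv \<eta> x - \<phi> x * deriv (deriv \<eta>) x"
    and "L' \<equiv> \<lambda>x. (2 * \<phi> x - c + 4 * c * deriv (deriv \<phi>) x) * deriv \<eta> x
      + 4 * c * deriv \<phi> x * deriv (deriv \<eta>) x + c * \<phi> x * deriv (deriv (deriv \<eta>)) x"
  shows "(LINT x|lborel. g x * of_real (G' x)) = (LINT x|lborel. f x * of_real (L' x))"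
proof -
  obtain R where R: "\<And>x. R < \<bar>x\<bar> \<Longrightarrow> \<eta> x = 0" and s: "smooth \<eta>"
    using \<eta> by (auto simp: test_function_def)
  note R1 = deriv_eq_0_outside[OF R] note R2 = deriv_eq_0_outside[OF R1]
  note R3 = deriv_eq_0_outside[OF R2]
  note s1 = smooth_deriv[OF s] note s2 = smooth_deriv[OF s1] note s3 = smooth_deriv[OF s2]
  note \<phi>1 = smooth_deriv[OF \<phi>] note \<phi>2 = smooth_deriv[OF \<phi>1]
  have f: "f \<in> L2" and g: "g \<in> L2"
    and eq: "G_op \<phi> (dist_of g) \<eta> = D_dist (L_op c \<phi> (dist_of f)) \<eta>"
    using fg \<eta> by (auto simp: A_graph_def)
  have int: "integrable lborel (\<lambda>x. h x * of_real (p x))"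
    if "h \<in> L2" "smooth p" "\<And>x. R < \<bar>x\<bar> \<Longrightarrow> p x = 0" for h p
    by (intro L2_mult_integrable that L2_compact_support[of _ R] continuous_intros smooth_continuous)
      (use that in auto)
  have "G_op \<phi> (dist_of g) \<eta> = (LINT x|lborel. g x * of_real (\<eta> x))
      + (LINT x|lborel. g x * of_real (deriv (deriv \<phi>) x * \<eta> x))
      - (LINT x|lborel. g x * of_real (deriv (deriv (\<lambda>x. \<phi> x * \<eta> x)) x))"
    by (simp add: G_op_def mult_dist_def D_dist_def dist_of_def)
  also have "deriv (deriv (\<lambda>x. \<phi> x * \<eta> x))
      = (\<lambda>x. deriv (deriv \<phi>) x * \<eta> x + 2 * deriv \<phi> x * deriv \<eta> x + \<phi> x * deriv (deriv \<eta>) x)"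
    by (simp add: deriv_smooth_mult deriv_smooth_add s s1 \<phi> \<phi>1 smooth_intros algebra_simps)
  also have "(LINT x|lborel. g x * of_real (\<eta> x))
      + (LINT x|lborel. g x * of_real (deriv (deriv \<phi>) x * \<eta> x))
      - (LINT x|lborel. g x * of_real (deriv (deriv \<phi>) x * \<eta> x + 2 * deriv \<phi> x * deriv \<eta> x + \<phi> x * deriv (deriv \<eta>) x))
     = (LINT x|lborel. g x * of_real (\<eta> x) + g x * of_real (deriv (deriv \<phi>) x * \<eta> x)
      - g x * of_real (deriv (deriv \<phi>) x * \<eta> x + 2 * deriv \<phi> x * deriv \<eta> x + \<phi> x * deriv (deriv \<eta>) x))"
    (is "_ = (LINT x|lborel. ?a x + ?b x - ?d x)")
  proof -
    have "integrable lborel ?a" "integrable lborel ?b" "integrable lborel ?d"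
      by (intro int g smooth_intros s \<phi>; simp add: R R1 R2)+
    from Bochner_Integration.integral_add[OF this(1,2)]
      Bochner_Integration.integral_diff[OF Bochner_Integration.integrable_add[OF this(1,2)] this(3)]
    show ?thesis by simp
  qed
  also have "\<dots> = (LINT x|lborel. g x * of_real (G' x))"
    by (intro Bochner_Integration.integral_cong) (auto simp: G'_def algebra_simps)
  finally have G: "G_op \<phi> (dist_of g) \<eta> = (LINT x|lborel. g x * of_real (G' x))" .
  have "D_dist (L_op c \<phi> (dist_of f)) \<eta> = -
     (of_real c * (LINT x|lborel. f x * of_real (deriv \<eta> x))
      - 2 * (LINT x|lborel. f x * of_real (\<phi> x * deriv \<eta> x))
      - of_real c * (LINT x|lborel. f x * of_real (deriv (deriv \<phi>) x * deriv \<eta> x))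
      - 2 * of_real c * (LINT x|lborel. f x * of_real (deriv (\<lambda>x. deriv \<phi> x * deriv \<eta> x) x))
      - of_real c * (LINT x|lborel. f x * of_real (deriv (deriv (\<lambda>x. \<phi> x * deriv \<eta> x)) x)))"
    by (simp add: L_op_def mult_dist_def D_dist_def dist_of_def)
  also have "deriv (\<lambda>x. deriv \<phi> x * deriv \<eta> x)
      = (\<lambda>x. deriv (deriv \<phi>) x * deriv \<eta> x + deriv \<phi> x * deriv (deriv \<eta>) x)"
    by (simp add: deriv_smooth_mult s1 \<phi>1)
  also have "deriv (deriv (\<lambda>x. \<phi> x * deriv \<eta> x)) = (\<lambda>x. deriv (deriv \<phi>) x * deriv \<eta> x
      + 2 * deriv \<phi> x * deriv (deriv \<eta>) x + \<phi> x * deriv (deriv (deriv \<eta>)) x)"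
    by (simp add: deriv_smooth_mult deriv_smooth_add s1 s2 \<phi> \<phi>1 smooth_intros algebra_simps)
  also have "- (of_real c * (LINT x|lborel. f x * of_real (deriv \<eta> x))
      - 2 * (LINT x|lborel. f x * of_real (\<phi> x * deriv \<eta> x))
      - of_real c * (LINT x|lborel. f x * of_real (deriv (deriv \<phi>) x * deriv \<eta> x))
      - 2 * of_real c * (LINT x|lborel. f x * of_real
          (deriv (deriv \<phi>) x * deriv \<eta> x + deriv \<phi> x * deriv (deriv \<eta>) x))
      - of_real c * (LINT x|lborel. f x * of_real (deriv (deriv \<phi>) x * deriv \<eta> x
      + 2 * deriv \<phi> x * deriv (deriv \<eta>) x + \<phi> x * deriv (deriv (deriv \<eta>)) x)))
    = (LINT x|lborel. - (of_real c * (f x * of_real (deriv \<eta> x))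
      - 2 * (f x * of_real (\<phi> x * deriv \<eta> x))
      - of_real c * (f x * of_real (deriv (deriv \<phi>) x * deriv \<eta> x))
      - 2 * of_real c * (f x * of_real
          (deriv (deriv \<phi>) x * deriv \<eta> x + deriv \<phi> x * deriv (deriv \<eta>) x))
      - of_real c * (f x * of_real (deriv (deriv \<phi>) x * deriv \<eta> x
      + 2 * deriv \<phi> x * deriv (deriv \<eta>) x + \<phi> x * deriv (deriv (deriv \<eta>)) x))))"
    (is "_ = (LINT x|lborel. - (of_real c * ?a x - 2 * ?b x - of_real c * ?d x - 2 * of_real c * ?e x - of_real c * ?h x))")
  proof -
    have "integrable lborel ?a" "integrable lborel ?b" "integrable lborel ?d" "integrable lborel ?e" "integrable lborel ?h"
      by (intro int f smooth_intros s \<phi>; simp add: R1 R2 R3)+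
    then show ?thesis by simp
  qed
  also have "\<dots> = (LINT x|lborel. f x * of_real (L' x))"
    by (intro Bochner_Integration.integral_cong) (auto simp: L'_def algebra_simps)
  finally show ?thesis using G eq by simp
qed

text \<open>Test functions are real while Floquet solutions are complex, so real and imaginary parts
  are paired separately and recombined.\<close>

lemma A_graph_pairing_complex:
  fixes \<eta> :: "real \<Rightarrow> complex"
  assumes fg: "(f, g) \<in> A_graph c \<phi>" and \<phi>: "smooth \<phi>"
    and s: "smooth (\<lambda>x. Re (\<eta> x))" "smooth (\<lambda>x. Im (\<eta> x))"
    and R: "\<And>x. R < \<bar>x\<bar> \<Longrightarrow> \<eta> x = 0"
    and \<eta>1: "\<And>x. (\<eta> has_vector_derivative \<eta>1 x) (at x)"
    and \<eta>2: "\<And>x. (\<eta>1 has_vector_derivative \<eta>2 x) (at x)"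
    and \<eta>3: "\<And>x. (\<eta>2 has_vector_derivative \<eta>3 x) (at x)"
  defines "G' \<equiv> \<lambda>x. \<eta> x - of_real (2 * deriv \<phi> x) * \<eta>1 x - of_real (\<phi> x) * \<eta>2 x"
    and "L' \<equiv> \<lambda>x. of_real (2 * \<phi> x - c + 4 * c * deriv (deriv \<phi>) x) * \<eta>1 x
      + of_real (4 * c * deriv \<phi> x) * \<eta>2 x + of_real (c * \<phi> x) * \<eta>3 x"
  shows "(LINT x|lborel. g x * G' x) = (LINT x|lborel. f x * L' x)"
proof -
  have Re_der: "((\<lambda>x. Re (h x)) has_real_derivative Re h') (at x)"
    and Im_der: "((\<lambda>x. Im (h x)) has_real_derivative Im h') (at x)"
    if "(h has_vector_derivative h') (at x)" for h h' x
    using bounded_linear.has_vector_derivative[OF bounded_linear_Re that]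
      bounded_linear.has_vector_derivative[OF bounded_linear_Im that]
    by (simp_all add: has_real_derivative_iff_has_vector_derivative)
  have dRe: "deriv (\<lambda>x. Re (\<eta> x)) = (\<lambda>x. Re (\<eta>1 x))" "deriv (\<lambda>x. Re (\<eta>1 x)) = (\<lambda>x. Re (\<eta>2 x))"
    "deriv (\<lambda>x. Re (\<eta>2 x)) = (\<lambda>x. Re (\<eta>3 x))"
    and dIm: "deriv (\<lambda>x. Im (\<eta> x)) = (\<lambda>x. Im (\<eta>1 x))" "deriv (\<lambda>x. Im (\<eta>1 x)) = (\<lambda>x. Im (\<eta>2 x))"
    "deriv (\<lambda>x. Im (\<eta>2 x)) = (\<lambda>x. Im (\<eta>3 x))"
    using Re_der[OF \<eta>1] Re_der[OF \<eta>2] Re_der[OF \<eta>3] Im_der[OF \<eta>1] Im_der[OF \<eta>2] Im_der[OF \<eta>3]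
    by (auto intro!: ext DERIV_imp_deriv)
  have s1: "smooth (\<lambda>x. Re (\<eta>1 x))" "smooth (\<lambda>x. Im (\<eta>1 x))"
    using s[THEN smooth_deriv] by (simp_all add: dRe dIm)
  have s2: "smooth (\<lambda>x. Re (\<eta>2 x))" "smooth (\<lambda>x. Im (\<eta>2 x))"
    using s1[THEN smooth_deriv] by (simp_all add: dRe dIm)
  have s3: "smooth (\<lambda>x. Re (\<eta>3 x))" "smooth (\<lambda>x. Im (\<eta>3 x))"
    using s2[THEN smooth_deriv] by (simp_all add: dRe dIm)
  have t: "test_function (\<lambda>x. Re (\<eta> x))" "test_function (\<lambda>x. Im (\<eta> x))"
    using s R by (auto simp: test_function_def intro!: exI[of _ R])
  have R': "R < \<bar>x\<bar> \<Longrightarrow> Re (\<eta>1 x) = 0" "R < \<bar>x\<bar> \<Longrightarrow> Im (\<eta>1 x) = 0"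
    "R < \<bar>x\<bar> \<Longrightarrow> Re (\<eta>2 x) = 0" "R < \<bar>x\<bar> \<Longrightarrow> Im (\<eta>2 x) = 0"
    "R < \<bar>x\<bar> \<Longrightarrow> Re (\<eta>3 x) = 0" "R < \<bar>x\<bar> \<Longrightarrow> Im (\<eta>3 x) = 0" for x
  proof -
    have 1: "Re (\<eta>1 x) = 0" "Im (\<eta>1 x) = 0" if "R < \<bar>x\<bar>" for x
      using deriv_eq_0_outside[of R "\<lambda>x. Re (\<eta> x)" x] deriv_eq_0_outside[of R "\<lambda>x. Im (\<eta> x)" x] R that
      by (simp_all add: dRe dIm)
    have 2: "Re (\<eta>2 x) = 0" "Im (\<eta>2 x) = 0" if "R < \<bar>x\<bar>" for x
      using deriv_eq_0_outside[of R "\<lambda>x. Re (\<eta>1 x)" x] deriv_eq_0_outside[of R "\<lambda>x. Im (\<eta>1 x)" x] 1 that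
      by (simp_all add: dRe dIm)
    have 3: "Re (\<eta>3 x) = 0" "Im (\<eta>3 x) = 0" if "R < \<bar>x\<bar>" for x
      using deriv_eq_0_outside[of R "\<lambda>x. Re (\<eta>2 x)" x] deriv_eq_0_outside[of R "\<lambda>x. Im (\<eta>2 x)" x] 2 that
      by (simp_all add: dRe dIm)
    show "R < \<bar>x\<bar> \<Longrightarrow> Re (\<eta>1 x) = 0" "R < \<bar>x\<bar> \<Longrightarrow> Im (\<eta>1 x) = 0"
      "R < \<bar>x\<bar> \<Longrightarrow> Re (\<eta>2 x) = 0" "R < \<bar>x\<bar> \<Longrightarrow> Im (\<eta>2 x) = 0"
      "R < \<bar>x\<bar> \<Longrightarrow> Re (\<eta>3 x) = 0" "R < \<bar>x\<bar> \<Longrightarrow> Im (\<eta>3 x) = 0"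
      using 1 2 3 by auto
  qed
  have f: "f \<in> L2" and g: "g \<in> L2" using fg by (auto simp: A_graph_def)
  have int: "integrable lborel (\<lambda>x. h x * of_real (p x))"
    if "h \<in> L2" "smooth p" "\<And>x. R < \<bar>x\<bar> \<Longrightarrow> p x = 0" for h p
    by (intro L2_mult_integrable that L2_compact_support[of _ R] continuous_intros smooth_continuous)
      (use that in auto)
  note P1 = A_graph_pairing[OF fg \<phi> t(1), unfolded dRe]
  note P2 = A_graph_pairing[OF fg \<phi> t(2), unfolded dIm]
  let ?Gr = "\<lambda>x. Re (\<eta> x) - 2 * deriv \<phi> x * Re (\<eta>1 x) - \<phi> x * Re (\<eta>2 x)"
  let ?Gi = "\<lambda>x. Im (\<eta> x) - 2 * deriv \<phi> x * Im (\<eta>1 x) - \<phi> x * Im (\<eta>2 x)"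
  let ?Lr = "\<lambda>x. (2 * \<phi> x - c + 4 * c * deriv (deriv \<phi>) x) * Re (\<eta>1 x)
      + 4 * c * deriv \<phi> x * Re (\<eta>2 x) + c * \<phi> x * Re (\<eta>3 x)"
  let ?Li = "\<lambda>x. (2 * \<phi> x - c + 4 * c * deriv (deriv \<phi>) x) * Im (\<eta>1 x)
      + 4 * c * deriv \<phi> x * Im (\<eta>2 x) + c * \<phi> x * Im (\<eta>3 x)"
  have "g x * G' x = g x * of_real (?Gr x) + \<i> * (g x * of_real (?Gi x))" for x
  proof -
    have "G' x = of_real (?Gr x) + \<i> * of_real (?Gi x)"
      by (simp add: G'_def complex_eq_iff)
    then show ?thesis by (simp only: distrib_left mult.left_commute[of "g x" "\<i>"])
  qed
  moreover have "integrable lborel (\<lambda>x. g x * of_real (?Gr x))" "integrable lborel (\<lambda>x. g x * of_real (?Gi x))"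
    by (intro int g smooth_intros s s1 s2 \<phi>; simp add: R R')+
  ultimately have "(LINT x|lborel. g x * G' x)
      = (LINT x|lborel. g x * of_real (?Gr x)) + \<i> * (LINT x|lborel. g x * of_real (?Gi x))"
    by simp
  also have "\<dots> = (LINT x|lborel. f x * of_real (?Lr x)) + \<i> * (LINT x|lborel. f x * of_real (?Li x))"
    using P1 P2 by simp
  also have "\<dots> = (LINT x|lborel. f x * L' x)"
  proof -
    have "f x * L' x = f x * of_real (?Lr x) + \<i> * (f x * of_real (?Li x))" for x
    proof -
      have "L' x = of_real (?Lr x) + \<i> * of_real (?Li x)"
        by (simp add: L'_def complex_eq_iff)
      then show ?thesis by (simp only: distrib_left mult.left_commute[of "f x" "\<i>"])
    qed
    moreover have "integrable lborel (\<lambda>x. f x * of_real (?Lr x))" "integrable lborel (\<lambda>x. f x * of_real (?Li x))"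
      by (intro int f smooth_intros s s1 s2 s3 \<phi>; simp add: R R')+
    ultimately show ?thesis by simp
  qed
  finally show ?thesis .
qed

text \<open>As |\<kappa>| = 1, the norm is periodic, and a bound on one period is global.\<close>

lemma quasi_periodic_bounded:
  fixes f :: "real \<Rightarrow> complex"
  assumes "continuous_on UNIV f" "\<And>t. f (t + T) = \<kappa> * f t" "norm \<kappa> = 1" "0 < T"
  shows "\<exists>C>0. \<forall>t. norm (f t) \<le> C"
proof -
  interpret periodic_fun_simple "\<lambda>t. norm (f t)" T
    by standard (simp add: assms norm_mult)
  obtain C where C: "0 < C" "\<forall>t. \<bar>t\<bar> \<le> T \<longrightarrow> norm (f t) \<le> C"
    using continuous_bounded_interval[OF assms(1), of T] by blast
  have "norm (f t) \<le> C" for t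
  proof -
    define n where "n = \<lfloor>t / T\<rfloor>"
    have "of_int n * T \<le> t" "t < (of_int n + 1) * T"
      unfolding n_def using \<open>0 < T\<close> by (rule floor_divide_lower, rule floor_divide_upper)
    then have "\<bar>t - of_int n * T\<bar> \<le> T" by (auto simp: algebra_simps)
    then have "norm (f (t - of_int n * T)) \<le> C" using C by blast
    then show ?thesis by (simp add: minus_of_int)
  qed
  then show ?thesis using C(1) by blast
qed

lemma quasi_periodic_deriv:
  fixes f :: "real \<Rightarrow> complex"
  assumes "\<And>t. f (t + T) = \<kappa> * f t" "\<And>t. (f has_vector_derivative f' t) (at t)"
  shows "f' (t + T) = \<kappa> * f' t"
proof (rule vector_derivative_unique_at)
  show "((\<lambda>t. f (t + T)) has_vector_derivative f' (t + T)) (at t)"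
  proof -
    have "((\<lambda>t. t + T) has_vector_derivative 1) (at t)"
      by (auto intro!: derivative_eq_intros)
    from vector_diff_chain_at[OF this assms(2)] show ?thesis by (simp add: o_def)
  qed
  show "((\<lambda>t. f (t + T)) has_vector_derivative \<kappa> * f' t) (at t)"
    using has_vector_derivative_mult_right[OF assms(2)] assms(1) by simp
qed

lemma deriv_periodic:
  assumes "smooth \<phi>" "\<And>t. \<phi> (t + T) = \<phi> t"
  shows "deriv \<phi> (t + T) = deriv \<phi> t"
proof (rule DERIV_unique)
  show "((\<lambda>t. \<phi> (t + T)) has_real_derivative deriv \<phi> (t + T)) (at t)"
    using smooth_has_deriv[OF assms(1), of "t + T"] by (simp add: DERIV_shift)
  show "((\<lambda>t. \<phi> (t + T)) has_real_derivative deriv \<phi> t) (at t)"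
    using smooth_has_deriv[OF assms(1)] assms(2) by simp
qed

text \<open>The formal adjoint of \<open>G\<close> is \<open>\<psi> - \<phi>\<^sup>-\<^sup>1 (\<phi>\<^sup>2 \<psi>')'\<close>, hence coercive.\<close>

lemma adjoint_G_nonzero:
  fixes \<psi> :: "real \<Rightarrow> complex"
  assumes \<phi>: "smooth \<phi>" and pos: "\<And>t. 0 < \<phi> t" and per: "\<And>t. \<phi> (t + T) = \<phi> t" and T: "0 < T"
    and \<psi>1: "\<And>x. (\<psi> has_vector_derivative \<psi>1 x) (at x)"
    and \<psi>2: "\<And>x. (\<psi>1 has_vector_derivative \<psi>2 x) (at x)"
    and qp: "\<And>t. \<psi> (t + T) = \<kappa> * \<psi> t" and \<kappa>: "norm \<kappa> = 1" and nz: "\<psi> z \<noteq> 0"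
  shows "\<exists>x. \<psi> x - of_real (2 * deriv \<phi> x) * \<psi>1 x - of_real (\<phi> x) * \<psi>2 x \<noteq> 0"
proof (rule ccontr)
  assume "\<not> ?thesis"
  then have w: "\<psi> x = of_real (2 * deriv \<phi> x) * \<psi>1 x + of_real (\<phi> x) * \<psi>2 x" for x
    by (simp add: algebra_simps)
  \<comment> \<open>If the adjoint of G annihilates \<psi>, then (\<phi>^2 \<psi>')' = \<phi>
    \<psi>, so P has the derivative \<phi> |\<psi>|^2 + \<phi>^2 |\<psi>'|^2. But P is periodic,
    because \<kappa> cancels against its conjugate.\<close>
  define P where "P = (\<lambda>x. Re (of_real ((\<phi> x)\<^sup>2) * \<psi>1 x * cnj (\<psi> x)))"
  have P': "(P has_real_derivative \<phi> x * (norm (\<psi> x))\<^sup>2 + (\<phi> x)\<^sup>2 * (norm (\<psi>1 x))\<^sup>2) (at x)" for x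
  proof -
    have "((\<lambda>x. (\<phi> x)\<^sup>2) has_real_derivative 2 * \<phi> x * deriv \<phi> x) (at x)"
      using smooth_has_deriv[OF \<phi>] by (auto intro!: derivative_eq_intros)
    then have 1: "((\<lambda>x. of_real ((\<phi> x)\<^sup>2) :: complex) has_vector_derivative of_real (2 * \<phi> x * deriv \<phi> x)) (at x)"
      unfolding has_real_derivative_iff_has_vector_derivative
      by (rule bounded_linear.has_vector_derivative[OF bounded_linear_of_real])
    note 2 = has_vector_derivative_mult[OF has_vector_derivative_mult[OF 1 \<psi>2]
        bounded_linear.has_vector_derivative[OF bounded_linear_cnj \<psi>1]]
    have "of_real ((\<phi> x)\<^sup>2) * \<psi>1 x * cnj (\<psi>1 x) +
        (of_real ((\<phi> x)\<^sup>2) * \<psi>2 x + of_real (2 * \<phi> x * deriv \<phi> x) * \<psi>1 x) * cnj (\<psi> x)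
      = of_real ((\<phi> x)\<^sup>2) * (\<psi>1 x * cnj (\<psi>1 x)) + of_real (\<phi> x) * (\<psi> x * cnj (\<psi> x))"
      by (simp add: algebra_simps power2_eq_square w[of x])
    also have "\<dots> = of_real (\<phi> x * (norm (\<psi> x))\<^sup>2 + (\<phi> x)\<^sup>2 * (norm (\<psi>1 x))\<^sup>2)"
      by (simp add: complex_mult_cnj cmod_power2 algebra_simps)
    finally show ?thesis
      using bounded_linear.has_vector_derivative[OF bounded_linear_Re 2]
      unfolding has_real_derivative_iff_has_vector_derivative P_def by (metis Re_complex_of_real)
  qed
  have "0 < \<phi> z * (norm (\<psi> z))\<^sup>2 + (\<phi> z)\<^sup>2 * (norm (\<psi>1 z))\<^sup>2"
    using pos[of z] nz by (intro add_pos_nonneg) auto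
  from DERIV_pos_inc_right[OF P' this] obtain d where "0 < d" "\<And>h. 0 < h \<Longrightarrow> h < d \<Longrightarrow> P z < P (z + h)"
    by auto
  then have "P z < P (z + min (d / 2) T)" using T by auto
  also have "\<dots> \<le> P (z + T)"
  proof (rule DERIV_nonneg_imp_nondecreasing[where f = P])
    show "\<exists>y. (P has_real_derivative y) (at x) \<and> 0 \<le> y" for x
      by (rule exI, rule conjI, rule P') (simp add: pos less_imp_le)
    show "z + min (d / 2) T \<le> z + T" by simp
  qed
  also have "P (z + T) = P z"
  proof -
    have "\<kappa> * cnj \<kappa> = 1" using \<kappa> complex_norm_square[of \<kappa>] by simp
    moreover have "a * (\<kappa> * b) * cnj (\<kappa> * d) = (\<kappa> * cnj \<kappa>) * (a * b * cnj d)" for a b d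
      by simp
    ultimately have "a * (\<kappa> * b) * cnj (\<kappa> * d) = a * b * cnj d" for a b d
      by (simp only: mult_1_left)
    then show ?thesis
      by (simp only: P_def per qp quasi_periodic_deriv[OF qp \<psi>1])
  qed
  finally show False by simp
qed

section \<open>Cut-off estimates and the spectral criterion\<close>

lemma bump_deriv_bounded: "\<exists>C>0. \<forall>x. \<bar>(deriv ^^ i) bump x\<bar> \<le> C"
  and bump_deriv_eq_0: "1 < \<bar>x\<bar> \<Longrightarrow> (deriv ^^ i) bump x = 0"
  and smooth_bump_deriv: "smooth ((deriv ^^ i) bump)"
proof -
  show z: "(deriv ^^ i) bump x = 0" if "1 < \<bar>x\<bar>" for x
    using that by (induction i arbitrary: x) (auto simp: bump_eq_0 intro: deriv_eq_0_outside[of 1])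
  show s: "smooth ((deriv ^^ i) bump)"
    by (induction i) (auto simp: smooth_bump smooth_deriv)
  obtain C where C: "0 < C" "\<forall>x. \<bar>x\<bar> \<le> 1 \<longrightarrow> norm ((deriv ^^ i) bump x) \<le> C"
    using continuous_bounded_interval[OF smooth_continuous[OF s], of 1] by blast
  then have "\<bar>(deriv ^^ i) bump x\<bar> \<le> C" for x
    using z[of x] by (cases "\<bar>x\<bar> \<le> 1") auto
  with C(1) show "\<exists>C>0. \<forall>x. \<bar>(deriv ^^ i) bump x\<bar> \<le> C" by blast
qed

lemma weighted_AM_GM:
  fixes a b d :: real
  assumes "0 < d"
  shows "a * b \<le> a\<^sup>2 * d + b\<^sup>2 / (4 * d)"
proof -
  have "0 \<le> (2 * d * a - b)\<^sup>2 / (4 * d)" using assms by simp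
  also have "\<dots> = a\<^sup>2 * d + b\<^sup>2 / (4 * d) - a * b"
    using assms by (simp add: field_simps power2_eq_square)
  finally show ?thesis by simp
qed

text \<open>The product estimate keeps a free weight d, so that the term with f can be made small
  enough to be absorbed.\<close>

lemma norm_LINT_mult_le:
  fixes f r :: "real \<Rightarrow> complex"
  assumes f: "f \<in> L2" and r: "r \<in> L2" and d: "0 < d"
  shows "norm (LINT x|lborel. f x * r x) \<le> d * (LINT x|lborel. (norm (f x))\<^sup>2) + (LINT x|lborel. (norm (r x))\<^sup>2) / (4 * d)"
proof -
  have i: "integrable lborel (\<lambda>x. (norm (f x))\<^sup>2)" "integrable lborel (\<lambda>x. (norm (r x))\<^sup>2)"
    using f r by (auto simp: L2_def)
  have "norm (LINT x|lborel. f x * r x) \<le> (LINT x|lborel. norm (f x * r x))"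
    by (rule integral_norm_bound)
  also have "\<dots> \<le> (LINT x|lborel. (norm (f x))\<^sup>2 * d + (norm (r x))\<^sup>2 / (4 * d))"
    using integrable_norm[OF L2_mult_integrable[OF f r]] i weighted_AM_GM[OF d]
    by (intro integral_mono) (auto simp: norm_mult)
  also have "\<dots> = d * (LINT x|lborel. (norm (f x))\<^sup>2) + (LINT x|lborel. (norm (r x))\<^sup>2) / (4 * d)"
    using i by simp
  finally show ?thesis .
qed

lemma LINT_norm_square_le:
  fixes r :: "real \<Rightarrow> complex"
  assumes r: "r \<in> L2" and bnd: "\<And>x. norm (r x) \<le> C" and R: "\<And>x. R < \<bar>x\<bar> \<Longrightarrow> r x = 0" "0 \<le> R"
  shows "(LINT x|lborel. (norm (r x))\<^sup>2) \<le> 2 * R * C\<^sup>2"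
proof -
  have "(LINT x|lborel. (norm (r x))\<^sup>2) \<le> (LINT x|lborel. indicator {-R..R} x * C\<^sup>2)"
  proof (rule integral_mono)
    show "integrable lborel (\<lambda>x. (norm (r x))\<^sup>2)" using r by (simp add: L2_def)
    show "integrable lborel (\<lambda>x. indicat_real {- R..R} x * C\<^sup>2)"
      by (intro integrable_mult_left integrable_real_indicator) (auto simp: emeasure_lborel_Icc_eq)
    fix x
    show "(norm (r x))\<^sup>2 \<le> indicat_real {- R..R} x * C\<^sup>2"
    proof (cases "\<bar>x\<bar> \<le> R")
      case True
      then show ?thesis using power_mono[OF bnd[of x], of 2] by (auto simp: indicator_def)
    qed (use R(1)[of x] in auto)
  qed
  also have "\<dots> = 2 * R * C\<^sup>2" using R(2) by simp
  finally show ?thesis .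
qed

lemma L2_norm_power2: "(L2_norm f)\<^sup>2 = (LINT x|lborel. (norm (f x))\<^sup>2)"
  by (simp add: L2_norm_def)

text \<open>If \<open>\<mu>\<close> were in the resolvent set, testing \<open>(A - \<mu>) f = h\<close> with the slowly cut off adjoint
  Floquet solution \<open>\<psi>\<close>, where \<open>h\<close> is the cut off conjugate of \<open>G\<^sup>* \<psi>\<close>, would force the \<open>L\<^sup>2\<close> norm of
  \<open>h\<close> to vanish in the limit.\<close>

proposition adjoint_floquet_in_spectrum:
  fixes \<psi> :: "real \<Rightarrow> complex"
  assumes \<phi>: "smooth \<phi>" and pos: "\<And>t. 0 < \<phi> t" and per: "\<And>t. \<phi> (t + T) = \<phi> t" and T: "0 < T"
    and s: "smooth (\<lambda>x. Re (\<psi> x))" "smooth (\<lambda>x. Im (\<psi> x))"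
    and \<psi>1: "\<And>x. (\<psi> has_vector_derivative \<psi>1 x) (at x)"
    and \<psi>2: "\<And>x. (\<psi>1 has_vector_derivative \<psi>2 x) (at x)"
    and \<psi>3: "\<And>x. (\<psi>2 has_vector_derivative \<psi>3 x) (at x)"
    and qp: "\<And>t. \<psi> (t + T) = \<kappa> * \<psi> t" and \<kappa>: "norm \<kappa> = 1" and nz: "\<psi> z \<noteq> 0"
    and eq: "\<And>x. of_real (c * \<phi> x) * \<psi>3 x + (of_real (4 * c * deriv \<phi> x) + \<mu> * of_real (\<phi> x)) * \<psi>2 x
       + (of_real (2 * \<phi> x - c + 4 * c * deriv (deriv \<phi>) x) + \<mu> * of_real (2 * deriv \<phi> x)) * \<psi>1 x
       - \<mu> * \<psi> x = 0"
  shows "\<mu> \<in> L2_spectrum (A_graph c \<phi>)"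
proof (rule ccontr)
  assume "\<mu> \<notin> L2_spectrum (A_graph c \<phi>)"
  then have res: "\<mu> \<in> L2_resolvent_set (A_graph c \<phi>)" by (simp add: L2_spectrum_def)
  then obtain C where C: "\<And>f g. (f, g) \<in> A_graph c \<phi> \<Longrightarrow> L2_norm f \<le> C * L2_norm (\<lambda>x. g x - \<mu> * f x)"
    unfolding L2_resolvent_set_def by blast
  have surj: "\<exists>f g. (f, g) \<in> A_graph c \<phi> \<and> (AE x in lborel. g x - \<mu> * f x = h x)" if "h \<in> L2" for h
    using res that unfolding L2_resolvent_set_def by blast
  note \<phi>1 = smooth_deriv[OF \<phi>] note \<phi>2 = smooth_deriv[OF \<phi>1]
  have cont: "continuous_on UNIV \<psi>" "continuous_on UNIV \<psi>1" "continuous_on UNIV \<psi>2"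
    using has_vector_derivative_imp_continuous_on[OF \<psi>1] has_vector_derivative_imp_continuous_on[OF \<psi>2]
      has_vector_derivative_imp_continuous_on[OF \<psi>3] by auto
  note qp1 = quasi_periodic_deriv[OF qp \<psi>1] note qp2 = quasi_periodic_deriv[OF qp1 \<psi>2]
  \<comment> \<open>The adjoint of G applied to \<psi>. Being nonzero at some x0, it keeps the norm
    of the cut off data away from 0.\<close>
  define w where "w = (\<lambda>x. \<psi> x - of_real (2 * deriv \<phi> x) * \<psi>1 x - of_real (\<phi> x) * \<psi>2 x)"
  have w_cont: "continuous_on UNIV w"
    unfolding w_def by (intro continuous_intros cont smooth_continuous \<phi> \<phi>1)
  obtain x0 where x0: "w x0 \<noteq> 0"
    using adjoint_G_nonzero[OF \<phi> pos per T \<psi>1 \<psi>2 qp \<kappa> nz] unfolding w_def by blast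
  have bnd_per: "\<exists>C>0. \<forall>t. \<bar>p t\<bar> \<le> C" if "smooth p" "\<And>t. p (t + T) = p t" for p :: "real \<Rightarrow> real"
    using quasi_periodic_bounded[of "\<lambda>t. of_real (p t)" T 1] that T
    by (auto intro!: continuous_intros smooth_continuous)
  obtain a0 where a0: "0 < a0" "\<And>t. norm (\<psi> t) \<le> a0" using quasi_periodic_bounded[OF cont(1) qp \<kappa> T] by auto
  obtain a1 where a1: "0 < a1" "\<And>t. norm (\<psi>1 t) \<le> a1" using quasi_periodic_bounded[OF cont(2) qp1 \<kappa> T] by auto
  obtain a2 where a2: "0 < a2" "\<And>t. norm (\<psi>2 t) \<le> a2" using quasi_periodic_bounded[OF cont(3) qp2 \<kappa> T] by auto
  obtain p0 where p0: "0 < p0" "\<And>t. \<bar>\<phi> t\<bar> \<le> p0" using bnd_per[OF \<phi> per] by auto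
  obtain p1 where p1: "0 < p1" "\<And>t. \<bar>deriv \<phi> t\<bar> \<le> p1" using bnd_per[OF \<phi>1 deriv_periodic[OF \<phi> per]] by auto
  obtain p2 where p2: "0 < p2" "\<And>t. \<bar>deriv (deriv \<phi>) t\<bar> \<le> p2"
    using bnd_per[OF \<phi>2 deriv_periodic[OF \<phi>1 deriv_periodic[OF \<phi> per]]] by auto
  define B where "B = (\<lambda>i. (deriv ^^ i) bump)"
  have B0: "B 0 = bump" and BS: "deriv (B i) = B (Suc i)" for i by (simp_all add: B_def)
  have "\<exists>C. \<forall>x. \<bar>B i x\<bar> \<le> C" for i
    using bump_deriv_bounded[of i] unfolding B_def by blast
  then obtain bb where bb: "\<And>i x. \<bar>B i x\<bar> \<le> bb i" by metis
  have bb0: "0 \<le> bb i" for i using bb[of i 0] by linarith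
  \<comment> \<open>\<open>q\<close> bounds the coefficient of the first derivative.
    \<open>E1\<close> and \<open>E2\<close> bound the cut-off errors e1 and e2 below divided by
    \<epsilon>, and repeat their structure as sums of products.\<close>
  define q where "q = \<bar>2 * 1\<bar> * p0 + \<bar>c\<bar> + 4 * \<bar>c\<bar> * p2"
  define E1 where "E1 = (2 * p1) * (bb 1 * a0) + p0 * (bb 2 * a0 + 2 * (bb 1 * a1))"
  define E2 where "E2 = q * (bb 1 * a0) + (4 * \<bar>c\<bar> * p1) * (bb 2 * a0 + 2 * (bb 1 * a1))
    + (\<bar>c\<bar> * p0) * (bb 3 * a0 + 3 * (bb 2 * a1) + 3 * (bb 1 * a2)) + norm \<mu> * E1"
  have E1: "0 \<le> E1" unfolding E1_def using bb0 a0 a1 p0 p1 by simp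
  have E2: "0 \<le> E2" unfolding E2_def q_def using bb0 a0 a1 a2 p0 p1 p2 E1 by simp
  define I where "I = (\<lambda>\<epsilon>. LINT x|lborel. (norm (of_real (bump (\<epsilon> * x)) * cnj (w x)))\<^sup>2)"
  have upper: "I \<epsilon> \<le> 4 * (4 * ((\<bar>C\<bar> + 1)\<^sup>2) * E2\<^sup>2 + E1\<^sup>2 * 4) * \<epsilon>" if \<epsilon>: "0 < \<epsilon>" "\<epsilon> \<le> 1" for \<epsilon>
  proof -
    \<comment> \<open>Every derivative of the cut-off brings a factor \<epsilon>, so the terms in
      which it is differentiated are errors of order \<epsilon>.\<close>
    define cut where "cut = (\<lambda>i x. \<epsilon> ^ i * B i (\<epsilon> * x))"
    have B_diff: "(B i has_real_derivative B (Suc i) x) (at x)" for i x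
      using smooth_has_deriv[OF smooth_bump_deriv[of i]] by (simp add: B_def)
    have cut': "(cut i has_real_derivative cut (Suc i) x) (at x)" for i x
      unfolding cut_def
      by (rule derivative_eq_intros DERIV_chain2[OF B_diff] refl | simp)+
    then have cut'v: "((\<lambda>x. of_real (cut i x) :: complex) has_vector_derivative of_real (cut (Suc i) x)) (at x)" for i x
      unfolding has_real_derivative_iff_has_vector_derivative
      by (rule bounded_linear.has_vector_derivative[OF bounded_linear_of_real])
    have cut_cont: "continuous_on UNIV (cut i)" for i
      using cut' DERIV_isCont continuous_at_imp_continuous_on by blast
    have cut0: "cut i x = 0" if "1 / \<epsilon> < \<bar>x\<bar>" for i x
    proof -
      have "1 < \<bar>\<epsilon> * x\<bar>" using that \<epsilon> by (simp add: abs_mult divide_less_eq mult.commute)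
      then show ?thesis by (simp add: cut_def B_def bump_deriv_eq_0)
    qed
    have cut_bnd: "\<bar>cut i x\<bar> \<le> \<epsilon> * bb i" if "0 < i" for i x
    proof -
      have "\<epsilon> ^ i \<le> \<epsilon> ^ 1" using that \<epsilon> by (intro power_decreasing) auto
      then have "\<epsilon> ^ i * \<bar>B i (\<epsilon> * x)\<bar> \<le> \<epsilon> ^ 1 * bb i" using bb \<epsilon> by (intro mult_mono) auto
      then show ?thesis using \<epsilon> by (simp add: cut_def abs_mult)
    qed
    have cut_smooth: "smooth (cut 0)"
      using smooth_affine[OF smooth_bump, of \<epsilon> 0] by (simp add: cut_def B0)
    define \<eta> where "\<eta> = (\<lambda>x. of_real (cut 0 x) * \<psi> x)"
    define \<eta>1 where "\<eta>1 = (\<lambda>x. of_real (cut 1 x) * \<psi> x + of_real (cut 0 x) * \<psi>1 x)"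
    define \<eta>2 where "\<eta>2 = (\<lambda>x. of_real (cut 2 x) * \<psi> x + 2 * (of_real (cut 1 x) * \<psi>1 x) + of_real (cut 0 x) * \<psi>2 x)"
    define \<eta>3 where "\<eta>3 = (\<lambda>x. of_real (cut 3 x) * \<psi> x + 3 * (of_real (cut 2 x) * \<psi>1 x)
      + 3 * (of_real (cut 1 x) * \<psi>2 x) + of_real (cut 0 x) * \<psi>3 x)"
    note m = has_vector_derivative_mult[OF cut'v]
    have d1: "(\<eta> has_vector_derivative \<eta>1 x) (at x)" for x
      unfolding \<eta>_def \<eta>1_def using m[OF \<psi>1, of 0 x]
      by (rule has_vector_derivative_eq_rhs) simp
    have d2: "(\<eta>1 has_vector_derivative \<eta>2 x) (at x)" for x
      unfolding \<eta>1_def \<eta>2_def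
      using has_vector_derivative_add[OF m[OF \<psi>1, of 1 x] m[OF \<psi>2, of 0 x]]
      by (rule has_vector_derivative_eq_rhs) (simp add: numeral_2_eq_2)
    have d3: "(\<eta>2 has_vector_derivative \<eta>3 x) (at x)" for x
      unfolding \<eta>2_def \<eta>3_def
      using has_vector_derivative_add[OF has_vector_derivative_add[OF m[OF \<psi>1, of 2 x]
          has_vector_derivative_mult_right[OF m[OF \<psi>2, of 1 x], of 2]] m[OF \<psi>3, of 0 x]]
      by (rule has_vector_derivative_eq_rhs) (simp add: numeral_2_eq_2 numeral_3_eq_3 algebra_simps)
    \<comment> \<open>With the conjugate of w, the integral of h against the main part
      \<open>cut 0 x * w x\<close> of G' is the squared norm of h.\<close>
    define h where "h = (\<lambda>x. of_real (cut 0 x) * cnj (w x))"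
    have h: "h \<in> L2"
      unfolding h_def
      by (intro L2_compact_support[of _ "1 / \<epsilon>"] continuous_intros cut_cont w_cont) (simp add: cut0)
    obtain f g where fg: "(f, g) \<in> A_graph c \<phi>" and gh: "AE x in lborel. g x - \<mu> * f x = h x"
      using surj[OF h] by blast
    have f: "f \<in> L2" and g: "g \<in> L2" using fg by (auto simp: A_graph_def)
    define G' where "G' = (\<lambda>x. \<eta> x - of_real (2 * deriv \<phi> x) * \<eta>1 x - of_real (\<phi> x) * \<eta>2 x)"
    define L' where "L' = (\<lambda>x. of_real (2 * \<phi> x - c + 4 * c * deriv (deriv \<phi>) x) * \<eta>1 x
      + of_real (4 * c * deriv \<phi> x) * \<eta>2 x + of_real (c * \<phi> x) * \<eta>3 x)"
    have pair: "(LINT x|lborel. g x * G' x) = (LINT x|lborel. f x * L' x)"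
      unfolding G'_def L'_def
    proof (rule A_graph_pairing_complex[OF fg \<phi> _ _ _ d1 d2 d3])
      show "smooth (\<lambda>x. Re (\<eta> x))" "smooth (\<lambda>x. Im (\<eta> x))"
        unfolding \<eta>_def by (auto intro!: smooth_mult s cut_smooth)
      show "\<eta> x = 0" if "1 / \<epsilon> < \<bar>x\<bar>" for x using cut0[OF that] by (simp add: \<eta>_def)
    qed
    define e1 where "e1 = (\<lambda>x. - (of_real (2 * deriv \<phi> x) * (of_real (cut 1 x) * \<psi> x)
      + of_real (\<phi> x) * (of_real (cut 2 x) * \<psi> x + 2 * (of_real (cut 1 x) * \<psi>1 x))))"
    define e2 where "e2 = (\<lambda>x. of_real (2 * \<phi> x - c + 4 * c * deriv (deriv \<phi>) x) * (of_real (cut 1 x) * \<psi> x)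
      + of_real (4 * c * deriv \<phi> x) * (of_real (cut 2 x) * \<psi> x + 2 * (of_real (cut 1 x) * \<psi>1 x))
      + of_real (c * \<phi> x) * (of_real (cut 3 x) * \<psi> x + 3 * (of_real (cut 2 x) * \<psi>1 x) + 3 * (of_real (cut 1 x) * \<psi>2 x))
      - \<mu> * e1 x)"
    have G'_eq: "G' x = of_real (cut 0 x) * w x + e1 x" for x
      by (simp add: G'_def \<eta>_def \<eta>1_def \<eta>2_def e1_def w_def algebra_simps)
    \<comment> \<open>The terms of L' - \<mu> G' with undifferentiated cut-off add up to the cut-off
      times the adjoint equation for \<psi>, hence to 0; what remains is e2.\<close>
    have L'_eq: "L' x = \<mu> * G' x + e2 x" for x
    proof -
      have "L' x - \<mu> * G' x - e2 x = of_real (cut 0 x) *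
       (of_real (c * \<phi> x) * \<psi>3 x + (of_real (4 * c * deriv \<phi> x) + \<mu> * of_real (\<phi> x)) * \<psi>2 x
       + (of_real (2 * \<phi> x - c + 4 * c * deriv (deriv \<phi>) x) + \<mu> * of_real (2 * deriv \<phi> x)) * \<psi>1 x
       - \<mu> * \<psi> x)"
        by (simp add: G'_eq w_def L'_def \<eta>1_def \<eta>2_def \<eta>3_def e2_def algebra_simps)
      then have "L' x - \<mu> * G' x - e2 x = 0" by (simp only: eq mult_zero_right)
      then show ?thesis by (simp add: algebra_simps)
    qed
    have e1_L2: "e1 \<in> L2"
      unfolding e1_def
      by (intro L2_compact_support[of _ "1 / \<epsilon>"] continuous_intros cut_cont cont smooth_continuous \<phi> \<phi>1)
        (simp add: cut0)
    have e2_L2: "e2 \<in> L2"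
      unfolding e2_def e1_def
      by (intro L2_compact_support[of _ "1 / \<epsilon>"] continuous_intros cut_cont cont smooth_continuous \<phi> \<phi>1 \<phi>2)
        (simp add: cut0)
    have G'_L2: "G' \<in> L2"
      unfolding G'_eq[abs_def] e1_def
      by (intro L2_compact_support[of _ "1 / \<epsilon>"] continuous_intros cut_cont w_cont cont smooth_continuous \<phi> \<phi>1)
        (simp add: cut0)
    have t: "norm (of_real (cut i x) * y) \<le> \<epsilon> * (bb i * a)" if "0 < i" "norm y \<le> a" for i x and y :: complex and a
    proof -
      have "\<bar>cut i x\<bar> * norm y \<le> (\<epsilon> * bb i) * a"
        using cut_bnd[OF that(1)] that(2) bb0 \<epsilon> by (intro mult_mono) auto
      then show ?thesis by (simp add: norm_mult mult.assoc)
    qed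
    have k: "norm (of_real r * y) \<le> \<epsilon> * (a * b)" if "\<bar>r\<bar> \<le> a" "norm y \<le> \<epsilon> * b" for r a b and y :: complex
    proof -
      have "\<bar>r\<bar> * norm y \<le> a * (\<epsilon> * b)" using that by (intro mult_mono) auto
      then show ?thesis by (simp add: norm_mult mult_ac)
    qed
    have pl: "norm (y + y') \<le> \<epsilon> * (a + b)" if "norm y \<le> \<epsilon> * a" "norm y' \<le> \<epsilon> * b" for a b and y y' :: complex
      using norm_triangle_ineq[of y y'] that by (simp add: distrib_left)
    have nn: "norm (numeral n * y) \<le> \<epsilon> * (numeral n * b)" if "norm y \<le> \<epsilon> * b" for n b and y :: complex
      using k[of "numeral n" "numeral n" y b] that by simp
    note t1 = t[OF zero_less_one] and t2 = t[OF zero_less_numeral]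
    have e1_bnd: "norm (e1 x) \<le> \<epsilon> * E1" for x
      unfolding e1_def E1_def norm_minus_cancel
      by (rule pl[OF k[OF _ t1[OF a0(2)]] k[OF p0(2) pl[OF t2[OF a0(2)] nn[OF t1[OF a1(2)]]]]])
        (use p1(2)[of x] in \<open>simp add: abs_mult\<close>)
    have e2_bnd: "norm (e2 x) \<le> \<epsilon> * E2" for x
    proof -
      have c1: "\<bar>2 * \<phi> x - c + 4 * c * deriv (deriv \<phi>) x\<bar> \<le> q"
      proof -
        have "\<bar>4 * c * deriv (deriv \<phi>) x\<bar> \<le> 4 * \<bar>c\<bar> * p2"
          using p2(2)[of x] by (simp add: abs_mult mult_left_mono)
        then show ?thesis using p0(2)[of x] unfolding q_def by linarith
      qed
      have c2: "\<bar>4 * c * deriv \<phi> x\<bar> \<le> 4 * \<bar>c\<bar> * p1" and c3: "\<bar>c * \<phi> x\<bar> \<le> \<bar>c\<bar> * p0"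
        using p1(2)[of x] p0(2)[of x] by (simp_all add: abs_mult mult_left_mono)
      have c4: "norm (- (\<mu> * e1 x)) \<le> \<epsilon> * (norm \<mu> * E1)"
        using mult_left_mono[OF e1_bnd[of x] norm_ge_zero[of \<mu>]] by (simp add: norm_mult mult_ac)
      show ?thesis
        unfolding e2_def E2_def diff_conv_add_uminus[of _ "\<mu> * e1 x"]
        by (rule pl[OF pl[OF pl[OF k[OF c1 t1[OF a0(2)]] k[OF c2 pl[OF t2[OF a0(2)] nn[OF t1[OF a1(2)]]]]]
              k[OF c3 pl[OF pl[OF t2[OF a0(2)] nn[OF t2[OF a1(2)]]] nn[OF t1[OF a2(2)]]]]] c4])
    qed
    have e_zero: "e1 x = 0" "e2 x = 0" if "1 / \<epsilon> < \<bar>x\<bar>" for x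
      using cut0[OF that] by (simp_all add: e1_def e2_def)
    have I_eq: "I \<epsilon> = (LINT x|lborel. (norm (h x))\<^sup>2)"
      by (simp add: I_def h_def cut_def B0)
    have "(LINT x|lborel. f x * L' x) = (LINT x|lborel. \<mu> * (f x * G' x) + f x * e2 x)"
      by (simp add: L'_eq algebra_simps)
    also have "\<dots> = \<mu> * (LINT x|lborel. f x * G' x) + (LINT x|lborel. f x * e2 x)"
      using L2_mult_integrable[OF f G'_L2] L2_mult_integrable[OF f e2_L2] by simp
    finally have A: "(LINT x|lborel. f x * L' x) = \<mu> * (LINT x|lborel. f x * G' x) + (LINT x|lborel. f x * e2 x)" .
    have "(LINT x|lborel. g x * G' x) = (LINT x|lborel. \<mu> * (f x * G' x) + h x * G' x)"
    proof (rule integral_cong_AE)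
      show "AE x in lborel. g x * G' x = \<mu> * (f x * G' x) + h x * G' x"
        using gh by eventually_elim (simp add: algebra_simps flip: distrib_left)
      show "(\<lambda>x. g x * G' x) \<in> borel_measurable lborel" "(\<lambda>x. \<mu> * (f x * G' x) + h x * G' x) \<in> borel_measurable lborel"
        using f g h G'_L2 by (auto simp: L2_def)
    qed
    also have "\<dots> = \<mu> * (LINT x|lborel. f x * G' x) + (LINT x|lborel. h x * G' x)"
      using L2_mult_integrable[OF f G'_L2] L2_mult_integrable[OF h G'_L2] by simp
    \<comment> \<open>Since g = \<mu> f + h almost everywhere, the terms with f G' cancel, and
      testing h against G' leaves only the error e2.\<close>
    finally have B: "(LINT x|lborel. h x * G' x) = (LINT x|lborel. f x * e2 x)"
      using pair A by simp
    have "(LINT x|lborel. h x * G' x) = (LINT x|lborel. of_real ((norm (h x))\<^sup>2) + h x * e1 x)"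
    proof (rule Bochner_Integration.integral_cong[OF refl])
      fix x
      have "of_real ((norm (h x))\<^sup>2) = h x * cnj (h x)" by (rule complex_norm_square)
      also have "cnj (h x) = of_real (cut 0 x) * w x" by (simp add: h_def)
      finally show "h x * G' x = of_real ((norm (h x))\<^sup>2) + h x * e1 x"
        by (simp only: G'_eq distrib_left)
    qed
    also have "\<dots> = of_real (I \<epsilon>) + (LINT x|lborel. h x * e1 x)"
    proof -
      have "integrable lborel (\<lambda>x. (norm (h x))\<^sup>2)" using h by (simp add: L2_def)
      from Bochner_Integration.integral_add[OF integrable_of_real[OF this] L2_mult_integrable[OF h e1_L2]]
      show ?thesis by (simp add: I_eq del: of_real_power)
    qed
    finally have "of_real (I \<epsilon>) = (LINT x|lborel. f x * e2 x) - (LINT x|lborel. h x * e1 x)"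
      using B by (simp add: algebra_simps)
    then have "norm (of_real (I \<epsilon>) :: complex) \<le> norm (LINT x|lborel. f x * e2 x) + norm (LINT x|lborel. h x * e1 x)"
      by (simp add: norm_triangle_ineq4)
    then have main: "I \<epsilon> \<le> norm (LINT x|lborel. f x * e2 x) + norm (LINT x|lborel. h x * e1 x)"
      by simp
    have fI: "(LINT x|lborel. (norm (f x))\<^sup>2) \<le> (\<bar>C\<bar> + 1)\<^sup>2 * I \<epsilon>"
    proof -
      have "L2_norm (\<lambda>x. g x - \<mu> * f x) = L2_norm h"
        unfolding L2_norm_def
        by (rule arg_cong[where f = sqrt], rule integral_cong_AE)
          (use gh f g h in \<open>auto simp: L2_def\<close>)
      with C[OF fg] have "L2_norm f \<le> C * L2_norm h" by simp
      also have "\<dots> \<le> (\<bar>C\<bar> + 1) * L2_norm h"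
        by (intro mult_right_mono) (auto simp: L2_norm_def)
      finally have "(L2_norm f)\<^sup>2 \<le> ((\<bar>C\<bar> + 1) * L2_norm h)\<^sup>2"
        by (intro power_mono) (auto simp: L2_norm_def)
      then show ?thesis by (simp add: power_mult_distrib L2_norm_power2 I_eq)
    qed
    \<comment> \<open>Adding 1 to |C| makes K positive. With the weight 1/(4 K), the resolvent bound
      turns the term with f into I/4, which the left side absorbs; the other term is O(\<epsilon>),
      as the squared norm of e2 is at most the support length 2/\<epsilon> times (\<epsilon>
      E2)^2.\<close>
    define K where "K = (\<bar>C\<bar> + 1)\<^sup>2"
    have K: "0 < K" by (simp add: K_def add_nonneg_pos)
    have "norm (LINT x|lborel. f x * e2 x) \<le> (1 / (4 * K)) * (LINT x|lborel. (norm (f x))\<^sup>2)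
        + (LINT x|lborel. (norm (e2 x))\<^sup>2) / (4 * (1 / (4 * K)))"
      by (rule norm_LINT_mult_le[OF f e2_L2]) (use K in simp)
    also have "\<dots> \<le> (1 / (4 * K)) * (K * I \<epsilon>) + (2 * (1 / \<epsilon>) * (\<epsilon> * E2)\<^sup>2) / (4 * (1 / (4 * K)))"
      using fI K \<epsilon> e2_bnd e_zero
      by (intro add_mono mult_left_mono divide_right_mono LINT_norm_square_le[OF e2_L2])
        (auto simp: K_def)
    also have "\<dots> = I \<epsilon> / 4 + 2 * K * E2\<^sup>2 * \<epsilon>"
      using K \<epsilon> by (simp add: field_simps power2_eq_square)
    finally have 1: "norm (LINT x|lborel. f x * e2 x) \<le> I \<epsilon> / 4 + 2 * K * E2\<^sup>2 * \<epsilon>" .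
    have "norm (LINT x|lborel. h x * e1 x) \<le> (1 / 4) * I \<epsilon>
        + (LINT x|lborel. (norm (e1 x))\<^sup>2) / (4 * (1 / 4))"
      unfolding I_eq by (rule norm_LINT_mult_le[OF h e1_L2]) simp
    also have "\<dots> \<le> (1 / 4) * I \<epsilon> + (2 * (1 / \<epsilon>) * (\<epsilon> * E1)\<^sup>2) / (4 * (1 / 4))"
      using \<epsilon> e1_bnd e_zero
      by (intro add_left_mono divide_right_mono LINT_norm_square_le[OF e1_L2]) auto
    also have "\<dots> = I \<epsilon> / 4 + 2 * E1\<^sup>2 * \<epsilon>"
      using \<epsilon> by (simp add: field_simps power2_eq_square)
    finally have 2: "norm (LINT x|lborel. h x * e1 x) \<le> I \<epsilon> / 4 + 2 * E1\<^sup>2 * \<epsilon>" .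
    have "I \<epsilon> \<le> 4 * K * E2\<^sup>2 * \<epsilon> + 4 * E1\<^sup>2 * \<epsilon>" using main 1 2 by linarith
    also have "\<dots> \<le> 4 * (4 * K * E2\<^sup>2 + E1\<^sup>2 * 4) * \<epsilon>"
    proof -
      have "0 \<le> K * E2\<^sup>2 * \<epsilon>" "0 \<le> E1\<^sup>2 * \<epsilon>" using K \<epsilon> by auto
      then show ?thesis by (simp add: algebra_simps)
    qed
    finally show ?thesis by (simp add: K_def)
  qed
  \<comment> \<open>Near x0 the function w stays away from 0. For \<epsilon> \<le> 1/(2 (|x0| + 1)),
    multiplication by \<epsilon> sends the points within distance 1 of x0 into [-1/2, 1/2], where
    the bump has a positive minimum.\<close>
  obtain m where m: "0 < m" "\<And>\<epsilon>. 0 < \<epsilon> \<Longrightarrow> \<epsilon> \<le> 1 / (2 * (\<bar>x0\<bar> + 1)) \<Longrightarrow> m \<le> I \<epsilon>"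
  proof -
    have "isCont w x0" using w_cont by (simp add: continuous_on_eq_continuous_at)
    then obtain d0 where d0: "0 < d0" "\<And>x. \<bar>x - x0\<bar> < d0 \<Longrightarrow> norm (w x - w x0) < norm (w x0) / 2"
      unfolding continuous_at_eps_delta using x0 by (metis dist_norm half_gt_zero_iff real_norm_def zero_less_norm_iff)
    define d where "d = min (d0 / 2) 1"
    have d: "0 < d" "d \<le> 1" "d < d0" using d0(1) by (auto simp: d_def)
    have "compact (bump ` {-1/2..1/2})"
      by (intro compact_continuous_image smooth_continuous smooth_bump) auto
    then obtain y where y: "y \<in> {-1/2..1/2}" "\<And>x. x \<in> {-1/2..1/2} \<Longrightarrow> bump y \<le> bump x"
      using compact_attains_inf[of "bump ` {-1/2..1/2::real}"] by auto
    have "0 < bump y" using y(1) by (intro bump_pos) auto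
    define m where "m = (2 * d) * (bump y * (norm (w x0) / 2))\<^sup>2"
    have "0 < m" using d x0 \<open>0 < bump y\<close> by (simp add: m_def)
    moreover have "m \<le> I \<epsilon>" if \<epsilon>: "0 < \<epsilon>" "\<epsilon> \<le> 1 / (2 * (\<bar>x0\<bar> + 1))" for \<epsilon>
    proof -
      have "m = (LINT x|lborel. indicator {x0 - d..x0 + d} x * (bump y * (norm (w x0) / 2))\<^sup>2)"
        using d by (simp add: m_def)
      also have "\<dots> \<le> I \<epsilon>"
        unfolding I_def
      proof (rule integral_mono)
        have b0: "bump (\<epsilon> * x) = 0" if "1 / \<epsilon> < \<bar>x\<bar>" for x
          using that \<epsilon> by (intro bump_eq_0) (simp add: abs_mult divide_less_eq mult.commute)
        show "integrable lborel (\<lambda>x. (norm (of_real (bump (\<epsilon> * x)) * cnj (w x)))\<^sup>2)"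
          by (intro integrable_compact_support[of _ "1 / \<epsilon>"] continuous_intros w_cont
              continuous_on_compose2[OF smooth_continuous[OF smooth_bump, of UNIV]])
            (auto simp: b0)
        show "integrable lborel (\<lambda>x. indicat_real {x0 - d..x0 + d} x * (bump y * (norm (w x0) / 2))\<^sup>2)"
          by (intro integrable_mult_left integrable_real_indicator) (auto simp: emeasure_lborel_Icc_eq)
        fix x
        show "indicat_real {x0 - d..x0 + d} x * (bump y * (norm (w x0) / 2))\<^sup>2
            \<le> (norm (of_real (bump (\<epsilon> * x)) * cnj (w x)))\<^sup>2"
        proof (cases "x \<in> {x0 - d..x0 + d}")
          case True
          then have x: "\<bar>x - x0\<bar> \<le> d" by auto
          then have "norm (w x0) / 2 \<le> norm (w x)"
            using d0(2)[of x] d norm_triangle_ineq3[of "w x" "w x0"] by linarith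
          moreover have "bump y \<le> bump (\<epsilon> * x)"
          proof (rule y(2))
            have "\<bar>x\<bar> \<le> \<bar>x0\<bar> + 1" using x d by linarith
            then have "\<epsilon> * \<bar>x\<bar> \<le> (1 / (2 * (\<bar>x0\<bar> + 1))) * (\<bar>x0\<bar> + 1)"
              using \<epsilon> by (intro mult_mono) auto
            also have "\<dots> = 1 / 2" by (simp add: field_simps)
            finally have "\<bar>\<epsilon> * x\<bar> \<le> 1 / 2" using \<epsilon>(1) by (simp add: abs_mult)
            then show "\<epsilon> * x \<in> {-1/2..1/2}" by (auto simp: abs_le_iff)
          qed
          ultimately have "bump y * (norm (w x0) / 2) \<le> bump (\<epsilon> * x) * norm (w x)"
            using \<open>0 < bump y\<close> by (intro mult_mono) auto
          then show ?thesis
            using True \<open>0 < bump y\<close> bump_ge_0[of "\<epsilon> * x"] by (simp add: norm_mult power_mono)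
        qed simp
      qed
      finally show ?thesis .
    qed
    ultimately show thesis using that by blast
  qed
  define N where "N = 4 * (4 * ((\<bar>C\<bar> + 1)\<^sup>2) * E2\<^sup>2 + E1\<^sup>2 * 4)"
  have N: "0 \<le> N" by (simp add: N_def)
  \<comment> \<open>Small enough for the lower bound to hold and for N \<epsilon> \<le> m/2.\<close>
  define \<epsilon> where "\<epsilon> = min (1 / (2 * (\<bar>x0\<bar> + 1))) (m / (2 * (N + 1)))"
  have \<epsilon>: "0 < \<epsilon>" "\<epsilon> \<le> 1 / (2 * (\<bar>x0\<bar> + 1))" "\<epsilon> \<le> m / (2 * (N + 1))"
    using m(1) N by (auto simp: \<epsilon>_def)
  have "1 / (2 * (\<bar>x0\<bar> + 1)) \<le> 1" by (simp add: divide_le_eq)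
  with \<epsilon> have "\<epsilon> \<le> 1" by linarith
  have "m \<le> N * \<epsilon>" using m(2)[OF \<epsilon>(1,2)] upper[OF \<epsilon>(1) \<open>\<epsilon> \<le> 1\<close>] by (simp add: N_def)
  also have "\<dots> \<le> (N + 1) * (m / (2 * (N + 1)))" using N \<epsilon> by (intro mult_mono) auto
  also have "\<dots> = m / 2" using N by (simp add: field_simps)
  finally show False using m(1) by simp
qed

section \<open>The profile equation and its parameter derivatives\<close>

lemma smooth_ln:
  assumes "smooth f" "\<And>x. 0 < f x"
  shows "smooth (\<lambda>x. ln (f x))"
proof (rule smooth_coinduct)
  let ?S = "insert (\<lambda>x. ln (f x)) {g. smooth g}"
  show "(\<lambda>x. ln (f x)) \<in> ?S" by simp
  fix g assume "g \<in> ?S"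
  then consider "g = (\<lambda>x. ln (f x))" | "smooth g" by auto
  then show "\<exists>f'\<in>?S. \<forall>x. (g has_real_derivative f' x) (at x)"
  proof cases
    case 1
    have "smooth (\<lambda>x. deriv f x / f x)"
      using assms by (intro smooth_intros) (auto simp: less_imp_neq[symmetric])
    then show ?thesis
      using 1 assms(2) smooth_has_deriv[OF assms(1)]
      by (intro bexI[of _ "\<lambda>x. deriv f x / f x"]) (auto intro!: derivative_eq_intros)
  next
    case 2
    then show ?thesis using smooth_has_deriv smooth_deriv by blast
  qed
qed

text \<open>At t = 0 the equation is a total derivative: with v = ln \<phi>, its last term becomes
  the derivative of c \<phi>^2 v''. Integrating once gives a constant, called - 2 c E, and dividing
  by c \<phi>^2 solves for v''.\<close>

lemma traveling_wave_profile:
  assumes tw: "traveling_wave c \<phi>" and pos: "\<And>z. 0 < \<phi> z" and c: "c \<noteq> 0"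
  obtains E where
    "\<And>z. (deriv (\<lambda>z. ln (\<phi> z)) has_real_derivative 1 / \<phi> z - 1 / c - 2 * E / (\<phi> z)\<^sup>2) (at z)"
proof -
  have \<phi>: "smooth \<phi>" and eq: "conduit_equation (\<lambda>x t. \<phi> (x - c * t))"
    using tw by (auto simp: traveling_wave_def)
  define v where "v = (\<lambda>z. ln (\<phi> z))"
  have v: "smooth v" unfolding v_def using \<phi> pos by (rule smooth_ln)
  note v1 = smooth_deriv[OF v] note v2 = smooth_deriv[OF v1]
  note \<phi>' = smooth_has_deriv[OF \<phi>]
  have v': "deriv v z = deriv \<phi> z / \<phi> z" for z
    unfolding v_def using \<phi>'[of z] pos[of z] by (intro DERIV_imp_deriv) (auto intro!: derivative_eq_intros)
  have t: "deriv (\<lambda>s. \<phi> (w - c * s)) 0 = - c * deriv \<phi> w" for w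
  proof (rule DERIV_imp_deriv)
    have "(\<phi> has_real_derivative deriv \<phi> w) (at (w - c * 0))" using \<phi>'[of w] by simp
    moreover have "((\<lambda>s. w - c * s) has_real_derivative - c) (at 0)"
      by (auto intro!: derivative_eq_intros)
    ultimately show "((\<lambda>s. \<phi> (w - c * s)) has_real_derivative - c * deriv \<phi> w) (at 0)"
      using DERIV_chain2[where f = \<phi> and g = "\<lambda>s. w - c * s" and x = 0] by (metis mult.commute)
  qed
  define h where "h = (\<lambda>y. (\<phi> y)\<^sup>2 * (- c * deriv (deriv v) y))"
  have h: "smooth h" unfolding h_def by (intro smooth_intros \<phi> v)
  have x: "deriv (\<lambda>y. (\<phi> y)\<^sup>2) x = 2 * \<phi> x * deriv \<phi> x" for x
    using \<phi>'[of x] by (intro DERIV_imp_deriv) (auto intro!: derivative_eq_intros)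
  have inner: "(\<lambda>w. inverse (\<phi> w) * deriv (\<lambda>s. \<phi> (w - c * s)) 0) = (\<lambda>w. - c * deriv v w)"
    by (auto simp: t v' divide_inverse)
  have d: "deriv (\<lambda>w. - c * deriv v w) y = - c * deriv (deriv v) y" for y
    using smooth_has_deriv[OF v1] by (intro DERIV_imp_deriv) (auto intro!: derivative_eq_intros)
  have key: "- c * deriv \<phi> x + 2 * \<phi> x * deriv \<phi> x - deriv h x = 0" for x
  proof -
    have "deriv (\<lambda>s. \<phi> (x - c * s)) 0 + deriv (\<lambda>y. (\<phi> (y - c * 0))\<^sup>2) x
        - deriv (\<lambda>y. (\<phi> (y - c * 0))\<^sup>2 * deriv (\<lambda>w. inverse (\<phi> (w - c * 0)) * deriv (\<lambda>s. \<phi> (w - c * s)) 0) y) x = 0"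
      using eq unfolding conduit_equation_def by blast
    then have "deriv (\<lambda>s. \<phi> (x - c * s)) 0 + deriv (\<lambda>y. (\<phi> y)\<^sup>2) x
        - deriv (\<lambda>y. (\<phi> y)\<^sup>2 * deriv (\<lambda>w. inverse (\<phi> w) * deriv (\<lambda>s. \<phi> (w - c * s)) 0) y) x = 0"
      by (simp only: mult_zero_right diff_zero)
    then show ?thesis unfolding inner unfolding d t x h_def .
  qed
  define P where "P = (\<lambda>x. - c * \<phi> x + (\<phi> x)\<^sup>2 - h x)"
  have "(P has_real_derivative 0) (at x)" for x
    unfolding P_def using \<phi>' smooth_has_deriv[OF h] key[of x]
    by (auto intro!: derivative_eq_intros simp: mult_ac)
  then have P: "P x = P 0" for x by (metis DERIV_isconst_all)
  define E where "E = - P 0 / (2 * c)"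
  have "deriv (deriv v) z = 1 / \<phi> z - 1 / c - 2 * E / (\<phi> z)\<^sup>2" for z
  proof -
    have "P z = - c * \<phi> z + (\<phi> z)\<^sup>2 + c * (\<phi> z)\<^sup>2 * deriv (deriv v) z"
      by (simp add: P_def h_def)
    then have "c * (\<phi> z)\<^sup>2 * deriv (deriv v) z = c * \<phi> z - (\<phi> z)\<^sup>2 - 2 * c * E"
      using P[of z] c by (simp add: E_def)
    then have "deriv (deriv v) z = (c * \<phi> z - (\<phi> z)\<^sup>2 - 2 * c * E) / (c * (\<phi> z)\<^sup>2)"
      using pos[of z] c by (simp add: eq_divide_eq mult.commute)
    then show ?thesis
      using pos[of z] c by (simp add: diff_divide_distrib power2_eq_square)
  qed
  then show thesis
    using that[of E] smooth_has_deriv[OF v1] by (simp add: v_def)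
qed

lemma has_integral_FTC:
  fixes F f :: "real \<Rightarrow> real"
  assumes "\<And>t. (F has_real_derivative f t) (at t)" "a \<le> b"
  shows "(f has_integral F b - F a) {a..b}"
  using assms by (intro fundamental_theorem_of_calculus)
    (auto simp: has_real_derivative_iff_has_vector_derivative intro: has_vector_derivative_at_within)

lemma even_imp_deriv_0:
  assumes "\<And>x. f (- x) = f x" "(f has_real_derivative D) (at 0)"
  shows "D = 0"
proof -
  have "((\<lambda>x. f (- x)) has_real_derivative - D) (at 0)"
    using DERIV_mirror[of f D 0] assms(2) by simp
  then show ?thesis using assms DERIV_unique[of f D 0 "- D"] by simp
qed

text \<open>\<open>H\<close> is the energy of the second order equation for ln \<psi>. The remaining
  relations come from integrating over a period, where total derivatives drop out: the derivative of
  V1 gives the relation that fixes E, that of c k^2 \<psi>^2 V1 gives the M-flux, and the energy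
  identity gives the Q-flux.\<close>

lemma rescaled_profile_facts:
  assumes rp: "rescaled_profile k c \<psi>" and pos: "\<And>\<theta>. 0 < \<psi> \<theta>" and c: "c \<noteq> 0"
  defines "V1 \<equiv> \<lambda>\<theta>. deriv \<psi> \<theta> / \<psi> \<theta>"
    and "Mf \<equiv> integral {0..1} (\<lambda>\<theta>. 2 * k\<^sup>2 * c * (deriv \<psi> \<theta>)\<^sup>2 - (\<psi> \<theta>)\<^sup>2)"
    and "Qf \<equiv> integral {0..1} (\<lambda>\<theta>. 2 * ln \<bar>\<psi> \<theta>\<bar>)"
  obtains E H where
    "smooth \<psi>" "\<And>\<theta>. \<psi> (\<theta> + 1) = \<psi> \<theta>" "\<And>\<theta>. \<psi> (- \<theta>) = \<psi> \<theta>"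
    "\<And>\<theta>. V1 (\<theta> + 1) = V1 \<theta>" "V1 0 = 0"
    "\<And>\<theta>. ((\<lambda>\<theta>. ln (\<psi> \<theta>)) has_real_derivative V1 \<theta>) (at \<theta>)"
    "\<And>\<theta>. (V1 has_real_derivative (1 / \<psi> \<theta> - 1 / c - 2 * E / (\<psi> \<theta>)\<^sup>2) / k\<^sup>2) (at \<theta>)"
    "\<And>\<theta>. k\<^sup>2 * (V1 \<theta>)\<^sup>2 / 2 + 1 / \<psi> \<theta> + ln (\<psi> \<theta>) / c - E / (\<psi> \<theta>)\<^sup>2 = H"
    "2 * E * integral {0..1} (\<lambda>\<theta>. 1 / (\<psi> \<theta>)\<^sup>2) = integral {0..1} (\<lambda>\<theta>. 1 / \<psi> \<theta>) - 1 / c"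
    "Mf = 2 * c * E - c * M_of \<psi>"
    "Qf = 2 * c * H - c * Q_of k \<psi> - 1"
    "Q_of k \<psi> = integral {0..1} (\<lambda>\<theta>. 1 / \<psi> \<theta> + k\<^sup>2 * (V1 \<theta>)\<^sup>2)"
proof -
  define \<phi> where "\<phi> = (\<lambda>z. \<psi> (k * z))"
  have k: "0 < k" and ev: "\<And>\<theta>. \<psi> (- \<theta>) = \<psi> \<theta>" and per: "\<And>\<theta>. \<psi> (\<theta> + 1) = \<psi> \<theta>"
    and tw: "traveling_wave c \<phi>"
    using rp by (auto simp: rescaled_profile_def even_fn_def fundamental_period_def \<phi>_def)
  have \<phi>: "smooth \<phi>" using tw by (simp add: traveling_wave_def)
  have \<psi>_eq: "\<psi> = (\<lambda>\<theta>. \<phi> ((1 / k) * \<theta> + 0))" using k by (simp add: \<phi>_def)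
  have s: "smooth \<psi>" unfolding \<psi>_eq by (rule smooth_affine[OF \<phi>])
  have \<phi>pos: "0 < \<phi> z" for z by (simp add: \<phi>_def pos)
  obtain E where E: "\<And>z. (deriv (\<lambda>z. ln (\<phi> z)) has_real_derivative 1 / \<phi> z - 1 / c - 2 * E / (\<phi> z)\<^sup>2) (at z)"
    using traveling_wave_profile[OF tw \<phi>pos c] by blast
  have dV: "((\<lambda>\<theta>. ln (\<psi> \<theta>)) has_real_derivative V1 \<theta>) (at \<theta>)" for \<theta>
    unfolding V1_def using smooth_has_deriv[OF s, of \<theta>] pos[of \<theta>] by (auto intro!: derivative_eq_intros)
  have "deriv (\<lambda>z. ln (\<phi> z)) z = k * V1 (k * z)" for z
    unfolding \<phi>_def
    using DERIV_chain2[where f = "\<lambda>\<theta>. ln (\<psi> \<theta>)" and g = "\<lambda>z. k * z" and x = z and s = UNIV, OF dV DERIV_cmult_Id]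
    by (intro DERIV_imp_deriv) (simp add: mult.commute)
  then have dln: "deriv (\<lambda>z. ln (\<phi> z)) = (\<lambda>z. k * V1 (k * z))" by auto
  have V1_eq: "V1 = (\<lambda>\<theta>. deriv (\<lambda>z. ln (\<phi> z)) (\<theta> / k) / k)"
    using k by (auto simp: dln)
  have dV1: "(V1 has_real_derivative (1 / \<psi> \<theta> - 1 / c - 2 * E / (\<psi> \<theta>)\<^sup>2) / k\<^sup>2) (at \<theta>)" for \<theta>
  proof -
    have "\<phi> (\<theta> / k) = \<psi> \<theta>" using k by (simp add: \<phi>_def)
    with E[of "\<theta> / k"] have 1: "(deriv (\<lambda>z. ln (\<phi> z)) has_real_derivative 1 / \<psi> \<theta> - 1 / c - 2 * E / (\<psi> \<theta>)\<^sup>2) (at (\<theta> / k))"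
      by simp
    have 2: "((\<lambda>\<theta>. \<theta> / k) has_real_derivative 1 / k) (at \<theta>)"
      using k by (auto intro!: derivative_eq_intros)
    show ?thesis
      unfolding V1_eq using DERIV_cdivide[OF DERIV_chain2[OF 1 2], of k]
      by (simp add: power2_eq_square)
  qed
  have per': "V1 (\<theta> + 1) = V1 \<theta>" for \<theta>
  proof (rule DERIV_unique)
    show "((\<lambda>\<theta>. ln (\<psi> (\<theta> + 1))) has_real_derivative V1 (\<theta> + 1)) (at \<theta>)"
      using dV[of "\<theta> + 1"] by (simp add: DERIV_shift)
    show "((\<lambda>\<theta>. ln (\<psi> (\<theta> + 1))) has_real_derivative V1 \<theta>) (at \<theta>)"
      using dV by (simp add: per)
  qed
  have V0: "V1 0 = 0" using even_imp_deriv_0[OF _ dV[of 0]] ev by simp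
  have V11: "V1 1 = 0" using per'[of 0] V0 by simp
  have \<psi>1: "\<psi> 1 = \<psi> 0" using per[of 0] by simp
  define e where "e = (\<lambda>\<theta>. k\<^sup>2 * (V1 \<theta>)\<^sup>2 / 2 + 1 / \<psi> \<theta> + ln (\<psi> \<theta>) / c - E / (\<psi> \<theta>)\<^sup>2)"
  have d\<psi>: "(\<psi> has_real_derivative \<psi> \<theta> * V1 \<theta>) (at \<theta>)" for \<theta>
    using smooth_has_deriv[OF s, of \<theta>] pos[of \<theta>] by (simp add: V1_def)
  have "(e has_real_derivative 0) (at \<theta>)" for \<theta>
  proof -
    have "(e has_real_derivative (k\<^sup>2 * (2 * V1 \<theta> * ((1 / \<psi> \<theta> - 1 / c - 2 * E / (\<psi> \<theta>)\<^sup>2) / k\<^sup>2)) / 2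
      + - (\<psi> \<theta> * V1 \<theta>) / (\<psi> \<theta>)\<^sup>2 + V1 \<theta> / c + 2 * E * (\<psi> \<theta> * V1 \<theta>) / (\<psi> \<theta>)^3)) (at \<theta>)"
      unfolding e_def using pos[of \<theta>] k c
      by (auto intro!: derivative_eq_intros dV1 d\<psi> dV simp: power2_eq_square power3_eq_cube)
    moreover have "(k\<^sup>2 * (2 * V1 \<theta> * ((1 / \<psi> \<theta> - 1 / c - 2 * E / (\<psi> \<theta>)\<^sup>2) / k\<^sup>2)) / 2
      + - (\<psi> \<theta> * V1 \<theta>) / (\<psi> \<theta>)\<^sup>2 + V1 \<theta> / c + 2 * E * (\<psi> \<theta> * V1 \<theta>) / (\<psi> \<theta>)^3) = 0"
      using pos[of \<theta>] k c by (simp add: field_simps power2_eq_square power3_eq_cube)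
    ultimately show ?thesis by simp
  qed
  then have H: "e \<theta> = e 0" for \<theta> by (metis DERIV_isconst_all)
  have V1c: "continuous_on A V1" for A
    using dV1 DERIV_isCont continuous_at_imp_continuous_on by blast
  note \<psi>c = smooth_continuous[OF s]
  have \<psi>nz: "\<psi> \<theta> \<noteq> 0" for \<theta> using pos[of \<theta>] by simp
  note ci = integrable_continuous_real continuous_intros V1c \<psi>c
  let ?I1 = "integral {0..1} (\<lambda>\<theta>. 1 / \<psi> \<theta>)" and ?I2 = "integral {0..1} (\<lambda>\<theta>. 1 / (\<psi> \<theta>)\<^sup>2)"
  have i1: "((\<lambda>\<theta>. 1 / \<psi> \<theta>) has_integral ?I1) {0..1}" and i2: "((\<lambda>\<theta>. 1 / (\<psi> \<theta>)\<^sup>2) has_integral ?I2) {0..1}"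
    and iM: "(\<psi> has_integral M_of \<psi>) {0..1}"
    unfolding M_of_def by (intro integrable_integral ci; simp add: \<psi>nz)+
  have iMf: "((\<lambda>\<theta>. 2 * k\<^sup>2 * c * (deriv \<psi> \<theta>)\<^sup>2 - (\<psi> \<theta>)\<^sup>2) has_integral Mf) {0..1}"
    unfolding Mf_def by (intro integrable_integral ci smooth_continuous smooth_deriv s)
  have iQf: "((\<lambda>\<theta>. 2 * ln \<bar>\<psi> \<theta>\<bar>) has_integral Qf) {0..1}"
    unfolding Qf_def by (intro integrable_integral ci) (simp add: \<psi>nz)
  have Qeq: "(\<psi> \<theta> + k\<^sup>2 * (deriv \<psi> \<theta>)\<^sup>2) / (\<psi> \<theta>)\<^sup>2 = 1 / \<psi> \<theta> + k\<^sup>2 * (V1 \<theta>)\<^sup>2" for \<theta>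
    using \<psi>nz[of \<theta>] by (simp add: V1_def field_simps power2_eq_square)
  have Q: "Q_of k \<psi> = integral {0..1} (\<lambda>\<theta>. 1 / \<psi> \<theta> + k\<^sup>2 * (V1 \<theta>)\<^sup>2)"
    by (simp add: Q_of_def Qeq)
  have iQ: "((\<lambda>\<theta>. 1 / \<psi> \<theta> + k\<^sup>2 * (V1 \<theta>)\<^sup>2) has_integral Q_of k \<psi>) {0..1}"
    unfolding Q by (intro integrable_integral ci) (simp add: \<psi>nz)
  have "((\<lambda>\<theta>. (1 / \<psi> \<theta> - 1 / c - 2 * E / (\<psi> \<theta>)\<^sup>2) / k\<^sup>2) has_integral V1 1 - V1 0) {0..1}"
    by (rule has_integral_FTC) (auto intro: dV1)
  from has_integral_mult_right[OF this, of "k\<^sup>2"]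
  have "((\<lambda>\<theta>. 1 / \<psi> \<theta> - 1 / c - 2 * E * (1 / (\<psi> \<theta>)\<^sup>2)) has_integral 0) {0..1}"
    using k by (simp add: V0 V11)
  moreover have "((\<lambda>\<theta>. 1 / \<psi> \<theta> - 1 / c - 2 * E * (1 / (\<psi> \<theta>)\<^sup>2)) has_integral ?I1 - 1 / c - 2 * E * ?I2) {0..1}"
    using has_integral_diff[OF has_integral_diff[OF i1 has_integral_const_real[of "1 / c" 0 1]]
        has_integral_mult_right[OF i2, of "2 * E"]] by simp
  ultimately have "0 = ?I1 - 1 / c - 2 * E * ?I2"
    by (rule has_integral_unique)
  then have E2: "2 * E * ?I2 = ?I1 - 1 / c" by simp
  have "((\<lambda>\<theta>. c * k\<^sup>2 * (\<psi> \<theta>)\<^sup>2 * V1 \<theta>) has_real_derivative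
      2 * k\<^sup>2 * c * (deriv \<psi> \<theta>)\<^sup>2 - (\<psi> \<theta>)\<^sup>2 + c * \<psi> \<theta> - 2 * c * E) (at \<theta>)" for \<theta>
  proof -
    have "((\<lambda>\<theta>. c * k\<^sup>2 * (\<psi> \<theta>)\<^sup>2 * V1 \<theta>) has_real_derivative
      c * k\<^sup>2 * (2 * \<psi> \<theta> * (\<psi> \<theta> * V1 \<theta>)) * V1 \<theta>
      + c * k\<^sup>2 * (\<psi> \<theta>)\<^sup>2 * ((1 / \<psi> \<theta> - 1 / c - 2 * E / (\<psi> \<theta>)\<^sup>2) / k\<^sup>2)) (at \<theta>)"
      by (auto intro!: derivative_eq_intros dV1 d\<psi>)
    moreover have "deriv \<psi> \<theta> = \<psi> \<theta> * V1 \<theta>" using \<psi>nz by (simp add: V1_def)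
    then have "c * k\<^sup>2 * (2 * \<psi> \<theta> * (\<psi> \<theta> * V1 \<theta>)) * V1 \<theta>
      + c * k\<^sup>2 * (\<psi> \<theta>)\<^sup>2 * ((1 / \<psi> \<theta> - 1 / c - 2 * E / (\<psi> \<theta>)\<^sup>2) / k\<^sup>2)
      = 2 * k\<^sup>2 * c * (deriv \<psi> \<theta>)\<^sup>2 - (\<psi> \<theta>)\<^sup>2 + c * \<psi> \<theta> - 2 * c * E"
      using k c \<psi>nz[of \<theta>] by (simp add: field_simps power2_eq_square)
    ultimately show ?thesis by (simp only:)
  qed
  from has_integral_FTC[OF this, of 0 1]
  have "((\<lambda>\<theta>. 2 * k\<^sup>2 * c * (deriv \<psi> \<theta>)\<^sup>2 - (\<psi> \<theta>)\<^sup>2 + c * \<psi> \<theta> - 2 * c * E) has_integral 0) {0..1}"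
    by (simp add: V0 V11)
  moreover have "((\<lambda>\<theta>. 2 * k\<^sup>2 * c * (deriv \<psi> \<theta>)\<^sup>2 - (\<psi> \<theta>)\<^sup>2 + c * \<psi> \<theta> - 2 * c * E)
      has_integral Mf + c * M_of \<psi> - 2 * c * E) {0..1}"
    using has_integral_diff[OF has_integral_add[OF iMf has_integral_mult_right[OF iM, of c]]
        has_integral_const_real[of "2 * c * E" 0 1]] by simp
  ultimately have "0 = Mf + c * M_of \<psi> - 2 * c * E"
    by (rule has_integral_unique)
  then have Mf: "Mf = 2 * c * E - c * M_of \<psi>" by simp
  have "((\<lambda>\<theta>. 2 * c * e \<theta>) has_integral 2 * c * e 0) {0..1}"
  proof -
    have "(\<lambda>\<theta>. 2 * c * e \<theta>) = (\<lambda>\<theta>. 2 * c * e 0)" by (rule ext, rule arg_cong[OF H])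
    then show ?thesis using has_integral_const_real[of "2 * c * e 0" 0 1] by simp
  qed
  moreover have "(\<lambda>\<theta>. 2 * c * e \<theta>) = (\<lambda>\<theta>. c * (1 / \<psi> \<theta> + k\<^sup>2 * (V1 \<theta>)\<^sup>2) + c * (1 / \<psi> \<theta>) + 2 * ln \<bar>\<psi> \<theta>\<bar>
      - 2 * c * E * (1 / (\<psi> \<theta>)\<^sup>2))"
    using c pos by (auto simp: e_def fun_eq_iff field_simps less_imp_le abs_of_pos)
  moreover have "((\<lambda>\<theta>. c * (1 / \<psi> \<theta> + k\<^sup>2 * (V1 \<theta>)\<^sup>2) + c * (1 / \<psi> \<theta>) + 2 * ln \<bar>\<psi> \<theta>\<bar>
      - 2 * c * E * (1 / (\<psi> \<theta>)\<^sup>2)) has_integral c * Q_of k \<psi> + c * ?I1 + Qf - 2 * c * E * ?I2) {0..1}"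
    by (intro has_integral_diff has_integral_add has_integral_mult_right iQ i1 i2 iQf)
  ultimately have "2 * c * e 0 = c * Q_of k \<psi> + c * ?I1 + Qf - 2 * c * E * ?I2"
    by (simp only:) (rule has_integral_unique)
  then have "2 * c * e 0 = c * Q_of k \<psi> + c * ?I1 + Qf - c * (2 * E * ?I2)"
    by simp
  \<comment> \<open>The relation for E makes the integrals of 1/\<psi> and 1/\<psi>^2 cancel up to
    the constant 1, the origin of the - 1 in the Q-flux.\<close>
  also have "\<dots> = c * Q_of k \<psi> + Qf + 1" unfolding E2 using c by (simp add: field_simps)
  finally have "Qf = 2 * c * e 0 - c * Q_of k \<psi> - 1" by simp
  moreover have "k\<^sup>2 * (V1 \<theta>)\<^sup>2 / 2 + 1 / \<psi> \<theta> + ln (\<psi> \<theta>) / c - E / (\<psi> \<theta>)\<^sup>2 = e 0" for \<theta>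
    using H[of \<theta>] by (simp only: e_def)
  ultimately show thesis
    using that[of E "e 0", OF s per ev per' V0 dV dV1 _ E2 Mf _ Q] by blast
qed

text \<open>The period relation solved for E. It contains no \<theta>-derivative of the profile, so
  it can be differentiated along a C1 family.\<close>

definition profile_E :: "real \<Rightarrow> (real \<Rightarrow> real) \<Rightarrow> real" where
  "profile_E c \<psi> = (integral {0..1} (\<lambda>\<theta>. 1 / \<psi> \<theta>) - 1 / c) / (2 * integral {0..1} (\<lambda>\<theta>. 1 / (\<psi> \<theta>)\<^sup>2))"

text \<open>The energy at \<theta> = 0, where evenness removes the kinetic term and with it the
  derivative of the profile.\<close>

definition profile_H :: "real \<Rightarrow> (real \<Rightarrow> real) \<Rightarrow> real" where
  "profile_H c \<psi> = 1 / \<psi> 0 + ln (\<psi> 0) / c - profile_E c \<psi> / (\<psi> 0)\<^sup>2"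

lemma integral_inverse_square_pos:
  fixes \<psi> :: "real \<Rightarrow> real"
  assumes "continuous_on UNIV \<psi>" "\<And>\<theta>. 0 < \<psi> \<theta>"
  shows "0 < integral {0..1} (\<lambda>\<theta>. 1 / (\<psi> \<theta>)\<^sup>2)"
proof -
  have nz: "\<psi> \<theta> \<noteq> 0" for \<theta> using assms(2)[of \<theta>] by simp
  have c: "continuous_on {0..1} (\<lambda>\<theta>. 1 / (\<psi> \<theta>)\<^sup>2)"
    using nz by (intro continuous_intros continuous_on_subset[OF assms(1)]) auto
  then have "0 \<le> integral {0..1} (\<lambda>\<theta>. 1 / (\<psi> \<theta>)\<^sup>2)"
    by (intro integral_nonneg integrable_continuous_real) auto
  moreover have "integral {0..1} (\<lambda>\<theta>. 1 / (\<psi> \<theta>)\<^sup>2) \<noteq> 0"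
  proof
    assume "integral {0..1} (\<lambda>\<theta>. 1 / (\<psi> \<theta>)\<^sup>2) = 0"
    then have "\<forall>\<theta>\<in>{0..1}. 1 / (\<psi> \<theta>)\<^sup>2 = 0"
      by (subst (asm) integral_eq_0_iff[OF c]) auto
    then show False using nz[of 0] by (auto dest: bspec[of _ _ 0])
  qed
  ultimately show ?thesis by linarith
qed

text \<open>Replaces the existentially given constants by the two derivative-free formulas: the
  period relation determines E, since the integral of 1/\<psi>^2 is positive, and the energy at 0
  then determines H.\<close>

lemma profile_facts:
  assumes rp: "rescaled_profile k c \<psi>" and pos: "\<And>\<theta>. 0 < \<psi> \<theta>" and c: "c \<noteq> 0"
  defines "V1 \<equiv> \<lambda>\<theta>. deriv \<psi> \<theta> / \<psi> \<theta>"
    and "Mf \<equiv> integral {0..1} (\<lambda>\<theta>. 2 * k\<^sup>2 * c * (deriv \<psi> \<theta>)\<^sup>2 - (\<psi> \<theta>)\<^sup>2)"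
    and "Qf \<equiv> integral {0..1} (\<lambda>\<theta>. 2 * ln \<bar>\<psi> \<theta>\<bar>)"
    and "E \<equiv> profile_E c \<psi>" and "H \<equiv> profile_H c \<psi>"
  shows "smooth \<psi>" "\<psi> (\<theta> + 1) = \<psi> \<theta>" "\<psi> (- \<theta>) = \<psi> \<theta>"
    "V1 (\<theta> + 1) = V1 \<theta>" "V1 0 = 0"
    "((\<lambda>\<theta>. ln (\<psi> \<theta>)) has_real_derivative V1 \<theta>) (at \<theta>)"
    "(V1 has_real_derivative (1 / \<psi> \<theta> - 1 / c - 2 * E / (\<psi> \<theta>)\<^sup>2) / k\<^sup>2) (at \<theta>)"
    "k\<^sup>2 * (V1 \<theta>)\<^sup>2 / 2 + 1 / \<psi> \<theta> + ln (\<psi> \<theta>) / c - E / (\<psi> \<theta>)\<^sup>2 = H"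
    "Mf = 2 * c * E - c * M_of \<psi>"
    "Qf = 2 * c * H - c * Q_of k \<psi> - 1"
    "Q_of k \<psi> = integral {0..1} (\<lambda>\<theta>. 1 / \<psi> \<theta> + k\<^sup>2 * (V1 \<theta>)\<^sup>2)"
proof -
  obtain E0 H0 where *: "smooth \<psi>" "\<And>\<theta>. \<psi> (\<theta> + 1) = \<psi> \<theta>" "\<And>\<theta>. \<psi> (- \<theta>) = \<psi> \<theta>"
    "\<And>\<theta>. V1 (\<theta> + 1) = V1 \<theta>" "V1 0 = 0"
    "\<And>\<theta>. ((\<lambda>\<theta>. ln (\<psi> \<theta>)) has_real_derivative V1 \<theta>) (at \<theta>)"
    "\<And>\<theta>. (V1 has_real_derivative (1 / \<psi> \<theta> - 1 / c - 2 * E0 / (\<psi> \<theta>)\<^sup>2) / k\<^sup>2) (at \<theta>)"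
    "\<And>\<theta>. k\<^sup>2 * (V1 \<theta>)\<^sup>2 / 2 + 1 / \<psi> \<theta> + ln (\<psi> \<theta>) / c - E0 / (\<psi> \<theta>)\<^sup>2 = H0"
    "2 * E0 * integral {0..1} (\<lambda>\<theta>. 1 / (\<psi> \<theta>)\<^sup>2) = integral {0..1} (\<lambda>\<theta>. 1 / \<psi> \<theta>) - 1 / c"
    "Mf = 2 * c * E0 - c * M_of \<psi>"
    "Qf = 2 * c * H0 - c * Q_of k \<psi> - 1"
    "Q_of k \<psi> = integral {0..1} (\<lambda>\<theta>. 1 / \<psi> \<theta> + k\<^sup>2 * (V1 \<theta>)\<^sup>2)"
    by (rule rescaled_profile_facts[OF rp pos c]) (rule that; (unfold V1_def Mf_def Qf_def)?; assumption)
  have J2: "0 < integral {0..1} (\<lambda>\<theta>. 1 / (\<psi> \<theta>)\<^sup>2)"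
    by (rule integral_inverse_square_pos[OF smooth_continuous[OF *(1)] pos])
  have E0: "E0 = E"
    using *(9) J2 unfolding E_def profile_E_def by (simp add: field_simps)
  have H0: "H0 = H"
    using *(8)[of 0] *(5) by (simp add: H_def profile_H_def E0 E_def)
  show "smooth \<psi>" "\<psi> (\<theta> + 1) = \<psi> \<theta>" "\<psi> (- \<theta>) = \<psi> \<theta>" "V1 (\<theta> + 1) = V1 \<theta>" "V1 0 = 0"
    "((\<lambda>\<theta>. ln (\<psi> \<theta>)) has_real_derivative V1 \<theta>) (at \<theta>)"
    "(V1 has_real_derivative (1 / \<psi> \<theta> - 1 / c - 2 * E / (\<psi> \<theta>)\<^sup>2) / k\<^sup>2) (at \<theta>)"
    "k\<^sup>2 * (V1 \<theta>)\<^sup>2 / 2 + 1 / \<psi> \<theta> + ln (\<psi> \<theta>) / c - E / (\<psi> \<theta>)\<^sup>2 = H"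
    "Mf = 2 * c * E - c * M_of \<psi>"
    "Qf = 2 * c * H - c * Q_of k \<psi> - 1"
    "Q_of k \<psi> = integral {0..1} (\<lambda>\<theta>. 1 / \<psi> \<theta> + k\<^sup>2 * (V1 \<theta>)\<^sup>2)"
    by (fact *(1) *(2) *(3) *(4) *(5) *(6) *(7)[unfolded E0] *(8)[unfolded E0 H0]
        *(10)[unfolded E0] *(11)[unfolded H0] *(12))+
qed

lemma periodic_derivative:
  assumes "\<And>x::real. f (x + 1) = f x" "\<And>x. (f has_real_derivative f' x) (at x)"
  shows "f' (x + 1) = f' x"
proof (rule DERIV_unique)
  show "((\<lambda>t. f (t + 1)) has_real_derivative f' (x + 1)) (at x)"
    using assms(2)[of "x + 1"] by (simp add: DERIV_shift)
  show "((\<lambda>t. f (t + 1)) has_real_derivative f' x) (at x)"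
    using assms by simp
qed

text \<open>A curve of profiles through the reference wave at s = 0. The constants
  \<open>k'\<close>, \<open>c'\<close>, \<open>M'\<close>, \<open>Q'\<close> are derivatives at 0;
  about the s-dependence of the \<theta>-derivative of \<open>g s\<close> no assumption is
  made.\<close>

locale profile_variation =
  fixes g g' :: "real \<Rightarrow> real \<Rightarrow> real" and k c :: "real \<Rightarrow> real" and d k' c' M' Q' :: real
  assumes d: "0 < d"
    and g': "\<And>s \<theta>. \<bar>s\<bar> < d \<Longrightarrow> ((\<lambda>s. g s \<theta>) has_real_derivative g' s \<theta>) (at s)"
    and g'_cont: "continuous_on ({-d<..<d} \<times> UNIV) (\<lambda>(s, \<theta>). g' s \<theta>)"
    and g_cont: "continuous_on ({-d<..<d} \<times> UNIV) (\<lambda>(s, \<theta>). g s \<theta>)"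
    and prof: "\<And>s. \<bar>s\<bar> < d \<Longrightarrow> rescaled_profile (k s) (c s) (g s)"
    and pos: "\<And>s \<theta>. \<bar>s\<bar> < d \<Longrightarrow> 0 < g s \<theta>"
    and cnz: "\<And>s. \<bar>s\<bar> < d \<Longrightarrow> c s \<noteq> 0"
    and k': "(k has_real_derivative k') (at 0)" and c': "(c has_real_derivative c') (at 0)"
    and M': "((\<lambda>s. M_of (g s)) has_real_derivative M') (at 0)"
    and Q': "((\<lambda>s. Q_of (k s) (g s)) has_real_derivative Q') (at 0)"
begin

text \<open>The composed function needs to be differentiable only on the positive reals, where all
  profiles take their values. The weight W is there for the Volterra kernel.\<close>

lemma leibniz:
  assumes f: "\<And>x. 0 < x \<Longrightarrow> (f has_real_derivative f' x) (at x)" and f'_cont: "continuous_on {0<..} f'"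
    and W: "continuous_on UNIV W"
  shows "((\<lambda>s. integral {a..b} (\<lambda>t. W t * f (g s t))) has_real_derivative
    integral {a..b} (\<lambda>t. W t * (f' (g 0 t) * g' 0 t))) (at 0)"
proof -
  define U where "U = {-d<..<d}"
  have f_cont: "continuous_on {0<..} f"
    using f by (meson DERIV_isCont continuous_at_imp_continuous_on greaterThan_iff)
  have gc: "continuous_on (U \<times> {a..b}) (\<lambda>x. g (fst x) (snd x))"
    and g'c: "continuous_on (U \<times> {a..b}) (\<lambda>x. g' (fst x) (snd x))"
    using g_cont g'_cont unfolding U_def split_beta by (auto elim: continuous_on_subset)
  have "((\<lambda>s. integral (cbox a b) (\<lambda>t. W t * f (g s t))) has_real_derivative
      integral (cbox a b) (\<lambda>t. W t * (f' (g 0 t) * g' 0 t))) (at 0 within U)"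
  proof (rule leibniz_rule_field_derivative)
    fix s t assume "s \<in> U"
    then have s: "\<bar>s\<bar> < d" by (auto simp: U_def)
    show "((\<lambda>s. W t * f (g s t)) has_real_derivative W t * (f' (g s t) * g' s t)) (at s within U)"
      by (intro DERIV_cmult DERIV_chain2[where f = f and g = "\<lambda>s. g s t", OF f[OF pos[OF s]]] has_field_derivative_at_within[OF g'[OF s]])
  next
    fix s assume "s \<in> U"
    then have s: "\<bar>s\<bar> < d" and su: "s \<in> U" by (auto simp: U_def)
    have "continuous_on {a..b} (g s)"
      by (rule continuous_on_compose2[OF gc, of "{a..b}" "\<lambda>t. (s, t)", unfolded fst_conv snd_conv])
        (use su in \<open>auto intro!: continuous_intros\<close>)
    then show "(\<lambda>t. W t * f (g s t)) integrable_on cbox a b"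
      unfolding cbox_interval
      by (intro integrable_continuous_real continuous_intros continuous_on_subset[OF W]
          continuous_on_compose2[OF f_cont]) (use pos[OF s] in auto)
  next
    show "continuous_on (U \<times> cbox a b) (\<lambda>(s, t). W t * (f' (g s t) * g' s t))"
      unfolding cbox_interval split_beta
      by (intro continuous_intros gc g'c continuous_on_compose2[OF f'_cont]
          continuous_on_compose2[OF W]) (auto simp: U_def intro!: pos)
    show "0 \<in> U" "convex U" using d by (auto simp: U_def)
  qed
  moreover have "at 0 within U = at (0::real)"
    using d by (intro at_within_open) (auto simp: U_def)
  ultimately show ?thesis by (simp add: cbox_interval)
qed

abbreviation "E \<equiv> \<lambda>s. profile_E (c s) (g s)"
abbreviation "H \<equiv> \<lambda>s. profile_H (c s) (g s)"

definition "V1 = (\<lambda>s \<theta>. deriv (g s) \<theta> / g s \<theta>)"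
text \<open>The s-derivative of ln g at 0. In logarithmic form the linearized profile equation has
  the same potential as the spectral problem written for u = f / \<phi>.\<close>

definition "Om = (\<lambda>\<theta>. g' 0 \<theta> / g 0 \<theta>)"

lemma facts:
  assumes s: "\<bar>s\<bar> < d"
  shows "smooth (g s)" "g s (\<theta> + 1) = g s \<theta>" "g s (- \<theta>) = g s \<theta>"
    "V1 s (\<theta> + 1) = V1 s \<theta>" "V1 s 0 = 0"
    "((\<lambda>\<theta>. ln (g s \<theta>)) has_real_derivative V1 s \<theta>) (at \<theta>)"
    "(V1 s has_real_derivative (1 / g s \<theta> - 1 / c s - 2 * E s / (g s \<theta>)\<^sup>2) / (k s)\<^sup>2) (at \<theta>)"
    "(k s)\<^sup>2 * (V1 s \<theta>)\<^sup>2 / 2 + 1 / g s \<theta> + ln (g s \<theta>) / c s - E s / (g s \<theta>)\<^sup>2 = H s"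
    "integral {0..1} (\<lambda>\<theta>. 2 * (k s)\<^sup>2 * c s * (deriv (g s) \<theta>)\<^sup>2 - (g s \<theta>)\<^sup>2) = 2 * c s * E s - c s * M_of (g s)"
    "integral {0..1} (\<lambda>\<theta>. 2 * ln \<bar>g s \<theta>\<bar>) = 2 * c s * H s - c s * Q_of (k s) (g s) - 1"
    "Q_of (k s) (g s) = integral {0..1} (\<lambda>\<theta>. 1 / g s \<theta> + (k s)\<^sup>2 * (V1 s \<theta>)\<^sup>2)"
  unfolding V1_def by (fact profile_facts[OF prof[OF s] pos[OF s] cnz[OF s]])+

lemma abs_0_less: "\<bar>0\<bar> < d" using d by simp

lemma g0_pos: "0 < g 0 \<theta>" and g0_nz: "g 0 \<theta> \<noteq> 0"
  using pos[OF abs_0_less, of \<theta>] by auto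

lemma g0_cont: "continuous_on A (g 0)"
  using facts(1)[OF abs_0_less] by (rule smooth_continuous)

lemma g'0_cont: "continuous_on A (g' 0)"
  by (rule continuous_on_compose2[OF g'_cont, of A "\<lambda>t. (0, t)", unfolded split_beta fst_conv snd_conv])
    (use d in \<open>auto intro!: continuous_intros\<close>)

lemma Om_cont: "continuous_on A Om"
  unfolding Om_def by (intro continuous_intros g'0_cont g0_cont) (simp add: g0_nz)

lemma ev_small: "\<forall>\<^sub>F s in nhds 0. \<bar>s\<bar> < d"
  using d eventually_nhds_in_open[of "{-d<..<d}" 0] by (auto elim!: eventually_mono)

lemma J1': "((\<lambda>s. integral {0..1} (\<lambda>t. 1 / g s t)) has_real_derivative
    - integral {0..1} (\<lambda>t. Om t / g 0 t)) (at 0)"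
proof -
  have "((\<lambda>s. integral {0..1} (\<lambda>t. 1 * (1 / g s t))) has_real_derivative
      integral {0..1} (\<lambda>t. 1 * (- (1 / (g 0 t)\<^sup>2) * g' 0 t))) (at 0)"
    by (rule leibniz) (auto intro!: derivative_eq_intros continuous_intros simp: power2_eq_square)
  moreover have "1 * (- (1 / (g 0 t)\<^sup>2) * g' 0 t) = - (Om t / g 0 t)" for t
    using g0_nz by (simp add: Om_def power2_eq_square)
  ultimately show ?thesis by simp
qed

lemma weighted_J1':
  assumes "continuous_on UNIV W"
  shows "((\<lambda>s. integral {a..b} (\<lambda>t. W t * (1 / g s t))) has_real_derivative
    integral {a..b} (\<lambda>t. W t * - (Om t / g 0 t))) (at 0)"
proof -
  have "((\<lambda>s. integral {a..b} (\<lambda>t. W t * (1 / g s t))) has_real_derivative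
      integral {a..b} (\<lambda>t. W t * (- (1 / (g 0 t)\<^sup>2) * g' 0 t))) (at 0)"
    using assms by (intro leibniz) (auto intro!: derivative_eq_intros continuous_intros simp: power2_eq_square)
  moreover have "- (1 / (g 0 t)\<^sup>2) * g' 0 t = - (Om t / g 0 t)" for t
    using g0_nz by (simp add: Om_def power2_eq_square)
  ultimately show ?thesis by (simp only:)
qed

lemma weighted_J2':
  assumes "continuous_on UNIV W"
  shows "((\<lambda>s. integral {a..b} (\<lambda>t. W t * (1 / (g s t)\<^sup>2))) has_real_derivative
    integral {a..b} (\<lambda>t. W t * - (2 * Om t / (g 0 t)\<^sup>2))) (at 0)"
proof -
  have "((\<lambda>s. integral {a..b} (\<lambda>t. W t * (1 / (g s t)\<^sup>2))) has_real_derivative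
      integral {a..b} (\<lambda>t. W t * (- (2 / (g 0 t)^3) * g' 0 t))) (at 0)"
    using assms by (intro leibniz)
      (auto intro!: derivative_eq_intros continuous_intros simp: power2_eq_square power3_eq_cube)
  moreover have "- (2 / (g 0 t)^3) * g' 0 t = - (2 * Om t / (g 0 t)\<^sup>2)" for t
    using g0_nz by (simp add: Om_def power2_eq_square power3_eq_cube)
  ultimately show ?thesis by (simp only:)
qed

text \<open>Numerator and denominator of \<open>profile_E\<close> at s = 0, followed by their
  derivatives and the quotient rule.\<close>

definition "N\<^sub>0 = integral {0..1} (\<lambda>t. 1 / g 0 t) - 1 / c 0"
definition "N' = c' / (c 0)\<^sup>2 - integral {0..1} (\<lambda>t. Om t / g 0 t)"
definition "D\<^sub>0 = 2 * integral {0..1} (\<lambda>t. 1 / (g 0 t)\<^sup>2)"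
definition "D' = 2 * integral {0..1} (\<lambda>t. - (2 * Om t / (g 0 t)\<^sup>2))"
definition "E' = (N' * D\<^sub>0 - N\<^sub>0 * D') / (D\<^sub>0 * D\<^sub>0)"

lemma D0_nz: "D\<^sub>0 \<noteq> 0"
  unfolding D\<^sub>0_def using integral_inverse_square_pos[OF g0_cont g0_pos] by simp

text \<open>The linearized period relation for E, cleared of denominators; \<open>Q'_eq\<close> uses
  it in this form.\<close>

lemma E'_eq: "E' * D\<^sub>0 + E 0 * D' = N'"
  using D0_nz by (simp add: E'_def profile_E_def field_simps flip: N\<^sub>0_def D\<^sub>0_def)

lemma inverse_c': "((\<lambda>s. 1 / c s) has_real_derivative - (c' / (c 0)\<^sup>2)) (at 0)"
  using DERIV_inverse_fun[OF c' cnz[OF abs_0_less]] by (simp add: divide_inverse power2_eq_square mult_ac)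

lemma E_deriv: "(E has_real_derivative E') (at 0)"
proof -
  have n: "((\<lambda>s. integral {0..1} (\<lambda>t. 1 / g s t) - 1 / c s) has_real_derivative N') (at 0)"
    unfolding N'_def using DERIV_diff[OF J1' inverse_c'] by simp
  have "((\<lambda>s. integral {0..1} (\<lambda>t. 1 * (1 / (g s t)\<^sup>2))) has_real_derivative
    integral {0..1} (\<lambda>t. 1 * - (2 * Om t / (g 0 t)\<^sup>2))) (at 0)"
    by (rule weighted_J2') simp
  then have d: "((\<lambda>s. 2 * integral {0..1} (\<lambda>t. 1 / (g s t)\<^sup>2)) has_real_derivative D') (at 0)"
    unfolding D'_def by (intro DERIV_cmult) simp
  show ?thesis
    unfolding profile_E_def E'_def using DERIV_divide[OF n d] D0_nz by (simp add: N\<^sub>0_def D\<^sub>0_def)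
qed

lemma ln_g_deriv: "((\<lambda>s. ln (g s \<theta>)) has_real_derivative Om \<theta>) (at 0)"
  using g'[OF abs_0_less, of \<theta>] g0_pos[of \<theta>] by (auto intro!: derivative_eq_intros simp: Om_def)

text \<open>By periodicity V1 has zeros arbitrarily far to the left; they serve as base points for
  the Volterra identity.\<close>

lemma V1_neg_nat: "\<bar>s\<bar> < d \<Longrightarrow> V1 s (- real n) = 0"
proof (induction n)
  case 0
  then show ?case using facts(5) by simp
next
  case (Suc n)
  have "V1 s (- real n) = V1 s (- real (Suc n) + 1)" by simp
  also have "\<dots> = V1 s (- real (Suc n))" by (rule facts(4)[OF Suc.prems])
  finally show ?case using Suc by simp
qed

text \<open>Integrating the profile equation twice from a zero of V1 leaves the kernel \<theta> - t
  and no derivative of the profile, so both sides can be differentiated in s. The base point moves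
  with n because the integral over \<open>{a..\<theta>}\<close> carries information only for a \<le>
  \<theta>.\<close>

lemma volterra:
  assumes s: "\<bar>s\<bar> < d" and \<theta>: "- real n \<le> \<theta>"
  shows "(k s)\<^sup>2 * (ln (g s \<theta>) - ln (g s (- real n))) =
    integral {- real n..\<theta>} (\<lambda>t. (\<theta> - t) * (1 / g s t))
    - 1 / c s * integral {- real n..\<theta>} (\<lambda>t. \<theta> - t)
    - 2 * E s * integral {- real n..\<theta>} (\<lambda>t. (\<theta> - t) * (1 / (g s t)\<^sup>2))"
proof -
  note f = facts[OF s]
  have k: "k s \<noteq> 0" using prof[OF s] by (simp add: rescaled_profile_def)
  have gnz: "g s t \<noteq> 0" for t using pos[OF s, of t] by simp
  note gc = smooth_continuous[OF f(1)]
  have "((\<lambda>t. (\<theta> - t) * ((k s)\<^sup>2 * V1 s t) + (k s)\<^sup>2 * ln (g s t)) has_real_derivative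
      (\<theta> - t) * (1 / g s t) - 1 / c s * (\<theta> - t) - 2 * E s * ((\<theta> - t) * (1 / (g s t)\<^sup>2))) (at t)" for t
  proof -
    have "((\<lambda>t. (\<theta> - t) * ((k s)\<^sup>2 * V1 s t) + (k s)\<^sup>2 * ln (g s t)) has_real_derivative
      (\<theta> - t) * ((k s)\<^sup>2 * ((1 / g s t - 1 / c s - 2 * E s / (g s t)\<^sup>2) / (k s)\<^sup>2))
      + (- 1) * ((k s)\<^sup>2 * V1 s t) + (k s)\<^sup>2 * V1 s t) (at t)"
    proof (intro DERIV_add DERIV_cmult f(6))
      have "((\<lambda>t. \<theta> - t) has_real_derivative - 1) (at t)" by (auto intro!: derivative_eq_intros)
      from DERIV_mult'[OF this DERIV_cmult[OF f(7), of "(k s)\<^sup>2"]]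
      show "((\<lambda>t. (\<theta> - t) * ((k s)\<^sup>2 * V1 s t)) has_real_derivative
          (\<theta> - t) * ((k s)\<^sup>2 * ((1 / g s t - 1 / c s - 2 * E s / (g s t)\<^sup>2) / (k s)\<^sup>2))
          + (- 1) * ((k s)\<^sup>2 * V1 s t)) (at t)" .
    qed
    moreover have "(k s)\<^sup>2 * (x / (k s)\<^sup>2) = x" for x using k by simp
    ultimately show ?thesis
      by (simp only:) (simp add: algebra_simps diff_divide_distrib)
  qed
  from has_integral_FTC[OF this \<theta>]
  have "((\<lambda>t. (\<theta> - t) * (1 / g s t) - 1 / c s * (\<theta> - t) - 2 * E s * ((\<theta> - t) * (1 / (g s t)\<^sup>2)))
      has_integral (k s)\<^sup>2 * (ln (g s \<theta>) - ln (g s (- real n)))) {- real n..\<theta>}"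
    by (simp add: V1_neg_nat[OF s] algebra_simps)
  moreover have "((\<lambda>t. (\<theta> - t) * (1 / g s t) - 1 / c s * (\<theta> - t) - 2 * E s * ((\<theta> - t) * (1 / (g s t)\<^sup>2)))
      has_integral integral {- real n..\<theta>} (\<lambda>t. (\<theta> - t) * (1 / g s t))
    - 1 / c s * integral {- real n..\<theta>} (\<lambda>t. \<theta> - t)
    - 2 * E s * integral {- real n..\<theta>} (\<lambda>t. (\<theta> - t) * (1 / (g s t)\<^sup>2))) {- real n..\<theta>}"
    by (intro has_integral_diff has_integral_mult_right integrable_integral integrable_continuous_real
        continuous_intros gc) (auto simp: gnz)
  ultimately show ?thesis by (rule has_integral_unique)
qed

text \<open>The s-derivative at 0 of the right-hand side 1/g - 1/c - 2 E/g^2 of the profile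
  equation.\<close>

definition "r = (\<lambda>t. - (Om t / g 0 t) + c' / (c 0)\<^sup>2 - 2 * E' / (g 0 t)\<^sup>2 + 4 * E 0 * Om t / (g 0 t)\<^sup>2)"

lemma r_cont: "continuous_on A r"
  unfolding r_def by (intro continuous_intros Om_cont g0_cont) (auto simp: g0_nz)

lemma volterra_deriv:
  assumes \<theta>: "- real n \<le> \<theta>"
  shows "(k 0)\<^sup>2 * (Om \<theta> - Om (- real n)) + 2 * k 0 * k' * (ln (g 0 \<theta>) - ln (g 0 (- real n)))
    = integral {- real n..\<theta>} (\<lambda>t. (\<theta> - t) * r t)"
proof -
  let ?I = "{- real n..\<theta>}"
  let ?L = "\<lambda>s. (k s)\<^sup>2 * (ln (g s \<theta>) - ln (g s (- real n)))"
  let ?R = "\<lambda>s. integral ?I (\<lambda>t. (\<theta> - t) * (1 / g s t)) - 1 / c s * integral ?I (\<lambda>t. \<theta> - t)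
    - 2 * E s * integral ?I (\<lambda>t. (\<theta> - t) * (1 / (g s t)\<^sup>2))"
  have W: "continuous_on UNIV (\<lambda>t. \<theta> - t)" by (intro continuous_intros)
  have "(?L has_real_derivative (k 0)\<^sup>2 * (Om \<theta> - Om (- real n))
      + 2 * k 0 * k' * (ln (g 0 \<theta>) - ln (g 0 (- real n)))) (at 0)"
    by (rule DERIV_cong[OF DERIV_mult'[OF DERIV_power[OF k', of 2] DERIV_diff[OF ln_g_deriv ln_g_deriv]]]) simp
  moreover have "(?R has_real_derivative
      integral ?I (\<lambda>t. (\<theta> - t) * - (Om t / g 0 t)) - (- (c' / (c 0)\<^sup>2)) * integral ?I (\<lambda>t. \<theta> - t)
      - (2 * E' * integral ?I (\<lambda>t. (\<theta> - t) * (1 / (g 0 t)\<^sup>2))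
        + integral ?I (\<lambda>t. (\<theta> - t) * - (2 * Om t / (g 0 t)\<^sup>2)) * (2 * E 0))) (at 0)"
    by (intro DERIV_diff DERIV_mult DERIV_cmult DERIV_cmult_right weighted_J1'[OF W] weighted_J2'[OF W]
        inverse_c' E_deriv)
  moreover have "\<forall>\<^sub>F s in nhds 0. ?L s = ?R s"
    using ev_small by eventually_elim (rule volterra[OF _ \<theta>])
  ultimately have "(k 0)\<^sup>2 * (Om \<theta> - Om (- real n)) + 2 * k 0 * k' * (ln (g 0 \<theta>) - ln (g 0 (- real n)))
    = integral ?I (\<lambda>t. (\<theta> - t) * - (Om t / g 0 t)) - (- (c' / (c 0)\<^sup>2)) * integral ?I (\<lambda>t. \<theta> - t)
      - (2 * E' * integral ?I (\<lambda>t. (\<theta> - t) * (1 / (g 0 t)\<^sup>2))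
        + integral ?I (\<lambda>t. (\<theta> - t) * - (2 * Om t / (g 0 t)\<^sup>2)) * (2 * E 0))"
    using DERIV_cong_ev[OF refl _ refl, of ?L ?R 0] DERIV_unique by blast
  moreover have "((\<lambda>t. (\<theta> - t) * - (Om t / g 0 t) - (- (c' / (c 0)\<^sup>2)) * (\<theta> - t)
      - (2 * E' * ((\<theta> - t) * (1 / (g 0 t)\<^sup>2)) + (\<theta> - t) * - (2 * Om t / (g 0 t)\<^sup>2) * (2 * E 0))) has_integral
    integral ?I (\<lambda>t. (\<theta> - t) * - (Om t / g 0 t)) - (- (c' / (c 0)\<^sup>2)) * integral ?I (\<lambda>t. \<theta> - t)
      - (2 * E' * integral ?I (\<lambda>t. (\<theta> - t) * (1 / (g 0 t)\<^sup>2))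
        + integral ?I (\<lambda>t. (\<theta> - t) * - (2 * Om t / (g 0 t)\<^sup>2)) * (2 * E 0))) ?I"
    by (intro has_integral_diff has_integral_add has_integral_mult_right has_integral_mult_left
        integrable_integral integrable_continuous_real continuous_intros Om_cont g0_cont) (auto simp: g0_nz)
  moreover have "(\<lambda>t. (\<theta> - t) * - (Om t / g 0 t) - (- (c' / (c 0)\<^sup>2)) * (\<theta> - t)
      - (2 * E' * ((\<theta> - t) * (1 / (g 0 t)\<^sup>2)) + (\<theta> - t) * - (2 * Om t / (g 0 t)\<^sup>2) * (2 * E 0)))
      = (\<lambda>t. (\<theta> - t) * r t)"
    by (auto simp: r_def fun_eq_iff algebra_simps)
  ultimately show ?thesis by (simp add: integral_unique)
qed

lemma Om_per: "Om (\<theta> + 1) = Om \<theta>" and Om_even: "Om (- \<theta>) = Om \<theta>"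
proof -
  have *: "Om a = Om b" if "\<And>s. \<bar>s\<bar> < d \<Longrightarrow> g s a = g s b" for a b
  proof -
    have "\<forall>\<^sub>F s in nhds 0. g s a = g s b"
      using ev_small by eventually_elim (rule that)
    then have "((\<lambda>s. g s b) has_real_derivative g' 0 a) (at 0)"
      using DERIV_cong_ev[OF refl _ refl, of "\<lambda>s. g s a" "\<lambda>s. g s b" 0 "g' 0 a"] g'[OF abs_0_less, of a] by simp
    then have "g' 0 a = g' 0 b"
      using g'[OF abs_0_less, of b] by (rule DERIV_unique)
    then show ?thesis using that[OF abs_0_less] by (simp add: Om_def)
  qed
  show "Om (\<theta> + 1) = Om \<theta>" by (rule *) (rule facts(2))
  show "Om (- \<theta>) = Om \<theta>" by (rule *) (rule facts(3))
qed

lemma k0: "0 < k 0" using prof[OF abs_0_less] by (simp add: rescaled_profile_def)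

definition "Om1 = deriv Om"
definition "V2 = (\<lambda>\<theta>. (1 / g 0 \<theta> - 1 / c 0 - 2 * E 0 / (g 0 \<theta>)\<^sup>2) / (k 0)\<^sup>2)"

lemma lng0: "((\<lambda>\<theta>. ln (g 0 \<theta>)) has_real_derivative V1 0 \<theta>) (at \<theta>)"
  and V1_deriv: "(V1 0 has_real_derivative V2 \<theta>) (at \<theta>)"
  unfolding V2_def using facts(6,7)[OF abs_0_less] by auto

lemma g0_deriv: "(g 0 has_real_derivative g 0 \<theta> * V1 0 \<theta>) (at \<theta>)"
  using smooth_has_deriv[OF facts(1)[OF abs_0_less], of \<theta>] by (simp add: V1_def g0_nz)

text \<open>The differentiated Volterra identity says that k^2 Om + 2 k k' ln g minus a second
  antiderivative of r is affine on every half-line from -n, hence on the whole line. So Om inherits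
  its \<theta>-derivatives from ln g and r, although only its continuity was known.\<close>

lemma Om_deriv: "(Om has_real_derivative Om1 \<theta>) (at \<theta>)"
  and Om1_deriv: "(Om1 has_real_derivative (r \<theta> - 2 * k 0 * k' * V2 \<theta>) / (k 0)\<^sup>2) (at \<theta>)"
proof -
  obtain S1 where S1: "\<And>t. (S1 has_real_derivative r t) (at t)"
    using continuous_antiderivative[OF r_cont] by (auto simp: has_real_derivative_iff_has_vector_derivative)
  have "continuous_on UNIV S1"
    using S1 DERIV_isCont continuous_at_imp_continuous_on by blast
  then obtain S2 where S2: "\<And>t. (S2 has_real_derivative S1 t) (at t)"
    using continuous_antiderivative[of S1] by (auto simp: has_real_derivative_iff_has_vector_derivative)
  define v where "v = (\<lambda>\<theta>. ln (g 0 \<theta>))"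
  have v: "(v has_real_derivative V1 0 \<theta>) (at \<theta>)" for \<theta> unfolding v_def by (rule lng0)
  define L where "L = (\<lambda>\<theta>. (k 0)\<^sup>2 * Om \<theta> + 2 * k 0 * k' * v \<theta> - S2 \<theta>)"
  have L: "L \<theta> = L (- real n) - (\<theta> + real n) * S1 (- real n)" if "- real n \<le> \<theta>" for \<theta> n
  proof -
    have "((\<lambda>t. (\<theta> - t) * r t) has_integral S2 \<theta> - S2 (- real n) - (\<theta> + real n) * S1 (- real n)) {- real n..\<theta>}"
    proof -
      have "((\<lambda>t. (\<theta> - t) * S1 t + S2 t) has_real_derivative (\<theta> - t) * r t) (at t)" for t
        by (auto intro!: derivative_eq_intros S1 S2)
      from has_integral_FTC[OF this that] show ?thesis by (simp add: algebra_simps)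
    qed
    then show ?thesis
      using volterra_deriv[OF that] by (simp add: L_def v_def integral_unique algebra_simps)
  qed
  \<comment> \<open>The points 0, 1 and \<theta> lie in the half-line from -n, and an affine
    function is determined by its values at 0 and 1; thus the coefficients do not depend on
    n.\<close>
  have aff: "L \<theta> = L 0 + (L 1 - L 0) * \<theta>" for \<theta>
  proof -
    obtain n where n: "- \<theta> \<le> real n" using real_arch_simple by blast
    define A where "A = L (- real n) - real n * S1 (- real n)"
    define B where "B = - S1 (- real n)"
    have *: "L x = A + B * x" if "- real n \<le> x" for x
      using L[OF that] by (simp add: A_def B_def algebra_simps)
    show ?thesis using *[of \<theta>] *[of 0] *[of 1] n by simp
  qed
  define b where "b = L 1 - L 0"
  have Om_eq: "Om = (\<lambda>\<theta>. (L 0 + b * \<theta> + S2 \<theta> - 2 * k 0 * k' * v \<theta>) / (k 0)\<^sup>2)"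
  proof
    fix \<theta>
    show "Om \<theta> = (L 0 + b * \<theta> + S2 \<theta> - 2 * k 0 * k' * v \<theta>) / (k 0)\<^sup>2"
      using aff[of \<theta>] k0 unfolding b_def[symmetric] by (simp add: L_def[of] field_simps)
  qed
  have d1: "(Om has_real_derivative (b + S1 \<theta> - 2 * k 0 * k' * V1 0 \<theta>) / (k 0)\<^sup>2) (at \<theta>)" for \<theta>
    unfolding Om_eq by (intro DERIV_cdivide) (auto intro!: derivative_eq_intros S2 v)
  then have Om1_eq: "Om1 = (\<lambda>\<theta>. (b + S1 \<theta> - 2 * k 0 * k' * V1 0 \<theta>) / (k 0)\<^sup>2)"
    unfolding Om1_def by (intro ext DERIV_imp_deriv)
  show "(Om has_real_derivative Om1 \<theta>) (at \<theta>)" using d1 by (simp add: Om1_eq)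
  show "(Om1 has_real_derivative (r \<theta> - 2 * k 0 * k' * V2 \<theta>) / (k 0)\<^sup>2) (at \<theta>)"
    unfolding Om1_eq by (intro DERIV_cdivide) (auto intro!: derivative_eq_intros S1 V1_deriv)
qed

lemma Om1_per: "Om1 (\<theta> + 1) = Om1 \<theta>" and Om1_0: "Om1 0 = 0"
  using periodic_derivative[OF Om_per Om_deriv] even_imp_deriv_0[OF Om_even Om_deriv] by auto

section \<open>Derivatives of M, Q and the fluxes along the family\<close>

lemma M'_eq: "integral {0..1} (\<lambda>\<theta>. g 0 \<theta> * Om \<theta>) = M'"
proof -
  have "((\<lambda>s. integral {0..1} (\<lambda>t. 1 * g s t)) has_real_derivative
      integral {0..1} (\<lambda>t. 1 * (1 * g' 0 t))) (at 0)"
    by (rule leibniz) (auto intro!: derivative_eq_intros continuous_intros)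
  then have "((\<lambda>s. M_of (g s)) has_real_derivative integral {0..1} (g' 0)) (at 0)"
    by (simp add: M_of_def)
  then have "integral {0..1} (g' 0) = M'" using M' by (rule DERIV_unique)
  moreover have "(\<lambda>\<theta>. g 0 \<theta> * Om \<theta>) = g' 0" by (auto simp: Om_def g0_nz)
  ultimately show ?thesis by simp
qed

definition "H' = - (Om 0 / g 0 0) + Om 0 / c 0 - c' * ln (g 0 0) / (c 0)\<^sup>2
  - E' / (g 0 0)\<^sup>2 + 2 * E 0 * Om 0 / (g 0 0)\<^sup>2"

lemma H_deriv: "(H has_real_derivative H') (at 0)"
proof -
  have g0: "((\<lambda>s. g s 0) has_real_derivative g 0 0 * Om 0) (at 0)"
    using g'[OF abs_0_less, of 0] by (simp add: Om_def g0_nz)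
  have "((\<lambda>s. 1 / g s 0 + ln (g s 0) * (1 / c s) - E s * (1 / (g s 0)\<^sup>2)) has_real_derivative
     - (Om 0 / g 0 0) + (ln (g 0 0) * - (c' / (c 0)\<^sup>2) + Om 0 * (1 / c 0))
     - (E 0 * - (2 * Om 0 / (g 0 0)\<^sup>2) + E' * (1 / (g 0 0)\<^sup>2))) (at 0)"
  proof (intro DERIV_diff DERIV_add DERIV_mult' inverse_c' E_deriv ln_g_deriv)
    show "((\<lambda>s. 1 / g s 0) has_real_derivative - (Om 0 / g 0 0)) (at 0)"
      using g0_pos[of 0] by (auto intro!: derivative_eq_intros g0 simp: power2_eq_square)
    show "((\<lambda>s. 1 / (g s 0)\<^sup>2) has_real_derivative - (2 * Om 0 / (g 0 0)\<^sup>2)) (at 0)"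
      using g0_pos[of 0] by (auto intro!: derivative_eq_intros g0 simp: power2_eq_square)
  qed
  moreover have "(\<lambda>s. 1 / g s 0 + ln (g s 0) * (1 / c s) - E s * (1 / (g s 0)\<^sup>2)) = H"
    by (simp add: profile_H_def)
  ultimately show ?thesis
    by (simp only:) (elim DERIV_cong, simp add: H'_def algebra_simps)
qed

text \<open>The integrand contains the \<theta>-derivative of the profile, so the flux is
  differentiated through the identity that equates it with 2 c E - c M.\<close>

lemma M_flux_deriv:
  "((\<lambda>s. integral {0..1} (\<lambda>\<theta>. 2 * (k s)\<^sup>2 * c s * (deriv (g s) \<theta>)\<^sup>2 - (g s \<theta>)\<^sup>2)) has_real_derivative
    2 * (c' * E 0 + c 0 * E') - c' * M_of (g 0) - c 0 * M') (at 0)"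
proof -
  have "((\<lambda>s. 2 * (c s * E s) - c s * M_of (g s)) has_real_derivative
      2 * (c 0 * E' + c' * E 0) - (c 0 * M' + c' * M_of (g 0))) (at 0)"
    by (intro DERIV_diff DERIV_cmult DERIV_mult' c' E_deriv M')
  moreover have "\<forall>\<^sub>F s in nhds 0. integral {0..1} (\<lambda>\<theta>. 2 * (k s)\<^sup>2 * c s * (deriv (g s) \<theta>)\<^sup>2 - (g s \<theta>)\<^sup>2)
      = 2 * (c s * E s) - c s * M_of (g s)"
    using ev_small by eventually_elim (simp add: facts(9))
  ultimately show ?thesis
    by (subst DERIV_cong_ev[OF refl _ refl]) (auto simp: algebra_simps)
qed

lemma Q_flux_deriv:
  "((\<lambda>s. integral {0..1} (\<lambda>\<theta>. 2 * ln \<bar>g s \<theta>\<bar>)) has_real_derivative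
    2 * (c' * H 0 + c 0 * H') - c' * Q_of (k 0) (g 0) - c 0 * Q') (at 0)"
proof -
  have "((\<lambda>s. 2 * (c s * H s) - c s * Q_of (k s) (g s) - 1) has_real_derivative
      2 * (c 0 * H' + c' * H 0) - (c 0 * Q' + c' * Q_of (k 0) (g 0)) - 0) (at 0)"
    by (intro DERIV_diff DERIV_cmult DERIV_mult' c' H_deriv Q' DERIV_const)
  moreover have "\<forall>\<^sub>F s in nhds 0. integral {0..1} (\<lambda>\<theta>. 2 * ln \<bar>g s \<theta>\<bar>)
      = 2 * (c s * H s) - c s * Q_of (k s) (g s) - 1"
    using ev_small by eventually_elim (simp only: facts(10) mult.assoc)
  ultimately show ?thesis
    by (subst DERIV_cong_ev[OF refl _ refl]) (auto simp: algebra_simps)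
qed

text \<open>The Q-flux is differentiated in two ways: through its expression 2 c H - c Q - 1, and
  under the integral, which only contains ln g.\<close>

lemma integral_Om:
  "2 * integral {0..1} Om = 2 * (c' * H 0 + c 0 * H') - c' * Q_of (k 0) (g 0) - c 0 * Q'"
proof -
  have "((\<lambda>s. integral {0..1} (\<lambda>t. 2 * ln (g s t))) has_real_derivative
      integral {0..1} (\<lambda>t. 2 * (1 / g 0 t * g' 0 t))) (at 0)"
    by (rule leibniz) (auto intro!: derivative_eq_intros continuous_intros)
  moreover have "\<forall>\<^sub>F s in nhds 0. integral {0..1} (\<lambda>\<theta>. 2 * ln \<bar>g s \<theta>\<bar>) = integral {0..1} (\<lambda>t. 2 * ln (g s t))"
    using ev_small by eventually_elim (simp add: pos abs_of_pos)
  ultimately have "((\<lambda>s. integral {0..1} (\<lambda>\<theta>. 2 * ln \<bar>g s \<theta>\<bar>)) has_real_derivative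
      integral {0..1} (\<lambda>t. 2 * (1 / g 0 t * g' 0 t))) (at 0)"
    by (subst DERIV_cong_ev[OF refl _ refl])
  from DERIV_unique[OF this Q_flux_deriv]
  have "integral {0..1} (\<lambda>t. 2 * Om t) = 2 * (c' * H 0 + c 0 * H') - c' * Q_of (k 0) (g 0) - c 0 * Q'"
    by (simp add: Om_def)
  then show ?thesis by simp
qed

text \<open>The derivative of the right-hand side of the profile equation with respect to ln
  g.\<close>

definition "V = (\<lambda>\<theta>. - 1 / g 0 \<theta> + 4 * E 0 / (g 0 \<theta>)\<^sup>2)"

lemma r_eq: "r \<theta> = V \<theta> * Om \<theta> + c' / (c 0)\<^sup>2 - 2 * E' / (g 0 \<theta>)\<^sup>2"
  by (simp add: r_def V_def algebra_simps)

lemma V2_deriv: "(V2 has_real_derivative V \<theta> * V1 0 \<theta> / (k 0)\<^sup>2) (at \<theta>)"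
  unfolding V2_def V_def
proof (rule DERIV_cdivide)
  show "((\<lambda>\<theta>. 1 / g 0 \<theta> - 1 / c 0 - 2 * E 0 / (g 0 \<theta>)\<^sup>2) has_real_derivative
      (- 1 / g 0 \<theta> + 4 * E 0 / (g 0 \<theta>)\<^sup>2) * V1 0 \<theta>) (at \<theta>)"
    using g0_nz[of \<theta>] by (auto intro!: derivative_eq_intros g0_deriv simp: field_simps power2_eq_square)
qed

text \<open>Formally the s-derivative of the energy identity, but V1 is not known to be
  differentiable in s. Instead, the equation for Om shows that the expression \<open>D\<close> is
  constant in \<theta>, and its value at 0, where V1 vanishes, is H'.\<close>

lemma linearized_energy:
  "(k 0)\<^sup>2 * V1 0 \<theta> * Om1 \<theta> + k 0 * k' * (V1 0 \<theta>)\<^sup>2 =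
    H' + Om \<theta> / g 0 \<theta> - Om \<theta> / c 0 + c' * ln (g 0 \<theta>) / (c 0)\<^sup>2 + E' / (g 0 \<theta>)\<^sup>2 - 2 * E 0 * Om \<theta> / (g 0 \<theta>)\<^sup>2"
proof -
  define v where "v = (\<lambda>\<theta>. ln (g 0 \<theta>))"
  have v: "(v has_real_derivative V1 0 \<theta>) (at \<theta>)" for \<theta> unfolding v_def by (rule lng0)
  define D where "D = (\<lambda>\<theta>. (k 0)\<^sup>2 * V1 0 \<theta> * Om1 \<theta> + k 0 * k' * (V1 0 \<theta>)\<^sup>2 -
    (Om \<theta> / g 0 \<theta> - Om \<theta> / c 0 + c' * v \<theta> / (c 0)\<^sup>2 + E' / (g 0 \<theta>)\<^sup>2 - 2 * E 0 * Om \<theta> / (g 0 \<theta>)\<^sup>2))"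
  have "(D has_real_derivative 0) (at \<theta>)" for \<theta>
  proof -
    have q1: "((\<lambda>\<theta>. Om \<theta> / g 0 \<theta>) has_real_derivative Om1 \<theta> / g 0 \<theta> - Om \<theta> * V1 0 \<theta> / g 0 \<theta>) (at \<theta>)"
      using g0_nz[of \<theta>] by (auto intro!: derivative_eq_intros Om_deriv g0_deriv simp: field_simps)
    have q2: "((\<lambda>\<theta>. E' / (g 0 \<theta>)\<^sup>2) has_real_derivative - (2 * E' * V1 0 \<theta> / (g 0 \<theta>)\<^sup>2)) (at \<theta>)"
      using g0_nz[of \<theta>] by (auto intro!: derivative_eq_intros g0_deriv simp: field_simps power2_eq_square)
    have q3: "((\<lambda>\<theta>. 2 * E 0 * Om \<theta> / (g 0 \<theta>)\<^sup>2) has_real_derivative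
        2 * E 0 * Om1 \<theta> / (g 0 \<theta>)\<^sup>2 - 4 * E 0 * Om \<theta> * V1 0 \<theta> / (g 0 \<theta>)\<^sup>2) (at \<theta>)"
      using g0_nz[of \<theta>] by (auto intro!: derivative_eq_intros Om_deriv g0_deriv simp: field_simps power2_eq_square)
    have "(D has_real_derivative
      ((k 0)\<^sup>2 * V1 0 \<theta> * ((r \<theta> - 2 * k 0 * k' * V2 \<theta>) / (k 0)\<^sup>2) + (k 0)\<^sup>2 * V2 \<theta> * Om1 \<theta>)
      + k 0 * k' * (of_nat 2 * (V2 \<theta> * V1 0 \<theta> ^ (2 - Suc 0)))
      - ((Om1 \<theta> / g 0 \<theta> - Om \<theta> * V1 0 \<theta> / g 0 \<theta>) - Om1 \<theta> / c 0 + c' * V1 0 \<theta> / (c 0)\<^sup>2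
        + - (2 * E' * V1 0 \<theta> / (g 0 \<theta>)\<^sup>2)
        - (2 * E 0 * Om1 \<theta> / (g 0 \<theta>)\<^sup>2 - 4 * E 0 * Om \<theta> * V1 0 \<theta> / (g 0 \<theta>)\<^sup>2))) (at \<theta>)"
      unfolding D_def
      by (intro DERIV_diff DERIV_add DERIV_mult' DERIV_cmult DERIV_power DERIV_cdivide v Om_deriv
          Om1_deriv V1_deriv q1 q2 q3)
    moreover have e1: "(k 0)\<^sup>2 * V1 0 \<theta> * ((r \<theta> - 2 * k 0 * k' * V2 \<theta>) / (k 0)\<^sup>2)
        = V1 0 \<theta> * (V \<theta> * Om \<theta> + c' / (c 0)\<^sup>2 - 2 * E' / (g 0 \<theta>)\<^sup>2) - 2 * k 0 * k' * V2 \<theta> * V1 0 \<theta>"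
    proof -
      have "(k 0)\<^sup>2 * a * (b / (k 0)\<^sup>2) = a * b" for a b using k0 by simp
      then show ?thesis by (simp only: r_eq) (simp add: algebra_simps)
    qed
    moreover have e2: "(k 0)\<^sup>2 * V2 \<theta> = 1 / g 0 \<theta> - 1 / c 0 - 2 * E 0 / (g 0 \<theta>)\<^sup>2"
      using k0 by (simp add: V2_def)
    ultimately show ?thesis
      by (elim DERIV_cong)
        (simp only: e1 e2, simp add: V_def algebra_simps add_divide_distrib diff_divide_distrib)
  qed
  then have "D \<theta> = D 0" by (metis DERIV_isconst_all)
  also have "D 0 = H'"
    using facts(5)[OF abs_0_less] by (simp add: D_def H'_def v_def)
  finally show ?thesis by (simp add: D_def v_def)
qed

lemma V1_cont: "continuous_on A (V1 0)"
  using V1_deriv DERIV_isCont continuous_at_imp_continuous_on by blast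

lemma Om1_cont: "continuous_on A Om1"
  using Om1_deriv DERIV_isCont continuous_at_imp_continuous_on by blast

text \<open>The density of Q contains V1^2, which bars differentiation under the integral. The
  linearized energy trades the terms with V1 for derivative-free ones, whose integrals are known
  from \<open>E'_eq\<close>, \<open>integral_Om\<close> and the formula for the Q-flux.\<close>

lemma Q'_eq: "integral {0..1} (\<lambda>\<theta>. - (Om \<theta> / g 0 \<theta>) + 2 * k 0 * k' * (V1 0 \<theta>)\<^sup>2 + 2 * (k 0)\<^sup>2 * V1 0 \<theta> * Om1 \<theta>) = Q'"
proof -
  let ?I = "{0..1::real}"
  have eq: "- (Om \<theta> / g 0 \<theta>) + 2 * k 0 * k' * (V1 0 \<theta>)\<^sup>2 + 2 * (k 0)\<^sup>2 * V1 0 \<theta> * Om1 \<theta>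
    = 2 * H' + Om \<theta> / g 0 \<theta> - 2 / c 0 * Om \<theta> + c' / (c 0)\<^sup>2 * (2 * ln \<bar>g 0 \<theta>\<bar>)
      + 2 * E' * (1 / (g 0 \<theta>)\<^sup>2) - 4 * E 0 * (Om \<theta> / (g 0 \<theta>)\<^sup>2)" for \<theta>
    using arg_cong[OF linearized_energy[of \<theta>], of "\<lambda>x. 2 * x"] g0_pos[of \<theta>]
    by (simp add: abs_of_pos divide_inverse algebra_simps)
  have "((\<lambda>\<theta>. 2 * H' + Om \<theta> / g 0 \<theta> - 2 / c 0 * Om \<theta> + c' / (c 0)\<^sup>2 * (2 * ln \<bar>g 0 \<theta>\<bar>)
      + 2 * E' * (1 / (g 0 \<theta>)\<^sup>2) - 4 * E 0 * (Om \<theta> / (g 0 \<theta>)\<^sup>2)) has_integral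
    integral ?I (\<lambda>\<theta>. 2 * H') + integral ?I (\<lambda>\<theta>. Om \<theta> / g 0 \<theta>) - 2 / c 0 * integral ?I Om
    + c' / (c 0)\<^sup>2 * integral ?I (\<lambda>\<theta>. 2 * ln \<bar>g 0 \<theta>\<bar>)
    + 2 * E' * integral ?I (\<lambda>\<theta>. 1 / (g 0 \<theta>)\<^sup>2) - 4 * E 0 * integral ?I (\<lambda>\<theta>. Om \<theta> / (g 0 \<theta>)\<^sup>2)) ?I"
    by (intro has_integral_diff has_integral_add has_integral_mult_right integrable_integral
        integrable_continuous_real continuous_intros Om_cont g0_cont)
      (auto simp: g0_nz)
  then have 0: "integral ?I (\<lambda>\<theta>. - (Om \<theta> / g 0 \<theta>) + 2 * k 0 * k' * (V1 0 \<theta>)\<^sup>2 + 2 * (k 0)\<^sup>2 * V1 0 \<theta> * Om1 \<theta>)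
     = 2 * H' + integral ?I (\<lambda>\<theta>. Om \<theta> / g 0 \<theta>) - 2 / c 0 * integral ?I Om
    + c' / (c 0)\<^sup>2 * integral ?I (\<lambda>\<theta>. 2 * ln \<bar>g 0 \<theta>\<bar>)
    + 2 * E' * integral ?I (\<lambda>\<theta>. 1 / (g 0 \<theta>)\<^sup>2) - 4 * E 0 * integral ?I (\<lambda>\<theta>. Om \<theta> / (g 0 \<theta>)\<^sup>2)"
    unfolding eq by (simp add: integral_unique)
  have 1: "2 * E' * integral ?I (\<lambda>\<theta>. 1 / (g 0 \<theta>)\<^sup>2) - 4 * E 0 * integral ?I (\<lambda>\<theta>. Om \<theta> / (g 0 \<theta>)\<^sup>2)
     = c' / (c 0)\<^sup>2 - integral ?I (\<lambda>\<theta>. Om \<theta> / g 0 \<theta>)"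
  proof -
    have "D' = - (4 * integral ?I (\<lambda>\<theta>. Om \<theta> / (g 0 \<theta>)\<^sup>2))"
    proof -
      have "(\<lambda>t. - (2 * Om t / (g 0 t)\<^sup>2)) = (\<lambda>t. (- 2) * (Om t / (g 0 t)\<^sup>2))" by auto
      then show ?thesis unfolding D'_def by (simp only: integral_mult_right)
    qed
    then show ?thesis using E'_eq unfolding D\<^sub>0_def N'_def by (simp add: algebra_simps)
  qed
  have 2: "2 / c 0 * integral ?I Om
      = 1 / c 0 * (2 * (c' * H 0 + c 0 * H') - c' * Q_of (k 0) (g 0) - c 0 * Q')"
    unfolding integral_Om[symmetric] by simp
  have 3: "c' / (c 0)\<^sup>2 * (2 * c 0 * H 0 - c 0 * Q_of (k 0) (g 0) - 1) + c' / (c 0)\<^sup>2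
      + 2 * H' - 1 / c 0 * (2 * (c' * H 0 + c 0 * H') - c' * Q_of (k 0) (g 0) - c 0 * Q') = Q'"
    (is "?l = _")
  proof -
    have "a / b\<^sup>2 * (2 * b * h - b * q - 1) + a / b\<^sup>2 + 2 * h' - 1 / b * (2 * (a * h + b * h') - a * q - b * q') = q'"
      if "b \<noteq> 0" for a b h h' q q' :: real
      using that by (simp add: field_simps power2_eq_square)
    then show ?thesis using cnz[OF abs_0_less] by blast
  qed
  show ?thesis
    using 0 1 2 3 unfolding facts(10)[OF abs_0_less] by linarith
qed

text \<open>The formal s-derivative at 0 of ln g in the unscaled variable, that is at \<theta> =
  k(s) z; the changing wave number contributes the secular term k' z V1.\<close>

definition "\<omega> = (\<lambda>z. k' * z * V1 0 (k 0 * z) + Om (k 0 * z))"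
definition "\<omega>1 = (\<lambda>z. k' * V1 0 (k 0 * z) + k' * z * (V2 (k 0 * z) * k 0) + Om1 (k 0 * z) * k 0)"

lemma scale_deriv:
  assumes "\<And>\<theta>. (F has_real_derivative F' \<theta>) (at \<theta>)"
  shows "((\<lambda>z. F (k 0 * z)) has_real_derivative F' (k 0 * z) * k 0) (at z)"
  using DERIV_chain2[where f = F and g = "\<lambda>z. k 0 * z" and x = z and s = UNIV, OF assms DERIV_cmult_Id] .

lemma \<omega>_deriv: "(\<omega> has_real_derivative \<omega>1 z) (at z)"
  unfolding \<omega>_def \<omega>1_def
  by (rule DERIV_cong[OF DERIV_add[OF DERIV_mult'[OF DERIV_cmult_Id scale_deriv[OF V1_deriv]] scale_deriv[OF Om_deriv]]])
    simp

text \<open>The unscaled profile equation does not contain k, so k' drops out of its linearization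
  and survives only in the end values.\<close>

lemma \<omega>1_deriv: "(\<omega>1 has_real_derivative V (k 0 * z) * \<omega> z + c' / (c 0)\<^sup>2 - 2 * E' / (g 0 (k 0 * z))\<^sup>2) (at z)"
proof -
  let ?\<theta> = "k 0 * z"
  have "(\<omega>1 has_real_derivative k' * (V2 ?\<theta> * k 0)
      + (k' * z * (V ?\<theta> * V1 0 ?\<theta> / (k 0)\<^sup>2 * k 0 * k 0) + k' * (V2 ?\<theta> * k 0))
      + (r ?\<theta> - 2 * k 0 * k' * V2 ?\<theta>) / (k 0)\<^sup>2 * k 0 * k 0) (at z)"
    unfolding \<omega>1_def
    by (intro DERIV_add DERIV_cmult DERIV_cmult_right DERIV_mult'[of "\<lambda>z. k' * z"] DERIV_cmult_Id
        scale_deriv V1_deriv V2_deriv Om1_deriv)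
  moreover have "x / (k 0)\<^sup>2 * k 0 * k 0 = x" for x using k0 by (simp add: power2_eq_square)
  ultimately show ?thesis
    by (elim DERIV_cong) (simp only:, simp add: r_eq \<omega>_def algebra_simps)
qed

lemma g0_1: "g 0 1 = g 0 0" and V1_1: "V1 0 1 = 0"
  using facts(2)[OF abs_0_less, of 0] facts(4,5)[OF abs_0_less] by (auto dest: meta_spec[of _ 0])

text \<open>The secular term is the only failure of periodicity; since V1 vanishes at both ends, it
  shows up in the derivative but not in the value.\<close>

lemma \<omega>_ends: "\<omega> 0 = Om 0" "\<omega>1 0 = 0" "\<omega> (1 / k 0) = \<omega> 0" "\<omega>1 (1 / k 0) = k' * V2 0"
proof -
  have V2_1: "V2 1 = V2 0" by (simp add: V2_def g0_1)
  show "\<omega> 0 = Om 0" "\<omega>1 0 = 0" using facts(5)[OF abs_0_less] Om1_0 by (simp_all add: \<omega>_def \<omega>1_def)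
  show "\<omega> (1 / k 0) = \<omega> 0" using k0 Om_per[of 0] V1_1 facts(5)[OF abs_0_less] by (simp add: \<omega>_def)
  show "\<omega>1 (1 / k 0) = k' * V2 0"
    using k0 Om1_per[of 0] V1_1 Om1_0 V2_1 by (simp add: \<omega>1_def)
qed

text \<open>In the scaled variable \<theta> g V1 = (\<theta> g)' - g, which converts the secular
  term into a boundary value and M; \<open>M'_eq\<close> gives the rest. An arbitrary antiderivative
  is allowed because the lemma will be applied to a component of a solution of the linear
  system.\<close>

lemma integral_\<phi>\<omega>:
  assumes X: "\<And>z. (X has_real_derivative g 0 (k 0 * z) * \<omega> z) (at z)"
  shows "X (1 / k 0) - X 0 = M' / k 0 + k' / (k 0)\<^sup>2 * (g 0 0 - M_of (g 0))"
proof -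
  let ?k = "k 0"
  define Y where "Y = (\<lambda>\<theta>. X (1 / ?k * \<theta>) - k' / ?k\<^sup>2 * (\<theta> * g 0 \<theta>))"
  have "(Y has_real_derivative 1 / ?k * (g 0 \<theta> * Om \<theta>) - k' / ?k\<^sup>2 * g 0 \<theta>) (at \<theta>)" for \<theta>
  proof -
    have "((\<lambda>\<theta>. X (1 / ?k * \<theta>)) has_real_derivative g 0 (?k * (1 / ?k * \<theta>)) * \<omega> (1 / ?k * \<theta>) * (1 / ?k)) (at \<theta>)"
      using DERIV_chain2[where f = X and g = "\<lambda>z. 1 / ?k * z" and x = \<theta> and s = UNIV, OF X DERIV_cmult_Id] .
    then have "(Y has_real_derivative g 0 (?k * (1 / ?k * \<theta>)) * \<omega> (1 / ?k * \<theta>) * (1 / ?k)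
        - k' / ?k\<^sup>2 * (\<theta> * (g 0 \<theta> * V1 0 \<theta>) + 1 * g 0 \<theta>)) (at \<theta>)"
      unfolding Y_def by (intro DERIV_diff DERIV_cmult DERIV_mult' DERIV_ident g0_deriv)
    then show ?thesis
      using k0 by (elim DERIV_cong) (simp add: \<omega>_def power2_eq_square algebra_simps add_divide_distrib)
  qed
  from has_integral_FTC[OF this, of 0 1]
  have "((\<lambda>\<theta>. 1 / ?k * (g 0 \<theta> * Om \<theta>) - k' / ?k\<^sup>2 * g 0 \<theta>) has_integral Y 1 - Y 0) {0..1}" by simp
  moreover have "((\<lambda>\<theta>. 1 / ?k * (g 0 \<theta> * Om \<theta>) - k' / ?k\<^sup>2 * g 0 \<theta>) has_integral 1 / ?k * M' - k' / ?k\<^sup>2 * M_of (g 0)) {0..1}"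
    unfolding M'_eq[symmetric] M_of_def
    by (intro has_integral_diff has_integral_mult_right integrable_integral integrable_continuous_real
        continuous_intros g0_cont Om_cont)
  ultimately have "Y 1 - Y 0 = 1 / ?k * M' - k' / ?k\<^sup>2 * M_of (g 0)" by (rule has_integral_unique)
  then show ?thesis by (simp add: Y_def g0_1 right_diff_distrib)
qed

text \<open>The integrand is minus the linearized density of Q. The secular term is \<theta> times
  the derivative of the density \<open>?q\<close> and is integrated by parts; \<open>Q'_eq\<close>
  gives the rest.\<close>

lemma integral_\<omega>_Q:
  assumes X: "\<And>z. (X has_real_derivative
    \<omega> z / g 0 (k 0 * z) - 2 * (k 0 * V1 0 (k 0 * z)) * \<omega>1 z) (at z)"
  shows "X (1 / k 0) - X 0 = - (Q' / k 0) - k' / (k 0)\<^sup>2 * (1 / g 0 0 - Q_of (k 0) (g 0))"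
proof -
  let ?k = "k 0"
  let ?p = "\<lambda>\<theta>. - (Om \<theta> / g 0 \<theta>) + 2 * ?k * k' * (V1 0 \<theta>)\<^sup>2 + 2 * ?k\<^sup>2 * V1 0 \<theta> * Om1 \<theta>"
  let ?q = "\<lambda>\<theta>. 1 / g 0 \<theta> + ?k\<^sup>2 * (V1 0 \<theta>)\<^sup>2"
  have q': "(?q has_real_derivative - (V1 0 \<theta> / g 0 \<theta>) + ?k\<^sup>2 * (2 * V2 \<theta> * V1 0 \<theta>)) (at \<theta>)" for \<theta>
    using g0_nz[of \<theta>] by (auto intro!: derivative_eq_intros g0_deriv V1_deriv simp: power2_eq_square)
  define Y where "Y = (\<lambda>\<theta>. X (1 / ?k * \<theta>) + k' / ?k\<^sup>2 * (\<theta> * ?q \<theta>))"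
  have "(Y has_real_derivative - 1 / ?k * ?p \<theta> + k' / ?k\<^sup>2 * ?q \<theta>) (at \<theta>)" for \<theta>
  proof -
    have "((\<lambda>\<theta>. X (1 / ?k * \<theta>)) has_real_derivative (\<omega> (1 / ?k * \<theta>) / g 0 (?k * (1 / ?k * \<theta>))
        - 2 * (?k * V1 0 (?k * (1 / ?k * \<theta>))) * \<omega>1 (1 / ?k * \<theta>)) * (1 / ?k)) (at \<theta>)"
      using DERIV_chain2[where f = X and g = "\<lambda>z. 1 / ?k * z" and x = \<theta> and s = UNIV, OF X DERIV_cmult_Id] .
    then have "(Y has_real_derivative (\<omega> (1 / ?k * \<theta>) / g 0 (?k * (1 / ?k * \<theta>))
        - 2 * (?k * V1 0 (?k * (1 / ?k * \<theta>))) * \<omega>1 (1 / ?k * \<theta>)) * (1 / ?k)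
        + k' / ?k\<^sup>2 * (\<theta> * (- (V1 0 \<theta> / g 0 \<theta>) + ?k\<^sup>2 * (2 * V2 \<theta> * V1 0 \<theta>)) + 1 * ?q \<theta>)) (at \<theta>)"
      unfolding Y_def by (intro DERIV_add[where f = "\<lambda>\<theta>. X (1 / ?k * \<theta>)"] DERIV_cmult DERIV_mult'[OF DERIV_ident] q')
    moreover have "?k * (1 / ?k * \<theta>) = \<theta>" using k0 by simp
    ultimately show ?thesis
      using k0 g0_nz[of \<theta>] by (elim DERIV_cong) (simp add: \<omega>_def \<omega>1_def field_simps power2_eq_square)
  qed
  from has_integral_FTC[OF this, of 0 1]
  have "((\<lambda>\<theta>. - 1 / ?k * ?p \<theta> + k' / ?k\<^sup>2 * ?q \<theta>) has_integral Y 1 - Y 0) {0..1}" by simp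
  moreover have "((\<lambda>\<theta>. - 1 / ?k * ?p \<theta> + k' / ?k\<^sup>2 * ?q \<theta>) has_integral - 1 / ?k * Q' + k' / ?k\<^sup>2 * Q_of ?k (g 0)) {0..1}"
    unfolding Q'_eq[symmetric] facts(11)[OF abs_0_less]
    by (intro has_integral_add has_integral_mult_right integrable_integral integrable_continuous_real
        continuous_intros g0_cont Om_cont Om1_cont V1_cont) (auto simp: g0_nz)
  ultimately have "Y 1 - Y 0 = - 1 / ?k * Q' + k' / ?k\<^sup>2 * Q_of ?k (g 0)" by (rule has_integral_unique)
  then show ?thesis by (simp add: Y_def g0_1 V1_1 right_diff_distrib mult.commute)
qed

end

section \<open>Floquet solutions of the linearized equation\<close>

lemma vector3_eq: "(vector [a, b, c] :: 'a::zero^3) = (\<chi> i. if i = 1 then a else if i = 2 then b else c)"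
  by (simp add: vec_eq_iff forall_3 vector_3)

lemma continuous_on_vector3:
  fixes f g h :: "real \<Rightarrow> 'a::{topological_space, zero}"
  assumes "continuous_on S f" "continuous_on S g" "continuous_on S h"
  shows "continuous_on S (\<lambda>t. vector [f t, g t, h t] :: 'a^3)"
proof -
  have "continuous_on S (\<lambda>t. if i = 1 then f t else if i = 2 then g t else h t)" for i :: 3
    using assms by (cases "i = 1"; cases "i = 2") simp_all
  then show ?thesis unfolding vector3_eq by (rule continuous_on_vec_lambda)
qed

lemma has_vector_derivative_vector3:
  fixes f g h :: "real \<Rightarrow> complex"
  assumes "(f has_vector_derivative f') (at t)" "(g has_vector_derivative g') (at t)"
    "(h has_vector_derivative h') (at t)"
  shows "((\<lambda>t. vector [f t, g t, h t] :: complex^3) has_vector_derivative vector [f', g', h']) (at t)"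
proof (rule has_vector_derivative_vecI)
  fix i :: 3
  show "((\<lambda>t. (vector [f t, g t, h t] :: complex^3) $ i) has_vector_derivative vector [f', g', h'] $ i) (at t)"
    using assms exhaust_3[of i] by (auto simp: vector_3)
qed

lemma has_vector_derivative_of_real_mult:
  assumes "(a has_real_derivative a') (at t)" "(z has_vector_derivative z') (at t)"
  shows "((\<lambda>t. of_real (a t) * z t :: complex) has_vector_derivative of_real (a t) * z' + of_real a' * z t) (at t)"
proof -
  have "((\<lambda>t. of_real (a t) :: complex) has_vector_derivative of_real a') (at t)"
    using assms(1) unfolding has_real_derivative_iff_has_vector_derivative
    by (rule bounded_linear.has_vector_derivative[OF bounded_linear_of_real])
  from has_vector_derivative_mult[OF this assms(2)] show ?thesis .
qed

lemma smooth_alg_minus: "f \<in> smooth_alg B \<Longrightarrow> (\<lambda>x. - f x) \<in> smooth_alg B"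
  using smooth_alg.mult[OF smooth_alg.smth[OF smooth_const[of "-1"]], of f B] by simp

lemma smooth_alg_diff: "f \<in> smooth_alg B \<Longrightarrow> g \<in> smooth_alg B \<Longrightarrow> (\<lambda>x. f x - g x) \<in> smooth_alg B"
  using smooth_alg.add[OF _ smooth_alg_minus, of f B g] by simp

text \<open>With \<open>\<psi> = z3\<close>, the adjoint system is equivalent to the third order equation
  \<open>(\<partial>\<^sub>z \<L> - l G)\<^sup>* \<psi> = 0\<close>.\<close>

lemma adjoint_scalar_equation:
  fixes f p q c V l z1 z2 z3 :: complex
  assumes "f \<noteq> 0" "c \<noteq> 0" and V: "V = 1 / f - 2 / c - 2 * q / f + 2 * p\<^sup>2 / f\<^sup>2"
  defines "z2' \<equiv> - z1 - l / c * z2" and "z1' \<equiv> - (V * z2) - l * f * z3"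
  shows "c * f * ((6 * p\<^sup>2 / (c * f ^ 4) - 2 * q / (c * f ^ 3)) * z2 + 2 * (- 2 * p / (c * f ^ 3)) * z2'
        + 1 / (c * f\<^sup>2) * (- z1' - l / c * z2'))
      + (4 * c * p + l * f) * (- 2 * p / (c * f ^ 3) * z2 + 1 / (c * f\<^sup>2) * z2')
      + (2 * f - c + 4 * c * q + l * (2 * p)) * (1 / (c * f\<^sup>2) * z2) - l * z3 = 0"
  unfolding V z1'_def z2'_def using assms(1,2)
  by (simp add: divide_simps) algebra

text \<open>One wave in the unscaled variable: \<open>v1\<close> is (ln \<phi>)', \<open>E\<close>
  the constant of the profile equation, and \<open>v1_0\<close> records the evenness of the
  profile.\<close>

locale periodic_wave =
  fixes \<phi> v1 :: "real \<Rightarrow> real" and c E T :: real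
  assumes \<phi>: "smooth \<phi>" and pos: "0 < \<phi> z" and per: "\<phi> (z + T) = \<phi> z" and T: "0 < T" and c: "c \<noteq> 0"
    and ln_\<phi>: "((\<lambda>z. ln (\<phi> z)) has_real_derivative v1 z) (at z)"
    and v1: "(v1 has_real_derivative 1 / \<phi> z - 1 / c - 2 * E / (\<phi> z)\<^sup>2) (at z)"
    and v1_0: "v1 0 = 0"
begin

definition "v2 = (\<lambda>z. 1 / \<phi> z - 1 / c - 2 * E / (\<phi> z)\<^sup>2)"
definition "V = (\<lambda>z. - 1 / \<phi> z + 4 * E / (\<phi> z)\<^sup>2)"

lemma nz: "\<phi> z \<noteq> 0" using pos[of z] by simp

lemma \<phi>_deriv: "(\<phi> has_real_derivative \<phi> z * v1 z) (at z)"
proof -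
  have "((\<lambda>z. ln (\<phi> z)) has_real_derivative deriv \<phi> z / \<phi> z) (at z)"
    using smooth_has_deriv[OF \<phi>, of z] pos[of z] by (auto intro!: derivative_eq_intros)
  from DERIV_unique[OF this ln_\<phi>] show ?thesis
    using smooth_has_deriv[OF \<phi>, of z] nz[of z] by (simp add: field_simps)
qed

text \<open>The right side is the coefficient that arises when \<L>[\<phi>] is applied to \<phi> u;
  the profile equation identifies it with the potential of the linearized profile equation.\<close>

lemma V_eq: "V z = 1 / \<phi> z - 2 / c - 2 * deriv (deriv \<phi>) z / \<phi> z + 2 * (deriv \<phi> z)\<^sup>2 / (\<phi> z)\<^sup>2"
proof -
  have d: "deriv \<phi> = (\<lambda>z. \<phi> z * v1 z)" using \<phi>_deriv by (auto intro!: DERIV_imp_deriv)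
  have "((\<lambda>z. \<phi> z * v1 z) has_real_derivative \<phi> z * v2 z + \<phi> z * v1 z * v1 z) (at z)"
    unfolding v2_def by (intro DERIV_mult' \<phi>_deriv v1)
  then have "deriv (deriv \<phi>) z = \<phi> z * v2 z + \<phi> z * v1 z * v1 z"
    unfolding d by (rule DERIV_imp_deriv)
  then show ?thesis
    unfolding d V_def v2_def using nz[of z] c by (simp add: field_simps power2_eq_square)
qed

lemma V_smooth: "smooth V"
  unfolding V_def by (intro smooth_intros \<phi>) (auto simp: nz)

text \<open>The unknowns are \<open>u = f / \<phi>\<close>, its derivative, and \<open>\<L>[\<phi>] f + \<mu> \<phi>\<^sup>2 u'\<close>, whose derivative is
  \<open>\<mu> f\<close> because \<open>G[\<phi>] f = f - (\<phi>\<^sup>2 u')'\<close>.\<close>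

definition sysmat :: "complex \<Rightarrow> real \<Rightarrow> complex^3^3" where
  "sysmat \<mu> z = vector [vector [0, 1, 0],
    vector [of_real (V z), \<mu> / of_real c, - of_real (1 / (c * (\<phi> z)\<^sup>2))],
    vector [\<mu> * of_real (\<phi> z), 0, 0]]"

lemma sysmat_mult: "sysmat \<mu> z *v y = vector [y $ 2,
    of_real (V z) * y $ 1 + \<mu> / of_real c * y $ 2 - of_real (1 / (c * (\<phi> z)\<^sup>2)) * y $ 3,
    \<mu> * of_real (\<phi> z) * y $ 1]"
  by (simp add: vec_eq_iff forall_3 vector_3 matrix_vector_mult_def sum_3 sysmat_def)

lemma sysmat_transpose_mult: "transpose (sysmat \<mu> z) *v y = vector [of_real (V z) * y $ 2 + \<mu> * of_real (\<phi> z) * y $ 3,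
    y $ 1 + \<mu> / of_real c * y $ 2, - (of_real (1 / (c * (\<phi> z)\<^sup>2)) * y $ 2)]"
  unfolding vec_eq_iff forall_3 transpose_def matrix_vector_mult_def
  by (simp add: vector_3 sum_3 sysmat_def)

lemma sysmat_cont: "continuous_on A (sysmat \<mu>)"
  unfolding sysmat_def[abs_def]
  by (intro continuous_on_vector3 continuous_intros smooth_continuous V_smooth \<phi>) (auto simp: nz c)

lemma sysmat_per: "sysmat \<mu> (z + T) = sysmat \<mu> z"
  by (simp add: sysmat_def V_def per)

text \<open>Passes to the adjoint system, whose multiplier 1/\<rho> again lies on the unit circle,
  and feeds its third component into the criterion for the spectrum.\<close>

lemma floquet_in_spectrum:
  assumes Y: "\<And>z. (Y has_vector_derivative sysmat \<mu> z *v Y z) (at z)"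
    and YT: "Y T = \<rho> *s Y 0" and Y0: "Y 0 \<noteq> 0" and \<rho>: "norm \<rho> = 1"
  shows "\<mu> \<in> L2_spectrum (A_graph c \<phi>)"
proof -
  have "\<rho> \<noteq> 0" using \<rho> by auto
  then obtain Z where Z: "\<And>t. (Z has_vector_derivative - (transpose (sysmat \<mu> t) *v Z t)) (at t)"
    and Z0: "Z 0 \<noteq> 0" and ZT: "\<And>t. Z (t + T) = (1 / \<rho>) *s Z t"
    using adjoint_floquet_solution[OF sysmat_cont sysmat_per Y Y0 YT] by blast
  define z1 z2 z3 where "z1 = (\<lambda>t. Z t $ 1)" and "z2 = (\<lambda>t. Z t $ 2)" and "z3 = (\<lambda>t. Z t $ 3)"
  \<comment> \<open>The third adjoint equation reads z3' = a z2, so a and its derivatives appear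
    when z3 is differentiated three times.\<close>
  define a a' a'' where "a = (\<lambda>t. 1 / (c * (\<phi> t)\<^sup>2))" and "a' = (\<lambda>t. - 2 * deriv \<phi> t / (c * (\<phi> t) ^ 3))"
    and "a'' = (\<lambda>t. 6 * (deriv \<phi> t)\<^sup>2 / (c * (\<phi> t) ^ 4) - 2 * deriv (deriv \<phi>) t / (c * (\<phi> t) ^ 3))"
  define z1' z2' where "z1' = (\<lambda>t. - (of_real (V t) * z2 t) - \<mu> * of_real (\<phi> t) * z3 t)"
    and "z2' = (\<lambda>t. - z1 t - \<mu> / of_real c * z2 t)"
  note Zi = has_vector_derivative_vec_nth[OF Z, unfolded sysmat_transpose_mult]
  have d1: "(z1 has_vector_derivative z1' t) (at t)" for t
    using Zi[of 1 t] by (simp add: vector_3 z1_def z1'_def z2_def z3_def)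
  have d2: "(z2 has_vector_derivative z2' t) (at t)" for t
    using Zi[of 2 t] by (simp add: vector_3 z1_def z2'_def z2_def)
  have d3: "(z3 has_vector_derivative of_real (a t) * z2 t) (at t)" for t
    using Zi[of 3 t] by (simp add: vector_3 a_def z2_def z3_def)
  note \<phi>' = smooth_has_deriv[OF \<phi>] and \<phi>'' = smooth_has_deriv[OF smooth_deriv[OF \<phi>]]
  have a: "(a has_real_derivative a' t) (at t)" for t
    unfolding a_def a'_def using nz[of t] c
    by (auto intro!: derivative_eq_intros \<phi>' simp: field_simps power2_eq_square power3_eq_cube)
  have a': "(a' has_real_derivative a'' t) (at t)" for t
    unfolding a'_def a''_def using nz[of t] c
    by (auto intro!: derivative_eq_intros \<phi>' \<phi>'' simp: divide_simps) (simp add: algebra_simps eval_nat_numeral)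
  define \<psi>2 where "\<psi>2 = (\<lambda>t. of_real (a t) * z2' t + of_real (a' t) * z2 t)"
  define z2'' where "z2'' = (\<lambda>t. - z1' t - \<mu> / of_real c * z2' t)"
  define \<psi>3 where "\<psi>3 = (\<lambda>t. (of_real (a t) * z2'' t + of_real (a' t) * z2' t) + (of_real (a' t) * z2' t + of_real (a'' t) * z2 t))"
  have d4: "((\<lambda>t. of_real (a t) * z2 t) has_vector_derivative \<psi>2 t) (at t)" for t
    unfolding \<psi>2_def by (rule has_vector_derivative_of_real_mult[OF a d2])
  have dz2': "(z2' has_vector_derivative z2'' t) (at t)" for t
    unfolding z2'_def[abs_def] z2''_def
    by (intro has_vector_derivative_diff has_vector_derivative_minus has_vector_derivative_mult_right d1)
      (rule d2[unfolded z2'_def])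
  have d5: "(\<psi>2 has_vector_derivative \<psi>3 t) (at t)" for t
    unfolding \<psi>2_def \<psi>3_def
    by (intro has_vector_derivative_add has_vector_derivative_of_real_mult a a' d2 dz2')
  have z3T: "z3 (t + T) = (1 / \<rho>) * z3 t" for t by (simp add: z3_def ZT)
  \<comment> \<open>The third component determines the others: z3 = 0 forces z2 = 0 and then z1 = 0,
    against \<open>Z0\<close>.\<close>
  have "\<exists>t. z3 t \<noteq> 0"
  proof (rule ccontr)
    assume "\<not> ?thesis"
    then have z3_0: "z3 = (\<lambda>t. 0)" by auto
    have "of_real (a t) * z2 t = 0" for t
      using d3[of t] unfolding z3_0 by (rule vector_derivative_unique_at) auto
    then have z2_0: "z2 = (\<lambda>t. 0)" using nz c by (auto simp: a_def)
    have "z2' t = 0" for t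
      using d2[of t] unfolding z2_0 by (rule vector_derivative_unique_at) auto
    then have "z1 t = 0" for t by (simp add: z2'_def z2_0)
    then have "Z 0 = 0" using z2_0 z3_0 by (simp add: vec_eq_iff forall_3 z1_def z2_def z3_def fun_eq_iff)
    with Z0 show False by simp
  qed
  then obtain t0 where t0: "z3 t0 \<noteq> 0" by blast
  \<comment> \<open>The system is linear with smooth coefficients, so the derivatives of these six
    functions stay in the algebra they generate. Smoothness of z3 makes its cut-off a test
    function.\<close>
  define B where "B = {\<lambda>t. Re (z1 t), \<lambda>t. Im (z1 t), \<lambda>t. Re (z2 t), \<lambda>t. Im (z2 t), \<lambda>t. Re (z3 t), \<lambda>t. Im (z3 t)}"
  have a_smooth: "smooth a" unfolding a_def by (intro smooth_intros \<phi>) (auto simp: nz c)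
  have Bb: "(\<lambda>t. Re (z1 t)) \<in> smooth_alg B" "(\<lambda>t. Im (z1 t)) \<in> smooth_alg B"
    "(\<lambda>t. Re (z2 t)) \<in> smooth_alg B" "(\<lambda>t. Im (z2 t)) \<in> smooth_alg B"
    "(\<lambda>t. Re (z3 t)) \<in> smooth_alg B" "(\<lambda>t. Im (z3 t)) \<in> smooth_alg B"
    by (auto intro!: smooth_alg.base simp: B_def)
  have Bs: "V \<in> smooth_alg B" "\<phi> \<in> smooth_alg B" "a \<in> smooth_alg B" "(\<lambda>t. r) \<in> smooth_alg B" for r
    by (auto intro: smooth_alg.smth V_smooth \<phi> a_smooth smooth_const)
  have Re_der: "((\<lambda>x. Re (h x)) has_real_derivative Re h') (at x)"
    and Im_der: "((\<lambda>x. Im (h x)) has_real_derivative Im h') (at x)"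
    if "(h has_vector_derivative h') (at x)" for h h' x
    using bounded_linear.has_vector_derivative[OF bounded_linear_Re that]
      bounded_linear.has_vector_derivative[OF bounded_linear_Im that]
    by (simp_all add: has_real_derivative_iff_has_vector_derivative)
  define m where "m = \<mu> / of_real c"
  have alg: "(\<lambda>t. Re (z1' t)) \<in> smooth_alg B" "(\<lambda>t. Im (z1' t)) \<in> smooth_alg B"
    "(\<lambda>t. Re (z2' t)) \<in> smooth_alg B" "(\<lambda>t. Im (z2' t)) \<in> smooth_alg B"
    "(\<lambda>t. Re (of_real (a t) * z2 t)) \<in> smooth_alg B" "(\<lambda>t. Im (of_real (a t) * z2 t)) \<in> smooth_alg B"
    unfolding z1'_def z2'_def m_def[symmetric]
      minus_complex.simps uminus_complex.simps times_complex.simps Re_complex_of_real Im_complex_of_real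
    by (intro smooth_alg_diff smooth_alg_minus smooth_alg.add smooth_alg.mult Bb Bs)+
  have ex: "\<exists>f'\<in>smooth_alg B. \<forall>x. ((\<lambda>t. Re (z1 t)) has_real_derivative f' x) (at x)"
    "\<exists>f'\<in>smooth_alg B. \<forall>x. ((\<lambda>t. Im (z1 t)) has_real_derivative f' x) (at x)"
    "\<exists>f'\<in>smooth_alg B. \<forall>x. ((\<lambda>t. Re (z2 t)) has_real_derivative f' x) (at x)"
    "\<exists>f'\<in>smooth_alg B. \<forall>x. ((\<lambda>t. Im (z2 t)) has_real_derivative f' x) (at x)"
    "\<exists>f'\<in>smooth_alg B. \<forall>x. ((\<lambda>t. Re (z3 t)) has_real_derivative f' x) (at x)"
    "\<exists>f'\<in>smooth_alg B. \<forall>x. ((\<lambda>t. Im (z3 t)) has_real_derivative f' x) (at x)"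
    by (rule bexI[OF allI alg(1)], rule Re_der[OF d1], rule bexI[OF allI alg(2)], rule Im_der[OF d1],
      rule bexI[OF allI alg(3)], rule Re_der[OF d2], rule bexI[OF allI alg(4)], rule Im_der[OF d2],
      rule bexI[OF allI alg(5)], rule Re_der[OF d3], rule bexI[OF allI alg(6)], rule Im_der[OF d3])
  have B: "\<exists>f'\<in>smooth_alg B. \<forall>x. (f has_real_derivative f' x) (at x)" if "f \<in> B" for f
  proof -
    have "f = (\<lambda>t. Re (z1 t)) \<or> f = (\<lambda>t. Im (z1 t)) \<or> f = (\<lambda>t. Re (z2 t)) \<or> f = (\<lambda>t. Im (z2 t))
        \<or> f = (\<lambda>t. Re (z3 t)) \<or> f = (\<lambda>t. Im (z3 t))"
      using that by (simp add: B_def)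
    then show ?thesis by (elim disjE) (simp_all only: ex)
  qed
  have s: "smooth (\<lambda>t. Re (z3 t))" "smooth (\<lambda>t. Im (z3 t))"
    using smooth_smooth_alg[OF B Bb(5)] smooth_smooth_alg[OF B Bb(6)] by auto
  show ?thesis
  proof (rule adjoint_floquet_in_spectrum[OF \<phi> pos per T s d3 d4 d5 z3T _ t0])
    show "norm (1 / \<rho>) = 1" using \<rho> by (simp add: norm_divide)
    fix x
    have V: "complex_of_real (V x) = 1 / of_real (\<phi> x) - 2 / of_real c
        - 2 * of_real (deriv (deriv \<phi>) x) / of_real (\<phi> x) + 2 * (of_real (deriv \<phi> x))\<^sup>2 / (of_real (\<phi> x))\<^sup>2"
      by (simp add: V_eq)
    have *: "complex_of_real (\<phi> x) \<noteq> 0" "complex_of_real c \<noteq> 0" using nz c by auto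
    let ?f = "complex_of_real (\<phi> x)" and ?c = "complex_of_real c"
      and ?p = "complex_of_real (deriv \<phi> x)" and ?q = "complex_of_real (deriv (deriv \<phi>) x)"
    have e: "of_real (a x) = 1 / (?c * ?f\<^sup>2)" "of_real (a' x) = - 2 * ?p / (?c * ?f ^ 3)"
      "of_real (a'' x) = 6 * ?p\<^sup>2 / (?c * ?f ^ 4) - 2 * ?q / (?c * ?f ^ 3)"
      by (simp_all add: a_def a'_def a''_def)
    have h: "z2' x = - z1 x - \<mu> / ?c * z2 x" "z1' x = - (of_real (V x) * z2 x) - \<mu> * ?f * z3 x"
      by (simp_all add: z1'_def z2'_def)
    have I: "?c * ?f * (of_real (a'' x) * z2 x + 2 * of_real (a' x) * z2' x
        + of_real (a x) * (- z1' x - \<mu> / ?c * z2' x))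
      + (4 * ?c * ?p + \<mu> * ?f) * (of_real (a' x) * z2 x + of_real (a x) * z2' x)
      + (2 * ?f - ?c + 4 * ?c * ?q + \<mu> * (2 * ?p)) * (of_real (a x) * z2 x) - \<mu> * z3 x = 0"
      unfolding e h by (rule adjoint_scalar_equation[OF * V])
    have "of_real (c * \<phi> x) * \<psi>3 x + (of_real (4 * c * deriv \<phi> x) + \<mu> * of_real (\<phi> x)) * \<psi>2 x
       + (of_real (2 * \<phi> x - c + 4 * c * deriv (deriv \<phi>) x) + \<mu> * of_real (2 * deriv \<phi> x)) * (of_real (a x) * z2 x)
       - \<mu> * z3 x = ?c * ?f * (of_real (a'' x) * z2 x + 2 * of_real (a' x) * z2' x
        + of_real (a x) * (- z1' x - \<mu> / ?c * z2' x))
      + (4 * ?c * ?p + \<mu> * ?f) * (of_real (a' x) * z2 x + of_real (a x) * z2' x)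
      + (2 * ?f - ?c + 4 * ?c * ?q + \<mu> * (2 * ?p)) * (of_real (a x) * z2 x) - \<mu> * z3 x"
      unfolding \<psi>3_def \<psi>2_def z2''_def of_real_mult of_real_add of_real_diff of_real_numeral
      by (simp only: algebra_simps mult_2)
    then show "of_real (c * \<phi> x) * \<psi>3 x + (of_real (4 * c * deriv \<phi> x) + \<mu> * of_real (\<phi> x)) * \<psi>2 x
       + (of_real (2 * \<phi> x - c + 4 * c * deriv (deriv \<phi>) x) + \<mu> * of_real (2 * deriv \<phi> x)) * (of_real (a x) * z2 x)
       - \<mu> * z3 x = 0"
      unfolding I .
  qed
qed

end

section \<open>Long wave perturbation and the Whitham matrix\<close>

lemma det_eq_0_kernel:
  fixes A :: "complex^'n^'n"
  shows "det A = 0 \<longleftrightarrow> (\<exists>b. b \<noteq> 0 \<and> A *v b = 0)"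
  using invertible_det_nz[of A] matrix_left_invertible_ker[of A] invertible_left_inverse[of A] by blast

text \<open>Transfers increment formulas for real antiderivatives to complex solutions whose
  derivative is real: their imaginary part is constant.\<close>

lemma of_real_increment:
  assumes "\<And>X. (\<And>z. (X has_real_derivative f z) (at z)) \<Longrightarrow> X b - X a = r"
    and h: "\<And>z. (h has_vector_derivative complex_of_real (f z)) (at z)"
  shows "h b - h a = of_real r"
proof -
  have "((\<lambda>z. Re (h z)) has_real_derivative f z) (at z)" for z
    using bounded_linear.has_vector_derivative[OF bounded_linear_Re h[of z]]
    by (simp add: has_real_derivative_iff_has_vector_derivative)
  moreover have "((\<lambda>z. Im (h z)) has_real_derivative 0) (at z)" for z
    using bounded_linear.has_vector_derivative[OF bounded_linear_Im h[of z]]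
    by (simp add: has_real_derivative_iff_has_vector_derivative)
  ultimately have "Re (h b) - Re (h a) = r" "Im (h b) = Im (h a)"
    using assms(1)[of "\<lambda>z. Re (h z)"] DERIV_isconst_all[of "\<lambda>z. Im (h z)" b a] by auto
  then show ?thesis by (simp add: complex_eq_iff)
qed

definition exp_quot :: "complex \<Rightarrow> complex" where
  "exp_quot w = (if w = 0 then 1 else (exp w - 1) / w)"

lemma exp_quot_cont: "continuous_on A exp_quot"
proof -
  have "isCont exp_quot w" for w
  proof (cases "w = 0")
    case True
    have "((\<lambda>w::complex. (exp w - 1) / w) \<longlongrightarrow> 1) (at 0)" by (rule lim_exp_minus_1)
    then have "(exp_quot \<longlongrightarrow> 1) (at 0)"
      by (rule Lim_transform_eventually) (auto simp: exp_quot_def eventually_at intro!: exI[of _ 1])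
    then show ?thesis using True by (simp add: isCont_def exp_quot_def)
  next
    case False
    have "isCont (\<lambda>w::complex. (exp w - 1) / w) w" using False by (intro continuous_intros)
    moreover have "\<forall>\<^sub>F x in nhds w. exp_quot x = (exp x - 1) / x"
      using t1_space_nhds[OF False] by eventually_elim (simp add: exp_quot_def)
    ultimately show ?thesis using isCont_cong by fastforce
  qed
  then show ?thesis by (simp add: continuous_at_imp_continuous_on)
qed

abbreviation kronecker :: "3 \<Rightarrow> 3 \<Rightarrow> real" where
  "kronecker i j \<equiv> (if i = j then 1 else 0)"

text \<open>The index j runs over the directions k, M, Q, so the derivatives of k, M, Q themselves
  are Kronecker symbols. \<open>om j\<close> is the variation of ln \<phi>, \<open>cj j\<close> that
  of the speed and \<open>Ej j\<close> that of E; the family enters only through these data at the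
  reference wave.\<close>

locale whitham_data = periodic_wave +
  fixes k M Q :: real and om om1 :: "3 \<Rightarrow> real \<Rightarrow> real" and cj Ej :: "3 \<Rightarrow> real"
  assumes k: "0 < k" and Tk: "T = 1 / k"
    and om: "(om j has_real_derivative om1 j z) (at z)"
    and om1: "(om1 j has_real_derivative (- 1 / \<phi> z + 4 * E / (\<phi> z)\<^sup>2) * om j z
      + cj j / c\<^sup>2 - 2 * Ej j / (\<phi> z)\<^sup>2) (at z)"
    and om1_0: "om1 j 0 = 0" and om_T: "om j T = om j 0"
    and om1_T: "om1 j T = kronecker 1 j * (1 / \<phi> 0 - 1 / c - 2 * E / (\<phi> 0)\<^sup>2) / k\<^sup>2"
    and int_M: "(\<And>z. (X has_real_derivative \<phi> z * om j z) (at z)) \<Longrightarrow>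
      X T - X 0 = kronecker 2 j / k + kronecker 1 j / k\<^sup>2 * (\<phi> 0 - M)"
    and int_Q: "(\<And>z. (X has_real_derivative om j z / \<phi> z - 2 * v1 z * om1 j z) (at z)) \<Longrightarrow>
      X T - X 0 = - (kronecker 3 j / k) - kronecker 1 j / k\<^sup>2 * (1 / \<phi> 0 - Q)"
    and v1_T: "v1 T = 0" and nonconst: "\<exists>z. v1 z \<noteq> 0"
begin

lemma v2_deriv: "(v2 has_real_derivative V z * v1 z) (at z)"
  unfolding v2_def V_def using nz[of z]
  by (auto intro!: derivative_eq_intros \<phi>_deriv simp: field_simps power2_eq_square)

lemma \<phi>_T: "\<phi> T = \<phi> 0" and v2_T: "v2 T = v2 0"
  using per[of 0] by (simp_all add: v2_def)

lemma of_real_vd: "(f has_real_derivative f') (at z) \<Longrightarrow>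
    ((\<lambda>z. complex_of_real (f z)) has_vector_derivative of_real f') (at z)"
  unfolding has_real_derivative_iff_has_vector_derivative
  by (rule bounded_linear.has_vector_derivative[OF bounded_linear_of_real])

lemma zero_solution:
  assumes "\<And>z. (Y has_vector_derivative sysmat 0 z *v Y z) (at z)" "Y 0 = 0"
  shows "Y z = 0"
  using linear_ode_unique[where A = "sysmat 0" and Y = Y and Z = "\<lambda>_. 0" and r = "\<lambda>_. 0" and t = z,
      OF sysmat_cont] assms
  by (simp add: has_vector_derivative_const)

text \<open>The translation mode (v1, v2, 0) solves the system at \<mu> = 0. As v1 vanishes at 0, so
  would the whole mode if v2 did, and the profile would be constant.\<close>

lemma v2_0: "v2 0 \<noteq> 0"
proof
  assume v20: "v2 0 = 0"
  define Y :: "real \<Rightarrow> complex^3" where "Y = (\<lambda>z. vector [of_real (v1 z), of_real (v2 z), 0])"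
  have "(Y has_vector_derivative sysmat 0 z *v Y z) (at z)" for z
  proof -
    have "(Y has_vector_derivative vector [of_real (v2 z), of_real (V z * v1 z), 0]) (at z)"
      unfolding Y_def
      by (intro has_vector_derivative_vector3 of_real_vd v2_deriv has_vector_derivative_const)
        (simp add: v2_def v1)
    then show ?thesis by (simp add: sysmat_mult Y_def vector_3)
  qed
  moreover have "Y 0 = 0" by (simp add: Y_def v1_0 v20 vec_eq_iff forall_3 vector_3)
  ultimately have "Y z = 0" for z by (rule zero_solution)
  then have "v1 z = 0" for z by (simp add: Y_def vec_eq_iff forall_3 vector_3)
  then show False using nonconst by blast
qed

text \<open>The \<mu>-coefficient \<open>sysmat1\<close> of the system applied to the variation (om,
  om1): the residual of order \<mu> left by the leading part of the long wave.\<close>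

definition src :: "3 \<Rightarrow> real \<Rightarrow> complex^3" where
  "src j z = vector [0, of_real (om1 j z / c), of_real (\<phi> z * om j z)]"

lemma om_cont: "continuous_on A (om j)" and om1_cont: "continuous_on A (om1 j)"
  by (rule continuous_at_imp_continuous_on, blast intro: DERIV_isCont om om1)+

lemma src_cont: "continuous_on A (src j)"
  unfolding src_def[abs_def]
  by (intro continuous_on_vector3 continuous_intros om_cont om1_cont smooth_continuous \<phi>) (auto simp: c)

text \<open>An exact solution for each \<mu> rather than a Taylor coefficient. The fixed initial
  value 0 makes it entire in \<mu> and keeps the waves explicit at z = 0.\<close>

definition corr :: "3 \<Rightarrow> complex \<Rightarrow> real \<Rightarrow> complex^3" where
  "corr j \<mu> = (SOME Y. Y 0 = 0 \<and> (\<forall>z. (Y has_vector_derivative sysmat \<mu> z *v Y z + src j z) (at z)))"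

lemma corr_0: "corr j \<mu> 0 = 0"
  and corr: "(corr j \<mu> has_vector_derivative sysmat \<mu> z *v corr j \<mu> z + src j z) (at z)"
proof -
  have "\<exists>Y. Y 0 = 0 \<and> (\<forall>z. (Y has_vector_derivative sysmat \<mu> z *v Y z + src j z) (at z))"
    using linear_ode_exists[OF sysmat_cont src_cont, of 0] by metis
  from someI_ex[OF this, folded corr_def]
  show "corr j \<mu> 0 = 0" "(corr j \<mu> has_vector_derivative sysmat \<mu> z *v corr j \<mu> z + src j z) (at z)"
    by auto
qed

definition sysmat1 :: "real \<Rightarrow> complex^3^3" where
  "sysmat1 z = vector [vector [0, 0, 0], vector [0, 1 / of_real c, 0], vector [of_real (\<phi> z), 0, 0]]"

lemma sysmat1_cont: "continuous_on A sysmat1"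
  unfolding sysmat1_def[abs_def]
  by (intro continuous_on_vector3 continuous_intros smooth_continuous \<phi>)

lemma sysmat1_mult: "sysmat1 z *v y = vector [0, y $ 2 / of_real c, of_real (\<phi> z) * y $ 1]"
  by (simp add: vec_eq_iff forall_3 vector_3 matrix_vector_mult_def sum_3 sysmat1_def)

lemma sysmat_split: "sysmat \<mu> z *v y = sysmat 0 z *v y + \<mu> *s (sysmat1 z *v y)"
  by (simp add: sysmat_mult sysmat1_mult vec_eq_iff forall_3 vector_3)

lemma corr_hol: "(\<lambda>\<mu>. corr j \<mu> T $ i) holomorphic_on UNIV"
proof (rule linear_ode_holomorphic[OF sysmat_cont[of _ 0] sysmat1_cont])
  show "(corr j a has_vector_derivative
      sysmat 0 t *v corr j a t + a *s (sysmat1 t *v corr j a t) + src j t) (at t)" for a t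
    using corr[of j a t] unfolding sysmat_split[of a] .
qed (use T corr_0 in auto)

text \<open>At \<mu> = 0 the third row of the system consists of the source \<phi> om alone, so
  \<open>int_M\<close> applies.\<close>

lemma corr_M: "corr j 0 T $ 3 = of_real (kronecker 2 j / k + kronecker 1 j / k\<^sup>2 * (\<phi> 0 - M))"
proof -
  have "((\<lambda>t. corr j 0 t $ 3) has_vector_derivative of_real (\<phi> z * om j z)) (at z)" for z
    using has_vector_derivative_vec_nth[OF corr[of j 0 z], of 3]
    by (simp add: sysmat_mult src_def vector_3)
  then have "corr j 0 T $ 3 - corr j 0 0 $ 3 = of_real (kronecker 2 j / k + kronecker 1 j / k\<^sup>2 * (\<phi> 0 - M))"
    by (rule of_real_increment[where f = "\<lambda>z. \<phi> z * om j z" and h = "\<lambda>t. corr j 0 t $ 3", rotated]) (rule int_M)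
  then show ?thesis by (simp only: corr_0 zero_index diff_zero)
qed

text \<open>The vector (2 c v2, - 2 c v1, 1/\<phi>^2) solves the adjoint system at \<mu> = 0. Its
  pairing with \<open>corr j 0\<close> therefore changes only through the source, which contributes
  exactly the integrand of \<open>int_Q\<close>.\<close>

lemma corr_Q: "corr j 0 T $ 3 / of_real ((\<phi> 0)\<^sup>2) + of_real (2 * c * v2 0) * corr j 0 T $ 1
  = of_real (- (kronecker 3 j / k) - kronecker 1 j / k\<^sup>2 * (1 / \<phi> 0 - Q))"
proof -
  let ?h = "\<lambda>i t. corr j 0 t $ i"
  define X where "X = (\<lambda>t. of_real (1 / (\<phi> t)\<^sup>2) * ?h 3 t + of_real (2 * c * v2 t) * ?h 1 t
    - of_real (2 * c * v1 t) * ?h 2 t)"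
  have d: "(?h 1 has_vector_derivative ?h 2 z) (at z)"
    "(?h 2 has_vector_derivative of_real (V z) * ?h 1 z - of_real (1 / (c * (\<phi> z)\<^sup>2)) * ?h 3 z + of_real (om1 j z / c)) (at z)"
    "(?h 3 has_vector_derivative of_real (\<phi> z * om j z)) (at z)" for z
    using has_vector_derivative_vec_nth[OF corr[of j 0 z], of 1]
      has_vector_derivative_vec_nth[OF corr[of j 0 z], of 2]
      has_vector_derivative_vec_nth[OF corr[of j 0 z], of 3]
    by (simp_all add: sysmat_mult src_def vector_3)
  have "(X has_vector_derivative of_real (om j z / \<phi> z - 2 * v1 z * om1 j z)) (at z)" for z
  proof -
    have p: "((\<lambda>t. 1 / (\<phi> t)\<^sup>2) has_real_derivative - (2 * v1 z / (\<phi> z)\<^sup>2)) (at z)"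
      using nz[of z] by (auto intro!: derivative_eq_intros \<phi>_deriv simp: field_simps power2_eq_square)
    have "(X has_vector_derivative
      (of_real (1 / (\<phi> z)\<^sup>2) * of_real (\<phi> z * om j z) + of_real (- (2 * v1 z / (\<phi> z)\<^sup>2)) * ?h 3 z)
      + (of_real (2 * c * v2 z) * ?h 2 z + of_real (2 * c * (V z * v1 z)) * ?h 1 z)
      - (of_real (2 * c * v1 z) * (of_real (V z) * ?h 1 z - of_real (1 / (c * (\<phi> z)\<^sup>2)) * ?h 3 z + of_real (om1 j z / c))
         + of_real (2 * c * v2 z) * ?h 2 z)) (at z)"
      unfolding X_def
      by (intro has_vector_derivative_diff has_vector_derivative_add has_vector_derivative_of_real_mult d p
          DERIV_cmult v2_deriv) (use v1[of z] in \<open>simp add: v2_def\<close>)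
    then show ?thesis
      by (rule has_vector_derivative_eq_rhs)
        (use nz[of z] c in \<open>simp add: field_simps power2_eq_square\<close>)
  qed
  then have "X T - X 0 = of_real (- (kronecker 3 j / k) - kronecker 1 j / k\<^sup>2 * (1 / \<phi> 0 - Q))"
    by (rule of_real_increment[where f = "\<lambda>z. om j z / \<phi> z - 2 * v1 z * om1 j z" and h = X, rotated]) (rule int_Q)
  moreover have "X 0 = 0" by (simp add: X_def corr_0)
  moreover have "X T = corr j 0 T $ 3 / of_real ((\<phi> 0)\<^sup>2) + of_real (2 * c * v2 0) * corr j 0 T $ 1"
    by (simp add: X_def \<phi>_T v2_T v1_T)
  ultimately show ?thesis by simp
qed

text \<open>The third component of the leading part, forced by the second row of the system: it
  balances the inhomogeneity in the equation for om and the term cj v2 / c caused by the translation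
  mode.\<close>

definition "W j z = 2 * (cj j * E + c * Ej j) - cj j * \<phi> z"

text \<open>Formally A maps the parameter derivative of the profile to - cj times \<phi>'. This
  Jordan chain over the translation mode is the origin of the factor 1/\<mu>.\<close>

definition wave :: "3 \<Rightarrow> complex \<Rightarrow> real \<Rightarrow> complex^3" where
  "wave j \<mu> z = vector [of_real (om j z) - of_real (cj j) / \<mu> * of_real (v1 z),
    of_real (om1 j z) - of_real (cj j) / \<mu> * of_real (v2 z), of_real (W j z)] + \<mu> *s corr j \<mu> z"

text \<open>Order 1/\<mu> cancels because the translation mode solves the system at \<mu> = 0, order
  1 by the choice of W, and the whole remainder because \<open>corr\<close> has the source
  \<open>src\<close>.\<close>

lemma wave_deriv:
  assumes "\<mu> \<noteq> 0"
  shows "(wave j \<mu> has_vector_derivative sysmat \<mu> z *v wave j \<mu> z) (at z)"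
proof -
  let ?m = "of_real (cj j) / \<mu> :: complex"
  have W: "(W j has_real_derivative - (cj j * (\<phi> z * v1 z))) (at z)"
    unfolding W_def[abs_def] by (auto intro!: derivative_eq_intros \<phi>_deriv)
  have "(wave j \<mu> has_vector_derivative vector [of_real (om1 j z) - ?m * of_real (v2 z),
      of_real (V z * om j z + cj j / c\<^sup>2 - 2 * Ej j / (\<phi> z)\<^sup>2) - ?m * of_real (V z * v1 z),
      of_real (- (cj j * (\<phi> z * v1 z)))] + \<mu> *s (sysmat \<mu> z *v corr j \<mu> z + src j z)) (at z)"
    unfolding wave_def[abs_def]
    by (intro has_vector_derivative_add has_vector_derivative_vector3 has_vector_derivative_diff
        has_vector_derivative_mult_right of_real_vd om W v2_deriv corr
        bounded_linear.has_vector_derivative[OF bounded_linear_vector_smult])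
      (use v1[of z] om1[of j z] in \<open>simp_all add: v2_def V_def\<close>)
  moreover have "vector [of_real (om1 j z) - ?m * of_real (v2 z),
      of_real (V z * om j z + cj j / c\<^sup>2 - 2 * Ej j / (\<phi> z)\<^sup>2) - ?m * of_real (V z * v1 z),
      of_real (- (cj j * (\<phi> z * v1 z)))] + \<mu> *s (sysmat \<mu> z *v corr j \<mu> z + src j z)
     = sysmat \<mu> z *v wave j \<mu> z"
  proof -
    have "complex_of_real (cj j / c\<^sup>2 - 2 * Ej j / (\<phi> z)\<^sup>2) + of_real (cj j / c * v2 z)
        = - of_real (1 / (c * (\<phi> z)\<^sup>2) * W j z)"
    proof -
      have "cj j / c\<^sup>2 - 2 * Ej j / (\<phi> z)\<^sup>2 + cj j / c * v2 z = - (1 / (c * (\<phi> z)\<^sup>2) * W j z)"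
        unfolding W_def v2_def using nz[of z] c by (simp add: field_simps power2_eq_square)
      then show ?thesis by (metis of_real_add of_real_minus)
    qed
    then show ?thesis
      using assms nz[of z] c
      by (simp add: sysmat_mult wave_def src_def vec_eq_iff forall_3 vector_3 algebra_simps)
  qed
  ultimately show ?thesis by simp
qed

definition "H\<^sub>0 = 1 / \<phi> 0 + ln (\<phi> 0) / c - E / (\<phi> 0)\<^sup>2"
definition "Hj j = - (om j 0 / \<phi> 0) + om j 0 / c - cj j * ln (\<phi> 0) / c\<^sup>2 - Ej j / (\<phi> 0)\<^sup>2
  + 2 * E * om j 0 / (\<phi> 0)\<^sup>2"

text \<open>The value on the wave at 0 of the functional Y3 / \<phi>^2 + 2 c (v2 Y1 - v1 Y2) from
  \<open>corr_Q\<close>; the part of order 1/\<mu> drops out, as v2 v1 - v1 v2 = 0.\<close>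

definition "K j = W j 0 / (\<phi> 0)\<^sup>2 + 2 * c * v2 0 * om j 0"

lemma K_eq: "K j = cj j / \<phi> 0 - 2 * (cj j * H\<^sub>0 + c * Hj j)"
  unfolding K_def W_def Hj_def H\<^sub>0_def v2_def using nz[of 0] c
  by (simp add: field_simps power2_eq_square)

text \<open>The continuous extension of (\<rho> - 1)/\<xi> to \<xi> = 0, which lets the boundary
  conditions be divided by \<xi>.\<close>

definition R :: "real \<Rightarrow> complex" where
  "R \<xi> = \<i> * of_real T * exp_quot (\<i> * of_real (\<xi> * T))"

lemma R_eq: "\<xi> \<noteq> 0 \<Longrightarrow> of_real \<xi> * R \<xi> = exp (\<i> * of_real (\<xi> * T)) - 1"
  using T by (simp add: R_def exp_quot_def)

lemma R_0: "R 0 = \<i> * of_real T"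
  by (simp add: R_def exp_quot_def)

lemma R_cont: "continuous_on A R"
  unfolding R_def[abs_def]
  by (intro continuous_intros continuous_on_compose2[OF exp_quot_cont[of UNIV]]) auto

text \<open>The rows express that \<open>Y2\<close>, \<open>Y3\<close> and \<open>Y3 / \<phi>\<^sup>2 + 2 c (v2 Y1 - v1 Y2)\<close> are multiplied by
  \<open>\<rho> = exp (\<i> \<xi> T)\<close> over one period, the last two divided by \<open>\<xi>\<close>; here \<open>\<mu> = \<xi> \<Lambda>\<close>. The latter two
  functionals come from the conservation laws of \<open>M\<close> and \<open>Q\<close>.\<close>

definition bnd :: "complex \<Rightarrow> real \<Rightarrow> 3 \<Rightarrow> 3 \<Rightarrow> complex" where
  "bnd \<Lambda> \<xi> i j = (let h = corr j (of_real \<xi> * \<Lambda>) T in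
    if i = 1 then of_real (cj j * v2 0) / \<Lambda> * R \<xi> + of_real (om1 j T) + of_real \<xi> * \<Lambda> * h $ 2
    else if i = 2 then \<Lambda> * h $ 3 - of_real (W j 0) * R \<xi>
    else \<Lambda> * (h $ 3 / of_real ((\<phi> 0)\<^sup>2) + of_real (2 * c * v2 0) * h $ 1) - of_real (K j) * R \<xi>)"

definition "bndmat \<Lambda> \<xi> = (\<chi> i j. bnd \<Lambda> \<xi> i j)"

lemma wave_0: "wave j \<mu> 0 = vector [of_real (om j 0), - (of_real (cj j) / \<mu> * of_real (v2 0)), of_real (W j 0)]"
  by (simp add: wave_def v1_0 om1_0 corr_0 vec_eq_iff forall_3 vector_3)

lemma wave_T: "wave j \<mu> T = vector [of_real (om j 0) + \<mu> * corr j \<mu> T $ 1,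
    of_real (om1 j T) - of_real (cj j) / \<mu> * of_real (v2 0) + \<mu> * corr j \<mu> T $ 2,
    of_real (W j 0) + \<mu> * corr j \<mu> T $ 3]"
  by (simp add: wave_def v1_T om_T v2_T W_def \<phi>_T vec_eq_iff forall_3 vector_3)

text \<open>\<open>d j\<close> is the defect of the Floquet condition. In the second and third
  functional the leading part takes the same value at both ends and contributes a multiple of 1 -
  \<rho>; the correction carries the factor \<mu>. Hence both are divisible by \<xi>.\<close>

lemma bnd_wave:
  assumes \<xi>: "\<xi> \<noteq> 0" and \<Lambda>: "\<Lambda> \<noteq> 0"
  defines "\<rho> \<equiv> exp (\<i> * of_real (\<xi> * T))" and "\<mu> \<equiv> of_real \<xi> * \<Lambda>"
  defines "d \<equiv> \<lambda>j. wave j \<mu> T - \<rho> *s wave j \<mu> 0"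
  shows "bnd \<Lambda> \<xi> 1 j = d j $ 2" "of_real \<xi> * bnd \<Lambda> \<xi> 2 j = d j $ 3"
    "of_real \<xi> * bnd \<Lambda> \<xi> 3 j = d j $ 3 / of_real ((\<phi> 0)\<^sup>2) + of_real (2 * c * v2 0) * d j $ 1"
proof -
  have \<rho>: "\<rho> = 1 + of_real \<xi> * R \<xi>" using R_eq[OF \<xi>] by (simp add: \<rho>_def)
  have cx: "complex_of_real \<xi> \<noteq> 0" "complex_of_real (\<phi> 0) \<noteq> 0" using \<xi> nz by auto
  show "bnd \<Lambda> \<xi> 1 j = d j $ 2"
    using cx \<Lambda> by (simp add: bnd_def d_def wave_0 wave_T vector_3 \<rho> \<mu>_def Let_def field_simps)
  show "of_real \<xi> * bnd \<Lambda> \<xi> 2 j = d j $ 3"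
    by (simp add: bnd_def d_def wave_0 wave_T vector_3 \<rho> \<mu>_def Let_def algebra_simps)
  show "of_real \<xi> * bnd \<Lambda> \<xi> 3 j = d j $ 3 / of_real ((\<phi> 0)\<^sup>2) + of_real (2 * c * v2 0) * d j $ 1"
    using cx by (simp add: bnd_def d_def wave_0 wave_T vector_3 \<rho> \<mu>_def K_def Let_def field_simps)
qed

text \<open>Independence of the waves reflects that k, M, Q are coordinates. A vanishing combination
  has zero speed derivative, zero derivative of E and zero Cauchy data, so the combined variation
  vanishes identically. Then the end value of om1 detects the k-component, and \<open>corr_M\<close>
  and \<open>corr_Q\<close> detect the other two.\<close>

lemma combination_0:
  assumes "\<mu> \<noteq> 0" and z: "(\<Sum>j\<in>UNIV. b $ j *s wave j \<mu> 0) = 0"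
  shows "b = 0"
proof -
  have z': "(\<Sum>j\<in>UNIV. b $ j * wave j \<mu> 0 $ i) = 0" for i
    using arg_cong[OF z, of "\<lambda>x. x $ i"] by simp
  have s1: "(\<Sum>j\<in>UNIV. b $ j * of_real (om j 0)) = 0"
    using z'[of 1] by (simp add: wave_0 vector_3)
  have "(\<Sum>j\<in>UNIV. b $ j * of_real (cj j)) * (- (of_real (v2 0) / \<mu>))
      = (\<Sum>j\<in>UNIV. b $ j * wave j \<mu> 0 $ 2)"
    unfolding sum_distrib_right by (intro sum.cong) (simp_all add: wave_0 vector_3)
  then have "(\<Sum>j\<in>UNIV. b $ j * of_real (cj j)) * (- (of_real (v2 0) / \<mu>)) = 0"
    by (simp only: z')
  then have s2: "(\<Sum>j\<in>UNIV. b $ j * of_real (cj j)) = 0"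
    using v2_0 assms(1) by simp
  have "(\<Sum>j\<in>UNIV. b $ j * of_real (W j 0)) = 0"
    using z'[of 3] by (simp add: wave_0 vector_3)
  moreover have "(\<Sum>j\<in>UNIV. b $ j * of_real (W j 0)) = (2 * of_real E - of_real (\<phi> 0)) * (\<Sum>j\<in>UNIV. b $ j * of_real (cj j))
      + 2 * of_real c * (\<Sum>j\<in>UNIV. b $ j * of_real (Ej j))"
    by (simp add: W_def sum_3 algebra_simps)
  ultimately have s3: "(\<Sum>j\<in>UNIV. b $ j * of_real (Ej j)) = 0"
    using s2 c by simp
  define Y :: "real \<Rightarrow> complex^3" where
    "Y = (\<lambda>z. vector [\<Sum>j\<in>UNIV. b $ j * of_real (om j z), \<Sum>j\<in>UNIV. b $ j * of_real (om1 j z), 0])"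
  have "(Y has_vector_derivative sysmat 0 z *v Y z) (at z)" for z
  proof -
    have om1': "(om1 j has_real_derivative V z * om j z + cj j / c\<^sup>2 - 2 * Ej j / (\<phi> z)\<^sup>2) (at z)" for j
      unfolding V_def by (rule om1)
    have "(Y has_vector_derivative vector [\<Sum>j\<in>UNIV. b $ j * of_real (om1 j z),
      \<Sum>j\<in>UNIV. b $ j * of_real (V z * om j z + cj j / c\<^sup>2 - 2 * Ej j / (\<phi> z)\<^sup>2), 0]) (at z)"
      unfolding Y_def
      by (intro has_vector_derivative_vector3 has_vector_derivative_sum has_vector_derivative_mult_right
          of_real_vd om om1' has_vector_derivative_const)
    moreover have "(\<Sum>j\<in>UNIV. b $ j * of_real (V z * om j z + cj j / c\<^sup>2 - 2 * Ej j / (\<phi> z)\<^sup>2))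
        = of_real (V z) * (\<Sum>j\<in>UNIV. b $ j * of_real (om j z))
          + (\<Sum>j\<in>UNIV. b $ j * of_real (cj j)) / of_real (c\<^sup>2)
          - 2 * (\<Sum>j\<in>UNIV. b $ j * of_real (Ej j)) / of_real ((\<phi> z)\<^sup>2)"
      by (simp only: sum_3 of_real_add of_real_diff of_real_mult of_real_divide of_real_numeral
          add_divide_distrib distrib_left right_diff_distrib) (simp add: algebra_simps add_divide_distrib)
    ultimately show ?thesis
      by (simp add: s2 s3 sysmat_mult Y_def vector_3)
  qed
  moreover have "Y 0 = 0"
    by (simp add: Y_def s1 om1_0 vec_eq_iff forall_3 vector_3)
  ultimately have Y: "Y z = 0" for z by (rule zero_solution)
  have om_s: "(\<Sum>j\<in>UNIV. b $ j * of_real (om j z)) = 0" and om1_s: "(\<Sum>j\<in>UNIV. b $ j * of_real (om1 j z)) = 0" for z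
    using Y[of z] by (simp_all add: Y_def vec_eq_iff forall_3 vector_3)
  have "om1 j T = kronecker 1 j * v2 0 / k\<^sup>2" for j by (simp add: om1_T v2_def)
  then have b1: "b $ 1 = 0"
    using om1_s[of T] v2_0 k by (simp add: sum_3)
  have src_s: "(\<Sum>j\<in>UNIV. b $ j *s src j z) = 0" for z
  proof -
    have "(\<Sum>j\<in>UNIV. b $ j *s src j z) = vector [0, (\<Sum>j\<in>UNIV. b $ j * of_real (om1 j z)) / of_real c,
        of_real (\<phi> z) * (\<Sum>j\<in>UNIV. b $ j * of_real (om j z))]"
      by (simp add: vec_eq_iff forall_3 vector_3 src_def sum_3 add_divide_distrib algebra_simps)
    then show ?thesis by (simp add: om_s om1_s vec_eq_iff forall_3 vector_3)
  qed
  have "(\<Sum>j\<in>UNIV. b $ j *s corr j 0 T) = 0"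
  proof (rule zero_solution[of "\<lambda>z. \<Sum>j\<in>UNIV. b $ j *s corr j 0 z"])
    fix z
    have "((\<lambda>z. \<Sum>j\<in>UNIV. b $ j *s corr j 0 z) has_vector_derivative
        (\<Sum>j\<in>UNIV. b $ j *s (sysmat 0 z *v corr j 0 z + src j z))) (at z)"
      by (intro has_vector_derivative_sum bounded_linear.has_vector_derivative[OF bounded_linear_vector_smult] corr)
    also have "(\<Sum>j\<in>UNIV. b $ j *s (sysmat 0 z *v corr j 0 z + src j z))
        = sysmat 0 z *v (\<Sum>j\<in>UNIV. b $ j *s corr j 0 z) + (\<Sum>j\<in>UNIV. b $ j *s src j z)"
      by (simp add: vec.sum matrix_vector_mult_smult vector_add_ldistrib sum.distrib)
    finally show "((\<lambda>z. \<Sum>j\<in>UNIV. b $ j *s corr j 0 z) has_vector_derivative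
        sysmat 0 z *v (\<Sum>j\<in>UNIV. b $ j *s corr j 0 z)) (at z)"
      by (simp add: src_s)
  qed (simp add: corr_0)
  then have "(\<Sum>j\<in>UNIV. b $ j *s corr j 0 T) $ i = 0" for i by (simp only: zero_index)
  then have t: "(\<Sum>j\<in>UNIV. b $ j * corr j 0 T $ i) = 0" for i by simp
  have b2: "b $ 2 = 0"
    using t[of 3] b1 k unfolding corr_M by (simp add: sum_3)
  have "(\<Sum>j\<in>UNIV. b $ j * (corr j 0 T $ 3 / of_real ((\<phi> 0)\<^sup>2) + of_real (2 * c * v2 0) * corr j 0 T $ 1))
      = (\<Sum>j\<in>UNIV. b $ j * corr j 0 T $ 3) / of_real ((\<phi> 0)\<^sup>2)
        + of_real (2 * c * v2 0) * (\<Sum>j\<in>UNIV. b $ j * corr j 0 T $ 1)"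
    by (simp add: sum_3 add_divide_distrib algebra_simps)
  then have "(\<Sum>j\<in>UNIV. b $ j * (corr j 0 T $ 3 / of_real ((\<phi> 0)\<^sup>2) + of_real (2 * c * v2 0) * corr j 0 T $ 1)) = 0"
    by (simp only: t) simp
  then have "b $ 3 = 0"
    unfolding corr_Q using b1 b2 k by (simp add: sum_3)
  with b1 b2 show ?thesis by (simp add: vec_eq_iff forall_3)
qed

text \<open>A kernel vector combines the waves into a solution with multiplier \<rho>, nonzero by
  \<open>combination_0\<close>. The third row recovers the first component of the Floquet condition
  because \<open>v2 0\<close> does not vanish.\<close>

lemma bndmat_singular_imp_spectrum:
  assumes \<xi>: "\<xi> \<noteq> 0" and \<Lambda>: "\<Lambda> \<noteq> 0" and sing: "det (bndmat \<Lambda> \<xi>) = 0"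
  shows "of_real \<xi> * \<Lambda> \<in> L2_spectrum (A_graph c \<phi>)"
proof -
  define \<rho> where "\<rho> = exp (\<i> * of_real (\<xi> * T))"
  define \<mu> where "\<mu> = of_real \<xi> * \<Lambda>"
  have \<mu>: "\<mu> \<noteq> 0" using \<xi> \<Lambda> by (simp add: \<mu>_def)
  obtain b where b: "b \<noteq> 0" "bndmat \<Lambda> \<xi> *v b = 0" using sing by (auto simp: det_eq_0_kernel)
  define d where "d = (\<lambda>j. wave j \<mu> T - \<rho> *s wave j \<mu> 0)"
  note bw = bnd_wave[OF \<xi> \<Lambda>, folded \<rho>_def \<mu>_def]
  have row: "(\<Sum>j\<in>UNIV. bnd \<Lambda> \<xi> i j * b $ j) = 0" for i
    using arg_cong[OF b(2), of "\<lambda>x. x $ i"] by (simp add: bndmat_def matrix_vector_mult_def)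
  have d2: "(\<Sum>j\<in>UNIV. b $ j * d j $ 2) = 0"
    using row[of 1] bw(1) by (simp add: d_def mult.commute)
  have "(\<Sum>j\<in>UNIV. b $ j * (of_real \<xi> * bnd \<Lambda> \<xi> i j)) = of_real \<xi> * (\<Sum>j\<in>UNIV. bnd \<Lambda> \<xi> i j * b $ j)" for i
    by (simp add: sum_distrib_left mult_ac)
  then have row': "(\<Sum>j\<in>UNIV. b $ j * (of_real \<xi> * bnd \<Lambda> \<xi> i j)) = 0" for i by (simp add: row)
  have d3: "(\<Sum>j\<in>UNIV. b $ j * d j $ 3) = 0"
    using row'[of 2] by (simp only: bw(2) d_def)
  have "(\<Sum>j\<in>UNIV. b $ j * (d j $ 3 / of_real ((\<phi> 0)\<^sup>2) + of_real (2 * c * v2 0) * d j $ 1)) = 0"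
    using row'[of 3] by (simp only: bw(3) d_def)
  moreover have "(\<Sum>j\<in>UNIV. b $ j * (d j $ 3 / of_real ((\<phi> 0)\<^sup>2) + of_real (2 * c * v2 0) * d j $ 1))
     = (\<Sum>j\<in>UNIV. b $ j * d j $ 3) / of_real ((\<phi> 0)\<^sup>2) + of_real (2 * c * v2 0) * (\<Sum>j\<in>UNIV. b $ j * d j $ 1)"
    by (simp add: sum_3 add_divide_distrib algebra_simps)
  ultimately have d1: "(\<Sum>j\<in>UNIV. b $ j * d j $ 1) = 0"
    using d3 c v2_0 by simp
  have d: "(\<Sum>j\<in>UNIV. b $ j *s d j) = 0"
    using d1 d2 d3 by (simp add: vec_eq_iff forall_3)
  define Y where "Y = (\<lambda>z. \<Sum>j\<in>UNIV. b $ j *s wave j \<mu> z)"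
  have "(\<Sum>j\<in>UNIV. b $ j *s d j) = Y T - \<rho> *s Y 0"
    by (simp add: Y_def d_def sum_3 vec_eq_iff algebra_simps)
  with d have YT: "Y T = \<rho> *s Y 0" by simp
  have Y0: "Y 0 \<noteq> 0" using combination_0[OF \<mu>, of b] b(1) by (auto simp: Y_def)
  have Y: "(Y has_vector_derivative sysmat \<mu> z *v Y z) (at z)" for z
  proof -
    have "(Y has_vector_derivative (\<Sum>j\<in>UNIV. b $ j *s (sysmat \<mu> z *v wave j \<mu> z))) (at z)"
      unfolding Y_def
      by (intro has_vector_derivative_sum bounded_linear.has_vector_derivative[OF bounded_linear_vector_smult]
          wave_deriv \<mu>)
    also have "(\<Sum>j\<in>UNIV. b $ j *s (sysmat \<mu> z *v wave j \<mu> z)) = sysmat \<mu> z *v Y z"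
      by (simp add: Y_def vec.sum matrix_vector_mult_smult)
    finally show ?thesis .
  qed
  have "norm \<rho> = 1" by (simp add: \<rho>_def norm_exp_eq_Re)
  from floquet_in_spectrum[OF Y YT Y0 this] show ?thesis by (simp add: \<mu>_def)
qed

text \<open>The Whitham matrix plus c times the identity, in terms of the variational data; the
  shift is the passage to the moving frame.\<close>

definition shifted :: "real^3^3" where
  "shifted = (\<chi> i j. if i = 1 then - (k * cj j) else if i = 2 then 2 * (cj j * E + c * Ej j) - M * cj j
    else 2 * (cj j * H\<^sub>0 + c * Hj j) - Q * cj j)"

definition P :: "complex \<Rightarrow> 3 \<Rightarrow> 3 \<Rightarrow> complex" where
  "P \<Lambda> i j = of_real (shifted $ i $ j) + \<i> * \<Lambda> * of_real (kronecker i j)"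

text \<open>The limit matrix is a lower triangular matrix times \<open>P \<Lambda>\<close>.
  Multiples of the first row enter the others through the secular contributions of k to
  \<open>corr_M\<close> and \<open>corr_Q\<close>.\<close>

lemma bnd_limit:
  assumes "\<Lambda> \<noteq> 0"
  shows "bnd \<Lambda> 0 1 j = - (\<i> * of_real (v2 0 / k\<^sup>2) / \<Lambda>) * P \<Lambda> 1 j"
    "bnd \<Lambda> 0 2 j = - (\<i> / of_real k) * (P \<Lambda> 2 j + of_real ((\<phi> 0 - M) / k) * P \<Lambda> 1 j)"
    "bnd \<Lambda> 0 3 j = (\<i> / of_real k) * (P \<Lambda> 3 j + of_real ((1 / \<phi> 0 - Q) / k) * P \<Lambda> 1 j)"
proof -
  have k0: "complex_of_real k \<noteq> 0" using k by simp
  have RT: "R 0 = \<i> / of_real k" unfolding R_0 by (simp add: Tk)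
  have o: "om1 j T = kronecker 1 j * v2 0 / k\<^sup>2" by (simp add: om1_T v2_def)
  show "bnd \<Lambda> 0 1 j = - (\<i> * of_real (v2 0 / k\<^sup>2) / \<Lambda>) * P \<Lambda> 1 j"
    using k0 assms
    by (simp add: bnd_def RT P_def shifted_def o field_simps power2_eq_square)
  show "bnd \<Lambda> 0 2 j = - (\<i> / of_real k) * (P \<Lambda> 2 j + of_real ((\<phi> 0 - M) / k) * P \<Lambda> 1 j)"
    using k0
    by (simp add: bnd_def RT P_def shifted_def corr_M W_def field_simps power2_eq_square)
  have h: "corr j 0 T $ 3 / (complex_of_real (\<phi> 0))\<^sup>2 + 2 * of_real c * of_real (v2 0) * corr j 0 T $ 1
      = of_real (- (kronecker 3 j / k) - kronecker 1 j / k\<^sup>2 * (1 / \<phi> 0 - Q))"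
    using corr_Q[of j] by simp
  show "bnd \<Lambda> 0 3 j = (\<i> / of_real k) * (P \<Lambda> 3 j + of_real ((1 / \<phi> 0 - Q) / k) * P \<Lambda> 1 j)"
    using k0 nz[of 0]
    by (simp add: bnd_def RT P_def shifted_def h K_eq) (simp add: field_simps power2_eq_square)
qed

text \<open>The triangular factor of \<open>bnd_limit\<close> is invertible because
  \<open>v2 0\<close>, k and \<Lambda> are suitable nonzero numbers, so only the kernel of
  \<open>P \<Lambda>\<close> remains.\<close>

lemma bndmat_0_kernel:
  assumes \<Lambda>: "\<Lambda> \<noteq> 0"
  shows "bndmat \<Lambda> 0 *v b = 0 \<longleftrightarrow> (\<chi> i j. of_real (shifted $ i $ j)) *v b = (- \<i> * \<Lambda>) *s b"
proof -
  define p where "p = (\<lambda>i. \<Sum>j\<in>UNIV. P \<Lambda> i j * b $ j)"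
  have 1: "(bndmat \<Lambda> 0 *v b) $ 1 = - (\<i> * of_real (v2 0 / k\<^sup>2) / \<Lambda>) * p 1"
    unfolding p_def sum_distrib_left
    by (simp only: matrix_vector_mult_def bndmat_def vec_lambda_beta bnd_limit[OF \<Lambda>] mult.assoc)
  have "(bndmat \<Lambda> 0 *v b) $ 2 = (\<Sum>j\<in>UNIV. - (\<i> / of_real k) * (P \<Lambda> 2 j + of_real ((\<phi> 0 - M) / k) * P \<Lambda> 1 j) * b $ j)"
    by (simp only: matrix_vector_mult_def bndmat_def vec_lambda_beta bnd_limit[OF \<Lambda>])
  also have "\<dots> = - (\<i> / of_real k) * (p 2 + of_real ((\<phi> 0 - M) / k) * p 1)"
    unfolding p_def by (simp only: sum_3) (simp add: algebra_simps)
  finally have 2: "(bndmat \<Lambda> 0 *v b) $ 2 = - (\<i> / of_real k) * (p 2 + of_real ((\<phi> 0 - M) / k) * p 1)" .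
  have "(bndmat \<Lambda> 0 *v b) $ 3 = (\<Sum>j\<in>UNIV. (\<i> / of_real k) * (P \<Lambda> 3 j + of_real ((1 / \<phi> 0 - Q) / k) * P \<Lambda> 1 j) * b $ j)"
    by (simp only: matrix_vector_mult_def bndmat_def vec_lambda_beta bnd_limit[OF \<Lambda>])
  also have "\<dots> = (\<i> / of_real k) * (p 3 + of_real ((1 / \<phi> 0 - Q) / k) * p 1)"
    unfolding p_def by (simp only: sum_3) (simp add: algebra_simps)
  finally have 3: "(bndmat \<Lambda> 0 *v b) $ 3 = (\<i> / of_real k) * (p 3 + of_real ((1 / \<phi> 0 - Q) / k) * p 1)" .
  have "bndmat \<Lambda> 0 *v b = 0 \<longleftrightarrow> p 1 = 0 \<and> p 2 = 0 \<and> p 3 = 0"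
    unfolding vec_eq_iff[of _ 0] forall_3 1 2 3 using v2_0 k \<Lambda> by auto
  also have "\<dots> \<longleftrightarrow> (\<forall>i. p i = 0)" by (simp add: forall_3)
  also have "\<dots> \<longleftrightarrow> (\<chi> i j. of_real (shifted $ i $ j)) *v b = (- \<i> * \<Lambda>) *s b"
  proof -
    have "p i = ((\<chi> i j. of_real (shifted $ i $ j)) *v b) $ i + \<i> * \<Lambda> * b $ i" for i
    proof -
      have "(\<Sum>j\<in>UNIV. \<i> * \<Lambda> * of_real (kronecker i j) * b $ j) = \<i> * \<Lambda> * b $ i"
        by (simp add: if_distrib[of complex_of_real] if_distrib[of "\<lambda>x. \<i> * \<Lambda> * x * _"] cong: if_cong)
      then show ?thesis
        by (simp add: p_def P_def matrix_vector_mult_def distrib_right sum.distrib)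
    qed
    then show ?thesis by (simp add: vec_eq_iff eq_neg_iff_add_eq_0)
  qed
  finally show ?thesis .
qed

lemma bnd_cont: "continuous_on (S \<times> X) (\<lambda>x. bnd (fst x) (snd x) i j)" if "\<And>\<Lambda>. \<Lambda> \<in> S \<Longrightarrow> \<Lambda> \<noteq> 0"
proof -
  have h: "continuous_on UNIV (\<lambda>\<mu>. corr j \<mu> T $ l)" for l
    by (rule holomorphic_on_imp_continuous_on[OF corr_hol])
  have h': "continuous_on (S \<times> X) (\<lambda>x. corr j (of_real (snd x) * fst x) T $ l)" for l
    by (rule continuous_on_compose2[OF h]) (auto intro!: continuous_intros)
  have r: "continuous_on (S \<times> X) (\<lambda>x. R (snd x))"
    by (rule continuous_on_compose2[OF R_cont[of UNIV]]) (auto intro!: continuous_intros)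
  have nz1: "\<forall>x\<in>S \<times> X. fst x \<noteq> 0" using that by auto
  have nz2: "\<forall>x\<in>S \<times> X. complex_of_real ((\<phi> 0)\<^sup>2) \<noteq> 0" using nz by simp
  have "continuous_on (S \<times> X) (\<lambda>x. of_real (cj j * v2 0) / fst x * R (snd x) + of_real (om1 j T) + of_real (snd x) * fst x * corr j (of_real (snd x) * fst x) T $ 2)"
    "continuous_on (S \<times> X) (\<lambda>x. fst x * corr j (of_real (snd x) * fst x) T $ 3 - of_real (W j 0) * R (snd x))"
    "continuous_on (S \<times> X) (\<lambda>x. fst x * (corr j (of_real (snd x) * fst x) T $ 3 / of_real ((\<phi> 0)\<^sup>2) + of_real (2 * c * v2 0) * corr j (of_real (snd x) * fst x) T $ 1) - of_real (K j) * R (snd x))"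
    by (intro continuous_intros h' r nz1 nz2)+
  then show ?thesis
    unfolding bnd_def Let_def by (cases "i = 1"; cases "i = 2") simp_all
qed

lemma bnd_hol: "(\<lambda>\<Lambda>. bnd \<Lambda> \<xi> i j) holomorphic_on S" if "\<And>\<Lambda>. \<Lambda> \<in> S \<Longrightarrow> \<Lambda> \<noteq> 0"
proof -
  have h: "(\<lambda>\<Lambda>. corr j (of_real \<xi> * \<Lambda>) T $ l) holomorphic_on S" for l
    using holomorphic_on_compose_gen[of "\<lambda>\<Lambda>. of_real \<xi> * \<Lambda>" S "\<lambda>\<mu>. corr j \<mu> T $ l" UNIV] corr_hol
    by (auto simp: o_def intro!: holomorphic_intros)
  have nz2: "complex_of_real ((\<phi> 0)\<^sup>2) \<noteq> 0" using nz by simp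
  have "(\<lambda>\<Lambda>. of_real (cj j * v2 0) / \<Lambda> * R \<xi> + of_real (om1 j T) + of_real \<xi> * \<Lambda> * corr j (of_real \<xi> * \<Lambda>) T $ 2) holomorphic_on S"
    "(\<lambda>\<Lambda>. \<Lambda> * corr j (of_real \<xi> * \<Lambda>) T $ 3 - of_real (W j 0) * R \<xi>) holomorphic_on S"
    "(\<lambda>\<Lambda>. \<Lambda> * (corr j (of_real \<xi> * \<Lambda>) T $ 3 / of_real ((\<phi> 0)\<^sup>2) + of_real (2 * c * v2 0) * corr j (of_real \<xi> * \<Lambda>) T $ 1) - of_real (K j) * R \<xi>) holomorphic_on S"
    by (intro holomorphic_intros h that nz2; assumption)+
  then show ?thesis
    unfolding bnd_def Let_def by (cases "i = 1"; cases "i = 2") simp_all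
qed

text \<open>By Hurwitz' theorem, the roots of the limiting determinant persist for small \<open>\<xi>\<close>.\<close>

proposition no_unstable_limit_eigenvalue:
  assumes stable: "\<And>\<mu>. 0 < Re \<mu> \<Longrightarrow> \<mu> \<notin> L2_spectrum (A_graph c \<phi>)"
    and \<Lambda>0: "0 < Re \<Lambda>0" and eig: "(\<chi> i j. of_real (shifted $ i $ j)) *v b = (- \<i> * \<Lambda>0) *s b"
  shows "b = 0"
proof (rule ccontr)
  assume b: "b \<noteq> 0"
  define S where "S = {\<Lambda>. 0 < Re \<Lambda>}"
  have S0: "\<Lambda> \<noteq> 0" if "\<Lambda> \<in> S" for \<Lambda> using that by (auto simp: S_def)
  define F where "F = (\<lambda>\<xi> \<Lambda>. det (bndmat \<Lambda> \<xi>))"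
  define \<xi> where "\<xi> = (\<lambda>n. inverse (real (Suc n)))"
  have F: "F \<xi> \<Lambda> = bnd \<Lambda> \<xi> 1 1 * bnd \<Lambda> \<xi> 2 2 * bnd \<Lambda> \<xi> 3 3 + bnd \<Lambda> \<xi> 1 2 * bnd \<Lambda> \<xi> 2 3 * bnd \<Lambda> \<xi> 3 1
      + bnd \<Lambda> \<xi> 1 3 * bnd \<Lambda> \<xi> 2 1 * bnd \<Lambda> \<xi> 3 2 - bnd \<Lambda> \<xi> 1 1 * bnd \<Lambda> \<xi> 2 3 * bnd \<Lambda> \<xi> 3 2
      - bnd \<Lambda> \<xi> 1 2 * bnd \<Lambda> \<xi> 2 1 * bnd \<Lambda> \<xi> 3 3 - bnd \<Lambda> \<xi> 1 3 * bnd \<Lambda> \<xi> 2 2 * bnd \<Lambda> \<xi> 3 1" for \<xi> \<Lambda>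
    by (simp add: F_def det_3 bndmat_def)
  \<comment> \<open>Stability makes every \<open>F (\<xi> n)\<close> zero-free on the right
    half-plane, and a nonconstant limit inherits this.\<close>
  have "F 0 \<Lambda>0 \<noteq> 0"
  proof (rule Hurwitz_no_zeros[of S "\<lambda>n. F (\<xi> n)" "F 0"])
    show "open S" "connected S"
      using open_halfspace_Re_gt[of 0] convex_halfspace_Re_gt[of 0] by (auto simp: S_def convex_connected)
    show "F (\<xi> n) holomorphic_on S" for n
      unfolding F[abs_def] by (intro holomorphic_intros bnd_hol S0)
    show "F 0 holomorphic_on S"
      unfolding F[abs_def] by (intro holomorphic_intros bnd_hol S0)
    show "\<Lambda>0 \<in> S" using \<Lambda>0 by (simp add: S_def)
    show "F (\<xi> n) \<Lambda> \<noteq> 0" if "\<Lambda> \<in> S" for n \<Lambda>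
    proof
      assume "F (\<xi> n) \<Lambda> = 0"
      moreover have "0 < \<xi> n" by (simp add: \<xi>_def)
      ultimately have "of_real (\<xi> n) * \<Lambda> \<in> L2_spectrum (A_graph c \<phi>)"
        using bndmat_singular_imp_spectrum[of "\<xi> n" \<Lambda>] S0[OF that] by (simp add: F_def)
      moreover have "0 < Re (of_real (\<xi> n) * \<Lambda>)"
        using \<open>0 < \<xi> n\<close> that by (simp add: S_def)
      ultimately show False using stable by blast
    qed
    show "uniform_limit K (\<lambda>n. F (\<xi> n)) (F 0) sequentially" if K: "compact K" "K \<subseteq> S" for K
    proof (rule uniform_limitI)
      fix e :: real assume e: "0 < e"
      \<comment> \<open>Joint continuity up to \<xi> = 0, on a compact set containing all \<xi> n,
        gives the uniform convergence.\<close>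
      have "continuous_on (K \<times> {0..1}) (\<lambda>x. F (snd x) (fst x))"
        unfolding F using K(2) S0 by (intro continuous_intros bnd_cont) auto
      then have "uniformly_continuous_on (K \<times> {0..1}) (\<lambda>x. F (snd x) (fst x))"
        using K(1) by (intro compact_uniformly_continuous compact_Times) auto
      then obtain d where d: "0 < d" "\<And>x y. x \<in> K \<times> {0..1} \<Longrightarrow> y \<in> K \<times> {0..1} \<Longrightarrow> dist y x < d \<Longrightarrow>
          dist (F (snd y) (fst y)) (F (snd x) (fst x)) < e"
        unfolding uniformly_continuous_on_def using e by blast
      have "\<forall>\<^sub>F n in sequentially. \<xi> n < d"
        using order_tendstoD(2)[OF LIMSEQ_inverse_real_of_nat d(1)] by (simp add: \<xi>_def)
      then show "\<forall>\<^sub>F n in sequentially. \<forall>\<Lambda>\<in>K. dist (F (\<xi> n) \<Lambda>) (F 0 \<Lambda>) < e"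
      proof eventually_elim
        case (elim n)
        have "0 < \<xi> n" "\<xi> n \<le> 1" by (auto simp: \<xi>_def field_simps)
        then show ?case
          using d(2)[of "(\<Lambda>, 0)" "(\<Lambda>, \<xi> n)" for \<Lambda>] elim by (auto simp: dist_Pair_Pair)
      qed
    qed
    \<comment> \<open>A constant limit would vanish on the whole half-plane, and - i \<Lambda> would
      be an eigenvalue of \<open>shifted\<close> even for \<Lambda> beyond its norm bound.\<close>
    show "\<not> F 0 constant_on S"
    proof
      assume "F 0 constant_on S"
      then have F0: "F 0 \<Lambda> = 0" if "\<Lambda> \<in> S" for \<Lambda>
      proof -
        have "F 0 \<Lambda>0 = 0"
          using b eig bndmat_0_kernel[of \<Lambda>0 b] S0[of \<Lambda>0] \<Lambda>0 by (auto simp: F_def det_eq_0_kernel S_def)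
        with \<open>F 0 constant_on S\<close> show ?thesis
          using that \<Lambda>0 unfolding constant_on_def S_def by force
      qed
      let ?N = "(\<chi> i j. of_real (shifted $ i $ j)) :: complex^3^3"
      interpret mv: bounded_bilinear "(*v) :: complex^3^3 \<Rightarrow> complex^3 \<Rightarrow> complex^3"
        by (rule bounded_bilinear_matrix_vector_mult)
      obtain B where B: "\<And>x. norm (?N *v x) \<le> norm x * B"
        using bounded_linear.bounded[OF mv.bounded_linear_right[of ?N]] by blast
      define \<Lambda> where "\<Lambda> = complex_of_real (\<bar>B\<bar> + 1)"
      have \<Lambda>: "\<Lambda> \<in> S" by (auto simp: \<Lambda>_def S_def)
      obtain x where x: "x \<noteq> 0" "?N *v x = (- \<i> * \<Lambda>) *s x"
        using F0[OF \<Lambda>] bndmat_0_kernel[OF S0[OF \<Lambda>]] by (auto simp: F_def det_eq_0_kernel)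
      have "norm (?N *v x) = (\<bar>B\<bar> + 1) * norm x"
        unfolding x(2) norm_vector_smult by (simp add: norm_mult \<Lambda>_def abs_of_nonneg flip: of_real_add)
      also have "\<dots> > norm x * B" using x(1) by (simp add: mult.commute)
      finally show False using B[of x] by simp
    qed
  qed
  moreover have "F 0 \<Lambda>0 = 0"
    using b eig bndmat_0_kernel[of \<Lambda>0 b] S0[of \<Lambda>0] \<Lambda>0 by (auto simp: F_def det_eq_0_kernel S_def)
  ultimately show False by simp
qed

end

text \<open>The existential form frees the results from the constants of the locale, so that the
  data for the three directions can be chosen simultaneously.\<close>

lemma (in profile_variation) variation_summary:
  fixes \<phi> :: "real \<Rightarrow> real"
  assumes \<phi>: "\<And>z. \<phi> z = g 0 (k 0 * z)"
  shows "\<exists>w w1 e.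
    (\<forall>z. (w has_real_derivative w1 z) (at z)) \<and>
    (\<forall>z. (w1 has_real_derivative (- 1 / \<phi> z + 4 * E 0 / (\<phi> z)\<^sup>2) * w z + c' / (c 0)\<^sup>2 - 2 * e / (\<phi> z)\<^sup>2) (at z)) \<and>
    w1 0 = 0 \<and> w (1 / k 0) = w 0 \<and>
    w1 (1 / k 0) = k' * (1 / \<phi> 0 - 1 / c 0 - 2 * E 0 / (\<phi> 0)\<^sup>2) / (k 0)\<^sup>2 \<and>
    (\<forall>X. (\<forall>z. (X has_real_derivative \<phi> z * w z) (at z)) \<longrightarrow>
      X (1 / k 0) - X 0 = M' / k 0 + k' / (k 0)\<^sup>2 * (\<phi> 0 - M_of (g 0))) \<and>
    (\<forall>X. (\<forall>z. (X has_real_derivative w z / \<phi> z - 2 * (k 0 * (deriv (g 0) (k 0 * z) / g 0 (k 0 * z))) * w1 z) (at z)) \<longrightarrow>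
      X (1 / k 0) - X 0 = - (Q' / k 0) - k' / (k 0)\<^sup>2 * (1 / \<phi> 0 - Q_of (k 0) (g 0))) \<and>
    deriv (\<lambda>s. integral {0..1} (\<lambda>\<theta>. 2 * (k s)\<^sup>2 * c s * (deriv (g s) \<theta>)\<^sup>2 - (g s \<theta>)\<^sup>2)) 0
      = 2 * (c' * E 0 + c 0 * e) - c' * M_of (g 0) - c 0 * M' \<and>
    deriv (\<lambda>s. integral {0..1} (\<lambda>\<theta>. 2 * ln \<bar>g s \<theta>\<bar>)) 0
      = 2 * (c' * H 0 + c 0 * (- (w 0 / \<phi> 0) + w 0 / c 0 - c' * ln (\<phi> 0) / (c 0)\<^sup>2 - e / (\<phi> 0)\<^sup>2
        + 2 * E 0 * w 0 / (\<phi> 0)\<^sup>2)) - c' * Q_of (k 0) (g 0) - c 0 * Q'"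
proof (rule exI[of _ \<omega>], rule exI[of _ \<omega>1], rule exI[of _ E'], intro conjI allI impI)
  show "(\<omega>1 has_real_derivative (- 1 / \<phi> z + 4 * E 0 / (\<phi> z)\<^sup>2) * \<omega> z + c' / (c 0)\<^sup>2 - 2 * E' / (\<phi> z)\<^sup>2) (at z)" for z
    using \<omega>1_deriv[of z] by (simp add: \<phi> V_def)
  show "\<omega>1 (1 / k 0) = k' * (1 / \<phi> 0 - 1 / c 0 - 2 * E 0 / (\<phi> 0)\<^sup>2) / (k 0)\<^sup>2"
    using \<omega>_ends(4) by (simp add: \<phi> V2_def)
  show "X (1 / k 0) - X 0 = M' / k 0 + k' / (k 0)\<^sup>2 * (\<phi> 0 - M_of (g 0))"
    if "\<forall>z. (X has_real_derivative \<phi> z * \<omega> z) (at z)" for X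
    using integral_\<phi>\<omega>[of X] that by (simp add: \<phi>)
  show "X (1 / k 0) - X 0 = - (Q' / k 0) - k' / (k 0)\<^sup>2 * (1 / \<phi> 0 - Q_of (k 0) (g 0))"
    if "\<forall>z. (X has_real_derivative \<omega> z / \<phi> z - 2 * (k 0 * (deriv (g 0) (k 0 * z) / g 0 (k 0 * z))) * \<omega>1 z) (at z)" for X
    using integral_\<omega>_Q[of X] that by (simp add: \<phi> V1_def)
  show "deriv (\<lambda>s. integral {0..1} (\<lambda>\<theta>. 2 * ln \<bar>g s \<theta>\<bar>)) 0
      = 2 * (c' * H 0 + c 0 * (- (\<omega> 0 / \<phi> 0) + \<omega> 0 / c 0 - c' * ln (\<phi> 0) / (c 0)\<^sup>2 - E' / (\<phi> 0)\<^sup>2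
        + 2 * E 0 * \<omega> 0 / (\<phi> 0)\<^sup>2)) - c' * Q_of (k 0) (g 0) - c 0 * Q'"
    using DERIV_imp_deriv[OF Q_flux_deriv] unfolding H'_def by (simp only: \<phi> mult_zero_right \<omega>_ends(1))
qed (use \<omega>_deriv \<omega>_ends DERIV_imp_deriv[OF M_flux_deriv] in auto)

text \<open>The family is restricted to a coordinate line. The conduit equation excludes zeros of a
  profile, so by the intermediate value theorem its sign is that of its value at \<theta> = 0, and
  positivity near \<open>p\<^sub>0\<close> is an open condition on that single value.\<close>

lemma parameterized_variation:
  fixes \<Phi> :: "real^3 \<Rightarrow> real \<Rightarrow> real" and c :: "real^3 \<Rightarrow> real" and j :: 3
  assumes U: "open U" "p\<^sub>0 \<in> U" and \<Phi>: "C1_on (\<lambda>(\<theta>, p). \<Phi> p \<theta>) (UNIV \<times> U)" and c: "C1_on c U"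
    and prof: "\<forall>p\<in>U. rescaled_profile (p $ 1) (c p) (\<Phi> p) \<and> kMQ (p $ 1) (\<Phi> p) = p"
    and c0: "0 < c p\<^sub>0" and pos0: "\<And>\<theta>. 0 < \<Phi> p\<^sub>0 \<theta>"
  shows "\<exists>g' d. profile_variation (\<lambda>s. \<Phi> (p\<^sub>0 + s *\<^sub>R axis j 1)) g' (\<lambda>s. (p\<^sub>0 + s *\<^sub>R axis j 1) $ 1)
    (\<lambda>s. c (p\<^sub>0 + s *\<^sub>R axis j 1)) d (kronecker 1 j) (partial j c p\<^sub>0) (kronecker 2 j) (kronecker 3 j)"
proof -
  define e where "e = (axis j 1 :: real^3)"
  define p where "p = (\<lambda>s. p\<^sub>0 + s *\<^sub>R e)"
  have p_deriv: "(p has_derivative (\<lambda>h. h *\<^sub>R e)) (at s)" for s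
    unfolding p_def by (auto intro!: derivative_eq_intros)
  have p_cont: "continuous_on A p" for A unfolding p_def by (intro continuous_intros)
  obtain f' where f': "\<And>x. x \<in> UNIV \<times> U \<Longrightarrow> ((\<lambda>(\<theta>, p). \<Phi> p \<theta>) has_derivative blinfun_apply (f' x)) (at x)"
    and f'_cont: "continuous_on (UNIV \<times> U) f'"
    using \<Phi> unfolding C1_on_def by blast
  obtain c' where c': "\<And>x. x \<in> U \<Longrightarrow> (c has_derivative blinfun_apply (c' x)) (at x)"
    using c unfolding C1_on_def by blast
  have \<Phi>_cont: "continuous_on (UNIV \<times> U) (\<lambda>(\<theta>, p). \<Phi> p \<theta>)"
    by (intro continuous_at_imp_continuous_on ballI has_derivative_continuous[OF f'])
  have c_cont: "continuous_on U c"
    by (intro continuous_at_imp_continuous_on ballI has_derivative_continuous[OF c'])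
  have nz: "\<Phi> q \<theta> \<noteq> 0" and q_smooth: "continuous_on UNIV (\<Phi> q)" if "q \<in> U" for q \<theta>
  proof -
    have tw: "traveling_wave (c q) (\<lambda>z. \<Phi> q (q $ 1 * z))" and q1: "0 < q $ 1"
      using prof that by (auto simp: rescaled_profile_def)
    then have "\<Phi> q (q $ 1 * (\<theta> / q $ 1 - c q * 0)) \<noteq> 0"
      unfolding traveling_wave_def conduit_equation_def by blast
    then show "\<Phi> q \<theta> \<noteq> 0" using q1 by simp
    have "continuous_on UNIV (\<lambda>\<theta>. (case (\<theta>, q) of (\<theta>, p) \<Rightarrow> \<Phi> p \<theta>))"
      by (rule continuous_on_compose2[OF \<Phi>_cont]) (use that in \<open>auto intro!: continuous_intros\<close>)
    then show "continuous_on UNIV (\<Phi> q)" by simp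
  qed
  have "isCont p 0" using p_cont[of UNIV] by (simp add: continuous_on_eq_continuous_at)
  have p0: "p 0 = p\<^sub>0" by (simp add: p_def)
  define U' where "U' = {q \<in> U. 0 < c q \<and> 0 < \<Phi> q 0}"
  have "open U'"
  proof -
    have "continuous_on U (\<lambda>q. (case (0, q) of (\<theta>, p) \<Rightarrow> \<Phi> p \<theta>))"
      by (rule continuous_on_compose2[OF \<Phi>_cont]) (auto intro!: continuous_intros)
    then have "continuous_on U (\<lambda>q. \<Phi> q 0)" by simp
    then have "open ((\<lambda>q. \<Phi> q 0) -` {0<..} \<inter> U)" "open (c -` {0<..} \<inter> U)"
      using c_cont by (auto simp only: continuous_on_open_vimage[OF U(1)] open_greaterThan)
    moreover have "U' = ((\<lambda>q. \<Phi> q 0) -` {0<..} \<inter> U) \<inter> (c -` {0<..} \<inter> U)"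
      by (auto simp: U'_def)
    ultimately show ?thesis by auto
  qed
  moreover have "p\<^sub>0 \<in> U'" using U(2) c0 pos0 by (simp add: U'_def)
  ultimately have "open (p -` U')" "0 \<in> p -` U'"
    using open_vimage[OF _ p_cont[of UNIV]] p0 by auto
  then obtain d where d: "0 < d" "ball 0 d \<subseteq> p -` U'"
    using open_contains_ball by blast
  have pU: "p s \<in> U" "0 < c (p s)" "0 < \<Phi> (p s) 0" if "\<bar>s\<bar> < d" for s
    using d(2) that by (auto simp: U'_def subset_iff dist_norm)
  have s_in: "\<bar>s\<bar> < d" if "s \<in> {-d<..<d}" for s using that by auto
  have pos: "0 < \<Phi> (p s) \<theta>" if s: "\<bar>s\<bar> < d" for s \<theta>
  proof (rule ccontr)
    assume "\<not> 0 < \<Phi> (p s) \<theta>"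
    moreover have "is_interval (range (\<Phi> (p s)))"
      using connected_continuous_image[OF q_smooth[OF pU(1)[OF s]] connected_UNIV]
      by (simp add: is_interval_connected_1)
    ultimately have "0 \<in> range (\<Phi> (p s))"
      using pU(3)[OF s] unfolding is_interval_1
      by (meson less_imp_le not_less rangeI)
    then have "\<exists>x. \<Phi> (p s) x = 0" by (metis rangeE)
    then show False using nz[OF pU(1)[OF s]] by blast
  qed
  define g' where "g' = (\<lambda>s \<theta>. blinfun_apply (f' (\<theta>, p s)) (0, e))"
  have kM: "p s $ 1 = p\<^sub>0 $ 1 + s * kronecker 1 j" "p s $ 2 = p\<^sub>0 $ 2 + s * kronecker 2 j"
    "p s $ 3 = p\<^sub>0 $ 3 + s * kronecker 3 j" for s
    by (simp_all add: p_def e_def axis_def)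
  \<comment> \<open>M and Q are coordinates of the parameter, so they are affine along the line;
    this makes Q differentiable although it contains the \<theta>-derivative of the profile.\<close>
  have MQ: "M_of (\<Phi> (p s)) = p s $ 2" "Q_of (p s $ 1) (\<Phi> (p s)) = p s $ 3" if "\<bar>s\<bar> < d" for s
  proof -
    have "kMQ (p s $ 1) (\<Phi> (p s)) = p s" using prof pU(1)[OF that] by blast
    from arg_cong[OF this, of "\<lambda>v. v $ 2"] arg_cong[OF this, of "\<lambda>v. v $ 3"]
    show "M_of (\<Phi> (p s)) = p s $ 2" "Q_of (p s $ 1) (\<Phi> (p s)) = p s $ 3"
      by (simp_all add: kMQ_def vector_3)
  qed
  have ev: "\<forall>\<^sub>F s in nhds 0. \<bar>s\<bar> < d"
    using d(1) eventually_nhds_in_open[of "{-d<..<d}" 0] by (auto elim!: eventually_mono)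
  have "profile_variation (\<lambda>s. \<Phi> (p s)) g' (\<lambda>s. p s $ 1) (\<lambda>s. c (p s)) d
      (kronecker 1 j) (partial j c p\<^sub>0) (kronecker 2 j) (kronecker 3 j)"
  proof
    show "0 < d" by (rule d)
    show "((\<lambda>s. \<Phi> (p s) \<theta>) has_real_derivative g' s \<theta>) (at s)" if "\<bar>s\<bar> < d" for s \<theta>
    proof -
      have "((\<lambda>s. (\<theta>, p s)) has_derivative (\<lambda>h. (0, h *\<^sub>R e))) (at s)"
        by (intro has_derivative_Pair has_derivative_const p_deriv)
      from has_derivative_compose[OF this, of "\<lambda>(\<theta>, p). \<Phi> p \<theta>" "blinfun_apply (f' (\<theta>, p s))"]
      have "((\<lambda>s. \<Phi> (p s) \<theta>) has_derivative (\<lambda>h. blinfun_apply (f' (\<theta>, p s)) (0, h *\<^sub>R e))) (at s)"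
        using f'[of "(\<theta>, p s)"] pU(1)[OF that] by simp
      moreover have "blinfun_apply (f' (\<theta>, p s)) (0, h *\<^sub>R e) = g' s \<theta> * h" for h
        using blinfun.scaleR_right[of "f' (\<theta>, p s)" h "(0, e)"] by (simp add: g'_def)
      ultimately show ?thesis by (simp add: has_field_derivative_def)
    qed
    have cp: "continuous_on ({-d<..<d} \<times> UNIV) (\<lambda>x. (snd x, p (fst x)) :: real \<times> (real^3))"
      by (intro continuous_intros continuous_on_compose2[OF p_cont[of UNIV]]) auto
    have sub: "(\<lambda>x. (snd x, p (fst x))) ` ({-d<..<d} \<times> UNIV) \<subseteq> UNIV \<times> U"
      using pU(1) s_in by auto
    show "continuous_on ({-d<..<d} \<times> UNIV) (\<lambda>(s, \<theta>). g' s \<theta>)"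
      unfolding g'_def split_beta
      by (intro continuous_intros continuous_on_compose2[OF f'_cont cp sub])
    have "continuous_on ({-d<..<d} \<times> UNIV) (\<lambda>x. case (snd x, p (fst x)) of (\<theta>, p) \<Rightarrow> \<Phi> p \<theta>)"
      by (rule continuous_on_compose2[OF \<Phi>_cont cp sub])
    then show "continuous_on ({-d<..<d} \<times> UNIV) (\<lambda>(s, \<theta>). \<Phi> (p s) \<theta>)"
      by (simp add: split_beta)
    show "rescaled_profile (p s $ 1) (c (p s)) (\<Phi> (p s))" if "\<bar>s\<bar> < d" for s
      using prof pU(1)[OF that] by blast
    show "0 < \<Phi> (p s) \<theta>" if "\<bar>s\<bar> < d" for s \<theta> using pos[OF that] .
    show "c (p s) \<noteq> 0" if "\<bar>s\<bar> < d" for s using pU(2)[OF that] by simp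
    show "((\<lambda>s. p s $ 1) has_real_derivative kronecker 1 j) (at 0)"
      unfolding kM by (auto intro!: derivative_eq_intros)
    have "((\<lambda>s. c (p s)) has_derivative (\<lambda>h. blinfun_apply (c' (p 0)) (h *\<^sub>R e))) (at 0)"
      using has_derivative_compose[OF p_deriv c'[of "p 0"]] pU(1)[of 0] d(1) by simp
    then have "((\<lambda>s. c (p s)) has_real_derivative blinfun_apply (c' (p 0)) e) (at 0)"
      by (simp add: has_field_derivative_def blinfun.scaleR_right mult_commute_abs)
    moreover from DERIV_imp_deriv[OF this] have "partial j c p\<^sub>0 = blinfun_apply (c' (p 0)) e"
      by (simp add: partial_def p_def e_def)
    ultimately show "((\<lambda>s. c (p s)) has_real_derivative partial j c p\<^sub>0) (at 0)" by simp
    have "((\<lambda>s. p s $ 2) has_real_derivative kronecker 2 j) (at 0)"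
      "((\<lambda>s. p s $ 3) has_real_derivative kronecker 3 j) (at 0)"
      unfolding kM by (auto intro!: derivative_eq_intros)
    moreover have "\<forall>\<^sub>F s in nhds 0. M_of (\<Phi> (p s)) = p s $ 2"
      "\<forall>\<^sub>F s in nhds 0. Q_of (p s $ 1) (\<Phi> (p s)) = p s $ 3"
      using ev by (eventually_elim, simp add: MQ)+
    ultimately show "((\<lambda>s. M_of (\<Phi> (p s))) has_real_derivative kronecker 2 j) (at 0)"
      "((\<lambda>s. Q_of (p s $ 1) (\<Phi> (p s))) has_real_derivative kronecker 3 j) (at 0)"
      using DERIV_cong_ev[OF refl _ refl, of "\<lambda>s. M_of (\<Phi> (p s))" "\<lambda>s. p s $ 2" 0]
        DERIV_cong_ev[OF refl _ refl, of "\<lambda>s. Q_of (p s $ 1) (\<Phi> (p s))" "\<lambda>s. p s $ 3" 0] by auto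
  qed
  then show ?thesis unfolding p_def e_def by blast
qed

text \<open>The matrix is real, so conjugating an eigenvector gives one for the conjugate
  eigenvalue. Excluding one open half-plane thus excludes both.\<close>

lemma characteristic_speed_cnj:
  assumes "characteristic_speed \<Phi> c p \<mu>"
  shows "characteristic_speed \<Phi> c p (cnj \<mu>)"
proof -
  let ?A = "whitham_matrix \<Phi> c p"
  obtain v where v: "v \<noteq> 0" "(\<chi> i j. complex_of_real (?A $ i $ j)) *v v = \<mu> *s v"
    using assms by (auto simp: characteristic_speed_def)
  define w where "w = (\<chi> i. cnj (v $ i))"
  have "(\<Sum>j\<in>UNIV. of_real (?A $ i $ j) * cnj (v $ j)) = cnj \<mu> * cnj (v $ i)" for i
    using arg_cong[OF v(2), of "\<lambda>x. cnj (x $ i)"] by (simp add: matrix_vector_mult_def)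
  then have "(\<chi> i j. complex_of_real (?A $ i $ j)) *v w = cnj \<mu> *s w"
    by (simp add: w_def matrix_vector_mult_def vec_eq_iff)
  moreover have "w \<noteq> 0" using v(1) by (simp add: w_def vec_eq_iff)
  ultimately show ?thesis unfolding characteristic_speed_def by blast
qed

theorem theorem3p1:
  fixes \<phi>\<^sub>0 :: "real \<Rightarrow> real" and c\<^sub>0 k\<^sub>0 :: real
    and \<Phi> :: "real ^ 3 \<Rightarrow> real \<Rightarrow> real" and c :: "real ^ 3 \<Rightarrow> real"
  assumes "0 < k\<^sub>0" and "0 < c\<^sub>0"
    and "traveling_wave c\<^sub>0 \<phi>\<^sub>0"
    and "even_fn \<phi>\<^sub>0"
    and "fundamental_period \<phi>\<^sub>0 (1 / k\<^sub>0)"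
    and "\<forall>z. 0 < \<phi>\<^sub>0 z"
    and "parameterized_by_kMQ \<phi>\<^sub>0 k\<^sub>0 c\<^sub>0 \<Phi> c"
    and "spectrally_stable c\<^sub>0 \<phi>\<^sub>0"
  shows "weakly_hyperbolic \<Phi> c (kMQ k\<^sub>0 (\<lambda>\<theta>. \<phi>\<^sub>0 (\<theta> / k\<^sub>0)))"
proof -
  define \<psi> where "\<psi> = (\<lambda>\<theta>. \<phi>\<^sub>0 (\<theta> / k\<^sub>0))"
  define p\<^sub>0 where "p\<^sub>0 = kMQ k\<^sub>0 \<psi>"
  have k0: "0 < k\<^sub>0" "k\<^sub>0 \<noteq> 0" and c0: "0 < c\<^sub>0" "c\<^sub>0 \<noteq> 0" using assms(1,2) by auto
  have \<phi>_eq: "\<phi>\<^sub>0 z = \<psi> (k\<^sub>0 * z)" for z using k0 by (simp add: \<psi>_def)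
  have pos: "0 < \<psi> \<theta>" for \<theta> using assms(6) by (simp add: \<psi>_def)
  have fp: "0 < 1 / k\<^sub>0" "\<And>x. \<phi>\<^sub>0 (x + 1 / k\<^sub>0) = \<phi>\<^sub>0 x"
    "\<And>S. 0 < S \<Longrightarrow> S < 1 / k\<^sub>0 \<Longrightarrow> \<not> (\<forall>x. \<phi>\<^sub>0 (x + S) = \<phi>\<^sub>0 x)"
    using assms(5) unfolding fundamental_period_def by auto
  have rp: "rescaled_profile k\<^sub>0 c\<^sub>0 \<psi>"
    unfolding rescaled_profile_def
  proof (intro conjI)
    show "even_fn \<psi>" using assms(4) by (simp add: even_fn_def \<psi>_def)
    show "traveling_wave c\<^sub>0 (\<lambda>z. \<psi> (k\<^sub>0 * z))" using assms(3) by (simp flip: \<phi>_eq)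
    show "fundamental_period \<psi> 1"
      unfolding fundamental_period_def
    proof (intro conjI allI impI)
      show "\<psi> (x + 1) = \<psi> x" for x
        using fp(2)[of "x / k\<^sub>0"] by (simp add: \<psi>_def add_divide_distrib)
      fix S :: real assume S: "0 < S \<and> S < 1"
      show "\<not> (\<forall>x. \<psi> (x + S) = \<psi> x)"
      proof
        assume "\<forall>x. \<psi> (x + S) = \<psi> x"
        then have "\<phi>\<^sub>0 (x + S / k\<^sub>0) = \<phi>\<^sub>0 x" for x
          using k0 by (simp add: \<phi>_eq distrib_left)
        then show False using fp(3)[of "S / k\<^sub>0"] S k0 by (simp add: divide_strict_right_mono)
      qed
    qed simp
  qed (rule k0)
  obtain U \<delta> where U: "open U" "p\<^sub>0 \<in> U" and \<Phi>C1: "C1_on (\<lambda>(\<theta>, p). \<Phi> p \<theta>) (UNIV \<times> U)"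
    and cC1: "C1_on c U"
    and prof: "\<forall>p\<in>U. rescaled_profile (p $ 1) (c p) (\<Phi> p) \<and> kMQ (p $ 1) (\<Phi> p) = p"
    and \<delta>: "0 < \<delta>" "\<forall>k s \<psi>. rescaled_profile k s \<psi> \<and> \<bar>k - k\<^sub>0\<bar> < \<delta> \<and> \<bar>s - c\<^sub>0\<bar> < \<delta> \<and>
           (\<forall>\<theta>. \<bar>\<psi> \<theta> - \<phi>\<^sub>0 (\<theta> / k\<^sub>0)\<bar> < \<delta>) \<longrightarrow>
           kMQ k \<psi> \<in> U \<and> \<Phi> (kMQ k \<psi>) = \<psi> \<and> c (kMQ k \<psi>) = s"
    using assms(7) unfolding parameterized_by_kMQ_def p\<^sub>0_def \<psi>_def by blast
  \<comment> \<open>The reference wave is at distance 0 from itself, so the second half of the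
    parameterization makes it the member of the family at \<open>p\<^sub>0\<close>.\<close>
  have \<Phi>0: "\<Phi> p\<^sub>0 = \<psi>" and cp0: "c p\<^sub>0 = c\<^sub>0"
    using \<delta>(2)[rule_format, of k\<^sub>0 c\<^sub>0 \<psi>] rp \<delta>(1) by (auto simp: p\<^sub>0_def \<psi>_def)
  have p0: "p\<^sub>0 $ 1 = k\<^sub>0" by (simp add: p\<^sub>0_def kMQ_def vector_3)
  define E where "E = profile_E c\<^sub>0 \<psi>"
  define H where "H = profile_H c\<^sub>0 \<psi>"
  define v1 where "v1 = (\<lambda>z. k\<^sub>0 * (deriv \<psi> (k\<^sub>0 * z) / \<psi> (k\<^sub>0 * z)))"
  define cj where "cj = (\<lambda>j. partial j c p\<^sub>0)"
  define P where "P = (\<lambda>j w w1 e.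
    (\<forall>z. (w has_real_derivative w1 z) (at z)) \<and>
    (\<forall>z. (w1 has_real_derivative (- 1 / \<phi>\<^sub>0 z + 4 * E / (\<phi>\<^sub>0 z)\<^sup>2) * w z + cj j / c\<^sub>0\<^sup>2 - 2 * e / (\<phi>\<^sub>0 z)\<^sup>2) (at z)) \<and>
    w1 0 = 0 \<and> w (1 / k\<^sub>0) = w 0 \<and>
    w1 (1 / k\<^sub>0) = kronecker 1 j * (1 / \<phi>\<^sub>0 0 - 1 / c\<^sub>0 - 2 * E / (\<phi>\<^sub>0 0)\<^sup>2) / k\<^sub>0\<^sup>2 \<and>
    (\<forall>X. (\<forall>z. (X has_real_derivative \<phi>\<^sub>0 z * w z) (at z)) \<longrightarrow>
      X (1 / k\<^sub>0) - X 0 = kronecker 2 j / k\<^sub>0 + kronecker 1 j / k\<^sub>0\<^sup>2 * (\<phi>\<^sub>0 0 - M_of \<psi>)) \<and>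
    (\<forall>X. (\<forall>z. (X has_real_derivative w z / \<phi>\<^sub>0 z - 2 * v1 z * w1 z) (at z)) \<longrightarrow>
      X (1 / k\<^sub>0) - X 0 = - (kronecker 3 j / k\<^sub>0) - kronecker 1 j / k\<^sub>0\<^sup>2 * (1 / \<phi>\<^sub>0 0 - Q_of k\<^sub>0 \<psi>)) \<and>
    partial j (M_flux \<Phi> c) p\<^sub>0 = 2 * (cj j * E + c\<^sub>0 * e) - cj j * M_of \<psi> - c\<^sub>0 * kronecker 2 j \<and>
    partial j (Q_flux \<Phi>) p\<^sub>0
      = 2 * (cj j * H + c\<^sub>0 * (- (w 0 / \<phi>\<^sub>0 0) + w 0 / c\<^sub>0 - cj j * ln (\<phi>\<^sub>0 0) / c\<^sub>0\<^sup>2 - e / (\<phi>\<^sub>0 0)\<^sup>2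
        + 2 * E * w 0 / (\<phi>\<^sub>0 0)\<^sup>2)) - cj j * Q_of k\<^sub>0 \<psi> - c\<^sub>0 * kronecker 3 j)"
  have "\<exists>w w1 e. P j w w1 e" for j
  proof -
    obtain g' d where pv: "profile_variation (\<lambda>s. \<Phi> (p\<^sub>0 + s *\<^sub>R axis j 1)) g' (\<lambda>s. (p\<^sub>0 + s *\<^sub>R axis j 1) $ 1)
      (\<lambda>s. c (p\<^sub>0 + s *\<^sub>R axis j 1)) d (kronecker 1 j) (partial j c p\<^sub>0) (kronecker 2 j) (kronecker 3 j)"
      using parameterized_variation[OF U \<Phi>C1 cC1 prof, unfolded cp0 \<Phi>0, OF c0(1) pos, of j] by blast
    have at0: "p\<^sub>0 + 0 *\<^sub>R axis j 1 = p\<^sub>0" by simp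
    have cjj: "partial j c p\<^sub>0 = cj j" by (simp add: cj_def)
    show ?thesis
      unfolding P_def E_def H_def v1_def partial_def[of j "M_flux \<Phi> c"] partial_def[of j "Q_flux \<Phi>"] M_flux_def Q_flux_def
      by (rule profile_variation.variation_summary[OF pv, where \<phi> = \<phi>\<^sub>0, unfolded at0 \<Phi>0 cp0 p0 cjj, OF \<phi>_eq])
  qed
  then obtain om om1 Ej where om_P: "\<And>j. P j (om j) (om1 j) (Ej j)"
    by metis
  have om_facts:
    "(om j has_real_derivative om1 j z) (at z)"
    "(om1 j has_real_derivative (- 1 / \<phi>\<^sub>0 z + 4 * E / (\<phi>\<^sub>0 z)\<^sup>2) * om j z + cj j / c\<^sub>0\<^sup>2 - 2 * Ej j / (\<phi>\<^sub>0 z)\<^sup>2) (at z)"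
    "om1 j 0 = 0" "om j (1 / k\<^sub>0) = om j 0"
    "om1 j (1 / k\<^sub>0) = kronecker 1 j * (1 / \<phi>\<^sub>0 0 - 1 / c\<^sub>0 - 2 * E / (\<phi>\<^sub>0 0)\<^sup>2) / k\<^sub>0\<^sup>2"
    "(\<forall>z. (X has_real_derivative \<phi>\<^sub>0 z * om j z) (at z)) \<longrightarrow>
      X (1 / k\<^sub>0) - X 0 = kronecker 2 j / k\<^sub>0 + kronecker 1 j / k\<^sub>0\<^sup>2 * (\<phi>\<^sub>0 0 - M_of \<psi>)"
    "(\<forall>z. (X has_real_derivative om j z / \<phi>\<^sub>0 z - 2 * v1 z * om1 j z) (at z)) \<longrightarrow>
      X (1 / k\<^sub>0) - X 0 = - (kronecker 3 j / k\<^sub>0) - kronecker 1 j / k\<^sub>0\<^sup>2 * (1 / \<phi>\<^sub>0 0 - Q_of k\<^sub>0 \<psi>)"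
    "partial j (M_flux \<Phi> c) p\<^sub>0 = 2 * (cj j * E + c\<^sub>0 * Ej j) - cj j * M_of \<psi> - c\<^sub>0 * kronecker 2 j"
    "partial j (Q_flux \<Phi>) p\<^sub>0
      = 2 * (cj j * H + c\<^sub>0 * (- (om j 0 / \<phi>\<^sub>0 0) + om j 0 / c\<^sub>0 - cj j * ln (\<phi>\<^sub>0 0) / c\<^sub>0\<^sup>2 - Ej j / (\<phi>\<^sub>0 0)\<^sup>2
        + 2 * E * om j 0 / (\<phi>\<^sub>0 0)\<^sup>2)) - cj j * Q_of k\<^sub>0 \<psi> - c\<^sub>0 * kronecker 3 j" for j z X
    using om_P[of j] unfolding P_def by blast+
  note pf = profile_facts[OF rp pos c0(2), folded E_def]
  interpret whitham_data \<phi>\<^sub>0 v1 c\<^sub>0 E "1 / k\<^sub>0" k\<^sub>0 "M_of \<psi>" "Q_of k\<^sub>0 \<psi>" om om1 cj Ej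
  proof
    have chain: "((\<lambda>z. F (k\<^sub>0 * z)) has_real_derivative F' (k\<^sub>0 * z) * k\<^sub>0) (at z)"
      if "\<And>\<theta>. (F has_real_derivative F' \<theta>) (at \<theta>)" for F F' z
      using DERIV_chain2[where f = F and g = "\<lambda>z. k\<^sub>0 * z" and x = z and s = UNIV, OF that DERIV_cmult_Id] .
    show "smooth \<phi>\<^sub>0" using assms(3) by (simp add: traveling_wave_def)
    show "0 < \<phi>\<^sub>0 z" for z using assms(6) by simp
    show "\<phi>\<^sub>0 (z + 1 / k\<^sub>0) = \<phi>\<^sub>0 z" for z by (rule fp(2))
    show ln\<phi>: "((\<lambda>z. ln (\<phi>\<^sub>0 z)) has_real_derivative v1 z) (at z)" for z
      unfolding v1_def \<phi>_eq by (rule DERIV_cong[OF chain[OF pf(6)]]) simp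
    show "(v1 has_real_derivative 1 / \<phi>\<^sub>0 z - 1 / c\<^sub>0 - 2 * E / (\<phi>\<^sub>0 z)\<^sup>2) (at z)" for z
      unfolding v1_def \<phi>_eq
      by (rule DERIV_cong[OF DERIV_cmult[OF chain[OF pf(7)]]]) (use k0 in \<open>simp add: power2_eq_square\<close>)
    show "v1 0 = 0" using pf(5) by (simp add: v1_def)
    show "v1 (1 / k\<^sub>0) = 0" using pf(4)[of 0] pf(5) k0 by (simp add: v1_def)
    \<comment> \<open>Otherwise the wave is constant, and half of the fundamental period is a period
      as well.\<close>
    show "\<exists>z. v1 z \<noteq> 0"
    proof (rule ccontr)
      assume "\<not> ?thesis"
      then have "ln (\<phi>\<^sub>0 x) = ln (\<phi>\<^sub>0 y)" for x y
        using DERIV_isconst_all[of "\<lambda>z. ln (\<phi>\<^sub>0 z)" x y] ln\<phi> by simp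
      then have "\<phi>\<^sub>0 x = \<phi>\<^sub>0 y" for x y
        using assms(6) ln_inj_iff by blast
      then show False using fp(3)[of "1 / k\<^sub>0 / 2"] fp(1) by auto
    qed
  qed (use k0 c0 fp om_facts in auto)
  have cj_eq: "partial j c p\<^sub>0 = cj j" for j by (simp add: cj_def)
  have Heq: "H\<^sub>0 = H"
    unfolding H\<^sub>0_def H_def profile_H_def E_def[symmetric] by (simp add: \<phi>_eq[of 0])
  \<comment> \<open>The first diagonal entry and the terms - c M and - c Q of the fluxes contribute
    - c on the diagonal of the Whitham matrix, which the shift cancels.\<close>
  have shift: "shifted $ i $ j = whitham_matrix \<Phi> c p\<^sub>0 $ i $ j + c\<^sub>0 * kronecker i j" for i j
  proof -
    have "i = 1 \<or> i = 2 \<or> i = 3" by (rule exhaust_3)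
    moreover have "j = 1 \<or> j = 2 \<or> j = 3" by (rule exhaust_3)
    ultimately show ?thesis
      by (elim disjE) (simp_all add: shifted_def whitham_matrix_def vector_3 om_facts(8,9) cp0 p0 Heq Hj_def
          cj_eq algebra_simps)
  qed
  have stable: "\<mu> \<notin> L2_spectrum (A_graph c\<^sub>0 \<phi>\<^sub>0)" if "0 < Re \<mu>" for \<mu>
    using assms(8) that by (auto simp: spectrally_stable_def spectrally_unstable_def)
  have no_neg: "\<not> characteristic_speed \<Phi> c p\<^sub>0 \<mu>" if \<mu>: "Im \<mu> < 0" for \<mu>
  proof
    assume "characteristic_speed \<Phi> c p\<^sub>0 \<mu>"
    then obtain v where v: "v \<noteq> 0" "(\<chi> i j. complex_of_real (whitham_matrix \<Phi> c p\<^sub>0 $ i $ j)) *v v = \<mu> *s v"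
      by (auto simp: characteristic_speed_def)
    \<comment> \<open>Chosen so that - i \<Lambda> is the eigenvalue \<mu> + c of
      \<open>shifted\<close>; its real part is - Im \<mu>, which is positive here.\<close>
    define \<Lambda> where "\<Lambda> = \<i> * (\<mu> + of_real c\<^sub>0)"
    have "((\<chi> i j. complex_of_real (shifted $ i $ j)) *v v) $ i = (\<mu> + of_real c\<^sub>0) * v $ i" for i
    proof -
      have "(\<Sum>j\<in>UNIV. of_real c\<^sub>0 * of_real (kronecker i j) * v $ j) = of_real c\<^sub>0 * v $ i"
        by (simp add: if_distrib[of complex_of_real] if_distrib[of "\<lambda>x. of_real c\<^sub>0 * x * _"] cong: if_cong)
      moreover have "(\<Sum>j\<in>UNIV. complex_of_real (whitham_matrix \<Phi> c p\<^sub>0 $ i $ j) * v $ j) = \<mu> * v $ i"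
        using arg_cong[OF v(2), of "\<lambda>x. x $ i"] by (simp add: matrix_vector_mult_def)
      ultimately show ?thesis
        by (simp add: matrix_vector_mult_def shift distrib_right sum.distrib)
    qed
    then have "(\<chi> i j. complex_of_real (shifted $ i $ j)) *v v = (- \<i> * \<Lambda>) *s v"
      by (simp add: vec_eq_iff \<Lambda>_def algebra_simps)
    moreover have "0 < Re \<Lambda>" using \<mu> by (simp add: \<Lambda>_def)
    ultimately have "v = 0" using no_unstable_limit_eigenvalue[OF stable] by blast
    with v(1) show False by simp
  qed
  have "weakly_hyperbolic \<Phi> c p\<^sub>0"
    unfolding weakly_hyperbolic_def
  proof (intro allI impI)
    fix \<mu> assume \<mu>: "characteristic_speed \<Phi> c p\<^sub>0 \<mu>"
    have "\<not> Im \<mu> < 0" using no_neg \<mu> by blast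
    moreover have "\<not> Im (cnj \<mu>) < 0" using no_neg characteristic_speed_cnj[OF \<mu>] by blast
    ultimately show "\<mu> \<in> \<real>" by (simp add: complex_is_Real_iff)
  qed
  then show ?thesis by (simp add: p\<^sub>0_def \<psi>_def)
qed

end
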